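(* Let $\eta$ be a Lévy noise on $\Gamma$ with Lévy characteristic $\psi$ whose Lévy measure has finite moments of all even orders $2n$, $n\ge0$, and let $P_\psi$ be its law on $S'(\Gamma)$. Then there exists a version of $G*\eta$ such that $G*\eta\in\mathcal M_b$ $P_\psi$-almost surely.
   Context: Fix an integer $d\ge1$ and reals $\delta>0$, $m_0>0$. Let $L_\delta=\delta\mathbb Z^d$ and $\Gamma=\mathbb R\times L_\delta$, with points $x=(t,\mathbf x)$ and $|x|^2=t^2+|\mathbf x|^2$; $\int g(x)\,dx=\sum_{\mathbf x\in L_\delta}\delta^d\int_{\mathbb R}g(t,\mathbf x)\,dt$; $\Gamma_+=\{(t,\mathbf x)\in\Gamma:t>0\}$. $S(\Gamma)$ is the Schwartz space of rapidly decreasing functions on $\Gamma$, $S'(\Gamma)$ its dual with the $\sigma$-algebra generated by cylinder sets. Let $\mu^2(\mathbf p)=2\delta^{-2}\big(d-\sum_{j=1}^d\cos(\delta p_j)\big)+m_0^2$ and $G(t,\mathbf x)=\theta(t)(2\pi)^{-d}\int_{[0,2\pi/\delta]^d}e^{-i\mathbf p\cdot\mathbf x}e^{-t\mu^2(\mathbf p)}\,d\mathbf p$, with $\theta(t)=1$ if $t>0$ and $\theta(t)=0$ otherwise. Lévy characteristic: $\psi(t)=i\bar at-\frac{\sigma^2t^2}2+\int_{\mathbb R\setminus\{0\}}\big(e^{ist}-1-\frac{ist}{1+s^2}\big)dM(s)$ with $\bar a\in\mathbb R$, $\sigma^2\ge0$ and $M$ a Lévy measure; it is assumed that $\int_{\mathbb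 R\setminus\{0\}}s^{2n}\,dM(s)<\infty$ for all integers $n\ge0$ (in particular $M$ is finite), so that equivalently $\psi(t)=iat-\frac{\sigma^2t^2}2+z\int_{\mathbb R\setminus\{0\}}(e^{ist}-1)\,dr(s)$ with $z=M(\mathbb R\setminus\{0\})$, $r=M/z$, $a=\bar a-\int\frac{s}{1+s^2}dM(s)$. $P_\psi$ is the unique probability measure on $S'(\Gamma)$ with $\int_{S'(\Gamma)}e^{i\langle g,\xi\rangle}dP_\psi(\xi)=\exp\big(\int_{\Gamma_+}\psi(g(x))\,dx\big)$ for all $g\in S(\Gamma)$, and the Lévy noise is the coordinate process $\eta(g)(\omega)=\omega(g)$ on $(S'(\Gamma),P_\psi)$. $G*\eta$ is the random distribution $(G*\eta)(\varphi)=\eta\big(\int G(x-\cdot)\varphi(x)\,dx\big)$, $\varphi\in S(\Gamma)$; a version of it in $\mathcal M_b$ is a random function lying in $\mathcal M_b$ that represents this distribution. $\mathcal M_b$ is the space of measurable $g:\Gamma\to\mathbb R$ such that for every $k\in\mathbb N$ there is $N\in\mathbb N$ with $\int\frac{|g(x)|^k}{(1+|x|^2)^N}\,dx<\infty$. *)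

theory Defs
  imports "HOL-Probability.Probability"
begin

text \<open>The dimension \<open>d \<ge> 1\<close> is \<open>CARD('d)\<close>. A function on \<open>\<Gamma> = \<real> \<times> \<delta>\<int>\<^sup>d\<close> is a function on the ambient
  type \<open>real \<times> (real ^ 'd)\<close> of which only the values on \<open>\<Gamma>\<close> matter. The product norm on this type is
  exactly \<open>|(t, x)|\<^sup>2 = t\<^sup>2 + |x|\<^sup>2\<close>.\<close>

type_synonym 'd point = "real \<times> (real ^ 'd)"
type_synonym 'd fn = "'d point \<Rightarrow> real"

definition lattice :: "real \<Rightarrow> (real ^ 'd::finite) set" where
  "lattice \<delta> = {x. \<forall>i. \<exists>n::int. x $ i = \<delta> * of_int n}"

definition Gam :: "real \<Rightarrow> 'd::finite point set" where
  "Gam \<delta> = UNIV \<times> lattice \<delta>"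

definition Gam_plus :: "real \<Rightarrow> 'd::finite point set" where
  "Gam_plus \<delta> = {0<..} \<times> lattice \<delta>"

text \<open>The measure \<open>dx\<close>: Lebesgue measure in time, mass \<open>\<delta>\<^sup>d\<close> at each lattice point.\<close>

definition Gam_measure :: "real \<Rightarrow> 'd::finite point measure" where
  "Gam_measure \<delta> =
     lborel \<Otimes>\<^sub>M scale_measure (ennreal (\<delta> ^ CARD('d))) (count_space (lattice \<delta>))"

definition time_deriv :: "nat \<Rightarrow> 'd::finite fn \<Rightarrow> 'd fn" where
  "time_deriv k g = (\<lambda>(t, x). (deriv ^^ k) (\<lambda>s. g (s, x)) t)"

text \<open>Real-valued Schwartz functions on \<open>\<Gamma>\<close>, normalised to vanish off \<open>\<Gamma>\<close> so that each function on
  \<open>\<Gamma>\<close> has exactly one representative. Only time derivatives are needed: the lattice directions are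
  discrete.\<close>

definition schwartz :: "real \<Rightarrow> 'd::finite fn set" where
  "schwartz \<delta> = {g.
     (\<forall>x. x \<notin> Gam \<delta> \<longrightarrow> g x = 0) \<and>
     (\<forall>k. \<forall>x\<in>lattice \<delta>. \<forall>t. (deriv ^^ k) (\<lambda>s. g (s, x)) differentiable (at t)) \<and>
     (\<forall>N k. bdd_above ((\<lambda>x. (1 + (norm x)\<^sup>2) ^ N * \<bar>time_deriv k g x\<bar>) ` Gam \<delta>))}"

definition schwartz_seminorm :: "real \<Rightarrow> nat \<Rightarrow> nat \<Rightarrow> 'd::finite fn \<Rightarrow> real" where
  "schwartz_seminorm \<delta> N k g = (SUP x\<in>Gam \<delta>. (1 + (norm x)\<^sup>2) ^ N * \<bar>time_deriv k g x\<bar>)"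

definition schwartz_topology :: "real \<Rightarrow> 'd::finite fn topology" where
  "schwartz_topology \<delta> = topology_generated_by
     {{h \<in> schwartz \<delta>. schwartz_seminorm \<delta> N k (\<lambda>x. h x - g x) < \<epsilon>} | g N k \<epsilon>.
        g \<in> schwartz \<delta> \<and> 0 < \<epsilon>}"

text \<open>The topological dual \<open>S'(\<Gamma>)\<close>; its elements are functions with domain \<open>schwartz \<delta>\<close>, hence the
  extensionality condition.\<close>

definition schwartz_dual :: "real \<Rightarrow> ('d::finite fn \<Rightarrow> real) set" where
  "schwartz_dual \<delta> = {\<omega> \<in> extensional (schwartz \<delta>).
     (\<forall>g\<in>schwartz \<delta>. \<forall>h\<in>schwartz \<delta>. \<omega> (\<lambda>x. g x + h x) = \<omega> g + \<omega> h) \<and>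
     (\<forall>c. \<forall>g\<in>schwartz \<delta>. \<omega> (\<lambda>x. c * g x) = c * \<omega> g) \<and>
     continuous_map (schwartz_topology \<delta>) euclideanreal \<omega>}"

definition cylinder_sets :: "real \<Rightarrow> ('d::finite fn \<Rightarrow> real) set set" where
  "cylinder_sets \<delta> = {{\<omega> \<in> schwartz_dual \<delta>. restrict \<omega> J \<in> B} | J B.
     finite J \<and> J \<subseteq> schwartz \<delta> \<and> B \<in> sets (Pi\<^sub>M J (\<lambda>_. borel))}"

text \<open>The symbol \<open>\<mu>\<^sup>2(p)\<close> and the Green function \<open>G\<close>. The Fourier integral defining \<open>G\<close> is real at
  lattice points, since \<open>p \<mapsto> (2\<pi>/\<delta>)(1,\<dots>,1) - p\<close> conjugates its integrand; \<open>Re\<close> is only a change of type.\<close>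

definition mu_sq :: "real \<Rightarrow> real \<Rightarrow> real ^ 'd::finite \<Rightarrow> real" where
  "mu_sq \<delta> m0 p = 2 / \<delta>\<^sup>2 * (real CARD('d) - (\<Sum>j\<in>UNIV. cos (\<delta> * p $ j))) + m0\<^sup>2"

definition Green :: "real \<Rightarrow> real \<Rightarrow> 'd::finite fn" where
  "Green \<delta> m0 = (\<lambda>(t, x). (if t > 0 then 1 else 0) / (2 * pi) ^ CARD('d) *
     Re (CLINT p:cbox 0 (\<chi> i. 2 * pi / \<delta>)|lborel.
           exp (- \<i> * of_real (p \<bullet> x)) * of_real (exp (- t * mu_sq \<delta> m0 p))))"

definition levy_measure :: "real measure \<Rightarrow> bool" where
  "levy_measure M \<longleftrightarrow> sets M = sets (restrict_space borel (UNIV - {0})) \<and>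
     (\<integral>\<^sup>+ s. ennreal (min 1 (s\<^sup>2)) \<partial>M) < \<infinity>"

text \<open>The parameter \<open>v\<close> is \<open>\<sigma>\<^sup>2\<close>.\<close>

definition levy_char :: "real \<Rightarrow> real \<Rightarrow> real measure \<Rightarrow> real \<Rightarrow> complex" where
  "levy_char a v M t = \<i> * of_real (a * t) - of_real (v * t\<^sup>2 / 2) +
     (CLINT s|M. exp (\<i> * of_real (s * t)) - 1 - \<i> * of_real (s * t / (1 + s\<^sup>2)))"

definition levy_noise_law ::
    "real \<Rightarrow> (real \<Rightarrow> complex) \<Rightarrow> ('d::finite fn \<Rightarrow> real) measure \<Rightarrow> bool" where
  "levy_noise_law \<delta> \<psi> P \<longleftrightarrow>
     prob_space P \<and>
     space P = schwartz_dual \<delta> \<and>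
     sets P = sigma_sets (schwartz_dual \<delta>) (cylinder_sets \<delta>) \<and>
     (\<forall>g\<in>schwartz \<delta>. (CLINT \<omega>|P. exp (\<i> * of_real (\<omega> g))) =
        exp (CLINT x:Gam_plus \<delta>|Gam_measure \<delta>. \<psi> (g x)))"

text \<open>\<open>conv_noise \<delta> m0 \<phi> \<omega>\<close> is \<open>(G * \<eta>)(\<phi>)\<close> at \<open>\<omega>\<close>, for the coordinate process \<open>\<eta>(g)(\<omega>) = \<omega> g\<close>.\<close>

definition Green_adjoint :: "real \<Rightarrow> real \<Rightarrow> 'd::finite fn \<Rightarrow> 'd fn" where
  "Green_adjoint \<delta> m0 \<phi> =
     (\<lambda>y. if y \<in> Gam \<delta> then (LINT x|Gam_measure \<delta>. Green \<delta> m0 (x - y) * \<phi> x) else 0)"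

definition conv_noise ::
    "real \<Rightarrow> real \<Rightarrow> 'd::finite fn \<Rightarrow> ('d fn \<Rightarrow> real) \<Rightarrow> real" where
  "conv_noise \<delta> m0 \<phi> \<omega> = \<omega> (Green_adjoint \<delta> m0 \<phi>)"

definition M_b :: "real \<Rightarrow> 'd::finite fn set" where
  "M_b \<delta> = {g \<in> borel_measurable (Gam_measure \<delta>).
     \<forall>k::nat. \<exists>N::nat.
       (\<integral>\<^sup>+ x. ennreal (\<bar>g x\<bar> ^ k / (1 + (norm x)\<^sup>2) ^ N) \<partial>Gam_measure \<delta>) < \<infinity>}"

text \<open>A function version of \<open>G * \<eta>\<close>: a jointly measurable random function \<open>X\<close> that almost surely
  represents the random distribution, i.e. outside one null set the identity holds for all test
  functions. Integrability is stated since the Bochner integral is \<open>0\<close> otherwise.\<close>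

definition version_of_conv_noise ::
    "real \<Rightarrow> real \<Rightarrow> ('d::finite fn \<Rightarrow> real) measure \<Rightarrow> (('d fn \<Rightarrow> real) \<Rightarrow> 'd fn) \<Rightarrow> bool" where
  "version_of_conv_noise \<delta> m0 P X \<longleftrightarrow>
     (\<lambda>(\<omega>, x). X \<omega> x) \<in> borel_measurable (P \<Otimes>\<^sub>M Gam_measure \<delta>) \<and>
     (AE \<omega> in P. \<forall>\<phi>\<in>schwartz \<delta>.
        integrable (Gam_measure \<delta>) (\<lambda>x. X \<omega> x * \<phi> x) \<and>
        conv_noise \<delta> m0 \<phi> \<omega> = (LINT x|Gam_measure \<delta>. X \<omega> x * \<phi> x))"

end

theory Submission imports Defs "HOL-Computational_Algebra.Polynomial" begin

text \<open>
  Convolution with the reflected Green function maps Schwartz functions to Schwartz functions, so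
  \<open>T = \<omega> \<circ> (G * \<cdot>)\<close> is a tempered functional for every \<open>\<omega>\<close>. Mollifying by Gaussians \<open>r\<^sub>n\<close> in time gives
  honest random functions \<open>X\<^sub>n(x) = T(r\<^sub>n(\<cdot> - x))\<close>, which satisfy \<open>\<integral> X\<^sub>n \<phi> = T(r\<^sub>n * \<phi>)\<close> for every \<open>\<omega>\<close> and
  all \<open>\<phi>\<close> at once. The characteristic function bounds all even moments of \<open>\<omega>(g)\<close> by a multiple of
  \<open>\<parallel>g\<parallel>\<^sub>1\<close> as long as \<open>\<parallel>g\<parallel>\<^sub>1\<close> and \<open>\<parallel>g\<parallel>\<^sub>\<infinity>\<close> stay bounded. The kernels of \<open>X\<^sub>n\<close> are bounded and converge in
  \<open>L\<^sup>1\<close>, although the Green function jumps at time \<open>0\<close>; hence the moments of \<open>X\<^sub>n(x)\<close> are bounded uniformly in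
  \<open>n\<close> and \<open>x\<close>, and along a subsequence the increments of \<open>X\<^sub>n\<close> are summable, almost surely almost
  everywhere and in a weighted \<open>L\<^sup>1\<close> space. The limit is the required version, and Fubini's theorem turns
  the uniform moment bounds into membership in \<open>M_b\<close>.
\<close>

text \<open>The represented identity must hold for uncountably many test functions outside one null
  set, and the reflected Green function, having a jump at time 0, is no test function, so it cannot
  be fed to \<open>\<omega>\<close> directly. Hence everything concerning \<open>\<phi>\<close> is
  done for one fixed \<open>\<omega>\<close> from a seminorm bound, and probability only shows that
  a majorant independent of \<open>\<phi>\<close> is finite almost surely. Exchanging
  \<open>\<omega>\<close> with an integral rests on an estimate: the error over a short time slab is
  quadratic in its length, one factor from Lipschitz dependence of translates and one from the mass
  of the slab, so the errors add up to zero. The moment bound has to be linear in the L1 norm, since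
  the jump rules out uniform convergence of the kernels; it is linear because every derivative of
  \<open>exp L\<close> carries a derivative of \<open>L\<close> as a factor. Spatial decay of the
  Green function comes from expanding it into k-step lattice walks: an exponential weight multiplies
  the jump rate by a factor close to one, and the mass \<open>m0^2 > 0\<close> absorbs the
  excess.\<close>

section \<open>Weights and the measure on the lattice cylinder\<close>

definition wt :: "nat \<Rightarrow> 'a::real_normed_vector \<Rightarrow> real" where
  "wt N x = (1 + (norm x)\<^sup>2) ^ N"

lemma wt_ge_1: "1 \<le> wt N x"
  by (simp add: wt_def)

lemma wt_pos: "0 < wt N x"
  using wt_ge_1[of N x] by linarith

lemma wt_nonneg [simp]: "0 \<le> wt N x"
  using wt_ge_1[of N x] by linarith

lemma wt_0 [simp]: "wt 0 x = 1"
  by (simp add: wt_def)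

lemma wt_add: "wt (M + N) x = wt M x * wt N x"
  by (simp add: wt_def power_add)

lemma wt_minus [simp]: "wt N (- x) = wt N x"
  by (simp add: wt_def)

lemma wt_mono_norm: "norm x \<le> norm y \<Longrightarrow> wt N x \<le> wt N y"
  unfolding wt_def by (intro power_mono) (auto intro!: power_mono)

lemma wt_mono_exp: "M \<le> N \<Longrightarrow> wt M x \<le> wt N x"
  unfolding wt_def by (intro power_increasing) auto

lemma norm_le_wt: "norm x \<le> wt 1 x"
proof -
  have "0 \<le> (norm x - 1)\<^sup>2 + (norm x)\<^sup>2" by simp
  then have "norm x * 2 \<le> 2 + 2 * (norm x)\<^sup>2" by (simp add: power2_eq_square algebra_simps)
  then show ?thesis by (simp add: wt_def)
qed

text \<open>Peetre's inequality for the weight. It is the source of every compatibility of the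
  seminorms with translation and convolution below.\<close>

lemma wt_plus_le: "wt N (x + y) \<le> 2 ^ N * wt N x * wt N y"
proof -
  have "(norm (x + y))\<^sup>2 \<le> (norm x + norm y)\<^sup>2"
    by (intro power_mono norm_triangle_ineq) auto
  also have "\<dots> \<le> 2 * (norm x)\<^sup>2 + 2 * (norm y)\<^sup>2"
    using sum_squares_ge_zero[of "norm x - norm y" 0] by (simp add: power2_eq_square algebra_simps)
  finally have "1 + (norm (x + y))\<^sup>2 \<le> 2 * (1 + (norm x)\<^sup>2) * (1 + (norm y)\<^sup>2)"
    using mult_nonneg_nonneg[OF zero_le_power2[of "norm x"] zero_le_power2[of "norm y"]]
    unfolding distrib_left distrib_right by linarith
  then have "(1 + (norm (x + y))\<^sup>2) ^ N \<le> (2 * (1 + (norm x)\<^sup>2) * (1 + (norm y)\<^sup>2)) ^ N"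
    by (intro power_mono) auto
  then show ?thesis unfolding wt_def power_mult_distrib .
qed

lemma wt_measurable [measurable]: "wt N \<in> borel_measurable borel"
  unfolding wt_def[abs_def] by measurable

locale spacing =
  fixes \<delta> :: real
  assumes pos: "0 < \<delta>"
begin

abbreviation \<mu> :: "'d::finite point measure" where "\<mu> \<equiv> Gam_measure \<delta>"

abbreviation site_measure :: "(real ^ 'd::finite) measure" where
  "site_measure \<equiv> scale_measure (ennreal (\<delta> ^ CARD('d))) (count_space (lattice \<delta>))"

lemma lattice_eq_range: "lattice \<delta> = range (\<lambda>n::int^'d::finite. \<chi> i. \<delta> * of_int (n $ i))" (is "?L = range ?f")
proof
  show "?L \<subseteq> range ?f"
  proof
    fix x assume "x \<in> ?L"
    then obtain n where n: "\<And>i. x $ i = \<delta> * of_int (n i)" unfolding lattice_def by auto metis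
    then have "x = ?f (\<chi> i. n i)" by (simp add: vec_eq_iff)
    then show "x \<in> range ?f" by blast
  qed
qed (auto simp: lattice_def)

lemma countable_lattice [simp, intro]: "countable (lattice \<delta> :: (real^'d::finite) set)"
  by (subst lattice_eq_range) simp

lemma lattice_0 [simp, intro]: "0 \<in> lattice \<delta>"
  by (auto simp: lattice_def intro: exI[of _ 0])

lemma lattice_add [intro]: "x \<in> lattice \<delta> \<Longrightarrow> y \<in> lattice \<delta> \<Longrightarrow> x + y \<in> lattice \<delta>"
  unfolding lattice_def by auto (metis distrib_left of_int_add)

lemma lattice_uminus [intro]: "x \<in> lattice \<delta> \<Longrightarrow> - x \<in> lattice \<delta>"
  unfolding lattice_def by auto (metis mult_minus_right of_int_minus)

lemma lattice_diff [intro]: "x \<in> lattice \<delta> \<Longrightarrow> y \<in> lattice \<delta> \<Longrightarrow> x - y \<in> lattice \<delta>"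
  using lattice_add[of x "- y"] lattice_uminus by auto

lemma Gam_iff: "x \<in> Gam \<delta> \<longleftrightarrow> snd x \<in> lattice \<delta>"
  by (cases x) (auto simp: Gam_def)

lemma Gam_add [intro]: "x \<in> Gam \<delta> \<Longrightarrow> y \<in> Gam \<delta> \<Longrightarrow> x + y \<in> Gam \<delta>"
  and Gam_diff [intro]: "x \<in> Gam \<delta> \<Longrightarrow> y \<in> Gam \<delta> \<Longrightarrow> x - y \<in> Gam \<delta>"
  and Gam_uminus [intro]: "x \<in> Gam \<delta> \<Longrightarrow> - x \<in> Gam \<delta>"
  and Gam_0 [simp, intro]: "0 \<in> Gam \<delta>"
  by (auto simp: Gam_iff)

lemma Gam_diff_iff: "y \<in> Gam \<delta> \<Longrightarrow> x - y \<in> Gam \<delta> \<longleftrightarrow> x \<in> Gam \<delta>"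
  using Gam_add[of "x - y" y] by auto

lemma space_\<mu> [simp]: "space \<mu> = Gam \<delta>"
  by (simp add: Gam_measure_def space_pair_measure Gam_def space_scale_measure)

lemma sigma_finite_site: "sigma_finite_measure (site_measure :: (real^'d::finite) measure)"
proof
  show "\<exists>A. countable A \<and> A \<subseteq> sets (site_measure :: (real^'d) measure) \<and>
     \<Union> A = space site_measure \<and> (\<forall>a\<in>A. emeasure site_measure a \<noteq> \<infinity>)"
    by (intro exI[of _ "(\<lambda>y. {y}) ` lattice \<delta>"])
      (auto simp: space_scale_measure ennreal_mult_eq_top_iff)
qed

lemma pair_sigma_finite_\<mu>: "pair_sigma_finite lborel (site_measure :: (real^'d::finite) measure)"
  by (intro pair_sigma_finite.intro sigma_finite_site sigma_finite_lborel)

lemma sigma_finite_\<mu>: "sigma_finite_measure (\<mu> :: 'd::finite point measure)"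
proof -
  interpret pair_sigma_finite lborel "site_measure :: (real^'d) measure"
    by (rule pair_sigma_finite_\<mu>)
  show ?thesis unfolding Gam_measure_def by (rule sigma_finite_measure_axioms)
qed

lemma sets_\<mu>: "sets \<mu> = sets (lborel \<Otimes>\<^sub>M count_space (lattice \<delta>))"
  unfolding Gam_measure_def by (intro sets_pair_measure_cong) simp_all

lemma fst_measurable [measurable]: "fst \<in> \<mu> \<rightarrow>\<^sub>M borel"
  unfolding Gam_measure_def by simp

lemma snd_measurable_count: "snd \<in> \<mu> \<rightarrow>\<^sub>M count_space (lattice \<delta>)"
  unfolding measurable_cong_sets[OF sets_\<mu> refl] by simp

text \<open>The lattice is countable and carries the discrete sigma-algebra, so measurability can be
  tested on each time line separately. There it usually follows from continuity in time.\<close>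

lemma measurable_\<mu>_I:
  assumes "\<And>y. y \<in> lattice \<delta> \<Longrightarrow> (\<lambda>t. f (t, y)) \<in> borel \<rightarrow>\<^sub>M N"
  shows "f \<in> \<mu> \<rightarrow>\<^sub>M N"
proof -
  have "(\<lambda>x. (\<lambda>y x. f (fst x, y)) (snd x) x) \<in> \<mu> \<rightarrow>\<^sub>M N"
    by (rule measurable_compose_countable'[where I = "lattice \<delta>"])
      (simp_all add: measurable_compose[OF fst_measurable assms] snd_measurable_count)
  then show ?thesis by simp
qed

lemma measurable_\<mu>_D:
  assumes "f \<in> \<mu> \<rightarrow>\<^sub>M N" "y \<in> lattice \<delta>"
  shows "(\<lambda>t. f (t, y)) \<in> borel \<rightarrow>\<^sub>M N"
proof -
  have "(\<lambda>t. (t, y)) \<in> borel \<rightarrow>\<^sub>M \<mu>"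
    unfolding measurable_cong_sets[OF refl sets_\<mu>] using assms(2) by simp
  from measurable_compose[OF this assms(1)] show ?thesis .
qed

lemma borel_measurable_\<mu>:
  assumes "f \<in> borel \<rightarrow>\<^sub>M N"
  shows "f \<in> \<mu> \<rightarrow>\<^sub>M N"
proof (rule measurable_\<mu>_I)
  fix y :: "real^'a"
  have "(\<lambda>t::real. (t, y)) \<in> borel \<rightarrow>\<^sub>M borel"
    by (intro borel_measurable_continuous_onI continuous_intros)
  from measurable_compose[OF this assms] show "(\<lambda>t. f (t, y)) \<in> borel \<rightarrow>\<^sub>M N" .
qed

lemma nn_integral_\<mu>:
  fixes f :: "'d::finite point \<Rightarrow> ennreal"
  assumes [measurable]: "f \<in> borel_measurable \<mu>"
  shows "(\<integral>\<^sup>+x. f x \<partial>\<mu>) =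
    ennreal (\<delta> ^ CARD('d)) * (\<integral>\<^sup>+y. (\<integral>\<^sup>+t. f (t, y) \<partial>lborel) \<partial>count_space (lattice \<delta>))"
proof -
  interpret pair_sigma_finite lborel "site_measure :: (real^'d) measure"
    by (rule pair_sigma_finite_\<mu>)
  have "(\<integral>\<^sup>+x. f x \<partial>\<mu>) = (\<integral>\<^sup>+y. (\<integral>\<^sup>+t. f (t, y) \<partial>lborel) \<partial>site_measure)"
    using assms unfolding Gam_measure_def
    by (simp add: nn_integral_snd)
  also have "\<dots> = ennreal (\<delta> ^ CARD('d)) * (\<integral>\<^sup>+y. (\<integral>\<^sup>+t. f (t, y) \<partial>lborel) \<partial>count_space (lattice \<delta>))"
    by (rule nn_integral_scale_measure) simp
  finally show ?thesis .
qed

lemma affine_measurable: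
  assumes "c = 1 \<or> c = -1" "a \<in> Gam \<delta>"
  shows "(\<lambda>x. a + c *\<^sub>R x) \<in> \<mu> \<rightarrow>\<^sub>M \<mu>"
proof -
  have l: "snd a + c *\<^sub>R y \<in> lattice \<delta>" if "y \<in> lattice \<delta>" for y :: "real^'a"
    using assms that lattice_diff[of "snd a" y] lattice_add[of "snd a" y] by (auto simp: Gam_iff)
  have "(\<lambda>x. a + c *\<^sub>R x) \<in> \<mu> \<rightarrow>\<^sub>M lborel \<Otimes>\<^sub>M count_space (lattice \<delta>)"
  proof (rule measurable_\<mu>_I)
    fix y :: "real^'a" assume "y \<in> lattice \<delta>"
    from l[OF this] have "(\<lambda>t. (fst a + c * t, snd a + c *\<^sub>R y)) \<in> borel \<rightarrow>\<^sub>M lborel \<Otimes>\<^sub>M count_space (lattice \<delta>)"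
      by (intro measurable_Pair) simp_all
    then show "(\<lambda>t. a + c *\<^sub>R (t, y)) \<in> borel \<rightarrow>\<^sub>M lborel \<Otimes>\<^sub>M count_space (lattice \<delta>)"
      by (simp add: plus_prod_def)
  qed
  then show ?thesis unfolding measurable_cong_sets[OF refl sets_\<mu>] .
qed

text \<open>\<open>c = 1\<close> gives translations and \<open>c = -1\<close> point reflections.
  Lebesgue measure is invariant under both on each time line, and both permute the lattice.\<close>

lemma distr_affine:
  assumes c: "c = 1 \<or> c = -1" and a: "a \<in> Gam \<delta>"
  shows "distr \<mu> \<mu> (\<lambda>x. a + c *\<^sub>R x) = (\<mu> :: 'd::finite point measure)"
proof (rule measure_eqI)
  fix A :: "'d point set" assume "A \<in> sets (distr \<mu> \<mu> (\<lambda>x. a + c *\<^sub>R x))"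
  then have A[measurable]: "A \<in> sets \<mu>" by simp
  note [measurable] = affine_measurable[OF c a]
  have "emeasure (distr \<mu> \<mu> (\<lambda>x. a + c *\<^sub>R x)) A = (\<integral>\<^sup>+x. indicator A x \<partial>distr \<mu> \<mu> (\<lambda>x. a + c *\<^sub>R x))"
    by simp
  also have "\<dots> = (\<integral>\<^sup>+x. indicator A (a + c *\<^sub>R x) \<partial>\<mu>)"
    by (rule nn_integral_distr) measurable
  also have "\<dots> = ennreal (\<delta> ^ CARD('d)) *
      (\<integral>\<^sup>+y. (\<integral>\<^sup>+t. indicator A (fst a + c * t, snd a + c *\<^sub>R y) \<partial>lborel) \<partial>count_space (lattice \<delta>))"
    using measurable_compose[OF affine_measurable[OF c a] borel_measurable_indicator[OF A]]
    by (subst nn_integral_\<mu>) (simp_all add: plus_prod_def)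
  also have "(\<integral>\<^sup>+y. (\<integral>\<^sup>+t. indicator A (fst a + c * t, snd a + c *\<^sub>R y) \<partial>lborel) \<partial>count_space (lattice \<delta>))
    = (\<integral>\<^sup>+y. (\<integral>\<^sup>+t. indicator A (t, snd a + c *\<^sub>R y) \<partial>lborel) \<partial>count_space (lattice \<delta>))"
  proof (rule nn_integral_cong)
    fix y :: "real^'d" assume "y \<in> space (count_space (lattice \<delta>))"
    then have y: "snd a + c *\<^sub>R y \<in> lattice \<delta>" using c a by (auto simp: Gam_iff)
    have [measurable]: "(\<lambda>t. indicator A (t, snd a + c *\<^sub>R y) :: ennreal) \<in> borel_measurable borel"
      by (rule measurable_\<mu>_D[OF _ y]) measurable
    show "(\<integral>\<^sup>+t. indicator A (fst a + c * t, snd a + c *\<^sub>R y) \<partial>lborel) =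
      (\<integral>\<^sup>+t. indicator A (t, snd a + c *\<^sub>R y) \<partial>lborel)"
      using c by (subst (2) nn_integral_real_affine[where c = c and t = "fst a"]) auto
  qed
  also have "\<dots> = (\<integral>\<^sup>+y. (\<integral>\<^sup>+t. indicator A (t, y) \<partial>lborel) \<partial>count_space (lattice \<delta>))"
  proof (rule nn_integral_bij_count_space)
    have "snd a \<in> lattice \<delta>" using a by (simp add: Gam_iff)
    then have "snd a + c *\<^sub>R y \<in> lattice \<delta>" "c *\<^sub>R (y - snd a) \<in> lattice \<delta>" if "y \<in> lattice \<delta>" for y
      using c that lattice_diff[of y "snd a"] lattice_diff[of "snd a" y] lattice_add[of "snd a" y] by auto
    then show "bij_betw (\<lambda>y. snd a + c *\<^sub>R y) (lattice \<delta>) (lattice \<delta>)"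
      using c by (intro bij_betwI[where g = "\<lambda>y. c *\<^sub>R (y - snd a)"]) (simp_all add: Pi_iff, (elim disjE; simp)+)
  qed
  also have "ennreal (\<delta> ^ CARD('d)) * \<dots> = (\<integral>\<^sup>+x. indicator A x \<partial>\<mu>)"
    by (subst nn_integral_\<mu>) auto
  finally show "emeasure (distr \<mu> \<mu> (\<lambda>x. a + c *\<^sub>R x)) A = emeasure \<mu> A" by simp
qed simp

lemma
  fixes f :: "'d::finite point \<Rightarrow> 'b::{banach, second_countable_topology}"
  assumes f: "f \<in> borel_measurable \<mu>" and a: "a \<in> Gam \<delta>"
  shows integral_shift: "(LINT x|\<mu>. f (a + x)) = (LINT x|\<mu>. f x)"
    and integral_reflect: "(LINT x|\<mu>. f (a - x)) = (LINT x|\<mu>. f x)"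
    and integrable_reflect: "integrable \<mu> (\<lambda>x. f (a - x)) \<longleftrightarrow> integrable \<mu> f"
    and measurable_shift: "(\<lambda>x. f (a + x)) \<in> borel_measurable \<mu>"
    and measurable_reflect: "(\<lambda>x. f (a - x)) \<in> borel_measurable \<mu>"
proof -
  note m1 = affine_measurable[of 1 a, simplified, OF a]
  note m2 = affine_measurable[of "-1" a, simplified, OF a]
  note d1 = distr_affine[of 1 a, simplified, OF a]
  note d2 = distr_affine[of "-1" a, simplified, OF a]
  show "(LINT x|\<mu>. f (a + x)) = (LINT x|\<mu>. f x)"
    using integral_distr[OF m1 f] unfolding d1 by (rule sym)
  show "(LINT x|\<mu>. f (a - x)) = (LINT x|\<mu>. f x)"
    using integral_distr[OF m2 f] unfolding d2 by (rule sym)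
  show "integrable \<mu> (\<lambda>x. f (a - x)) \<longleftrightarrow> integrable \<mu> f"
    using integrable_distr_eq[OF m2 f] unfolding d2 by (rule sym)
  show "(\<lambda>x. f (a + x)) \<in> borel_measurable \<mu>"
    by (rule measurable_compose[OF m1 f])
  show "(\<lambda>x. f (a - x)) \<in> borel_measurable \<mu>"
    by (rule measurable_compose[OF m2 f])
qed

lemma nn_integral_shift:
  fixes f :: "'d::finite point \<Rightarrow> ennreal"
  assumes f: "f \<in> borel_measurable \<mu>" and a: "a \<in> Gam \<delta>"
  shows "(\<integral>\<^sup>+x. f (a + x) \<partial>\<mu>) = (\<integral>\<^sup>+x. f x \<partial>\<mu>)"
proof -
  note m = affine_measurable[of 1 a, simplified, OF a]
  note d = distr_affine[of 1 a, simplified, OF a]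
  show ?thesis
    by (rule nn_integral_distr[OF m, of f, unfolded d, OF f, symmetric])
qed

lemma Gam_plus_sets [measurable]: "Gam_plus \<delta> \<in> sets (\<mu> :: 'd::finite point measure)"
  unfolding sets_\<mu> Gam_plus_def by (intro pair_measureI) auto

end

section \<open>Differentiation under the integral sign\<close>

lemma has_vector_derivative_iff_quotient:
  "(g has_vector_derivative D) (at t) \<longleftrightarrow> ((\<lambda>s. (g s - g t) /\<^sub>R (s - t)) \<longlongrightarrow> D) (at t)"
proof -
  have "norm (g s - g t - (s - t) *\<^sub>R D) / norm (s - t) = norm ((g s - g t) /\<^sub>R (s - t) - D)"
    if "s \<noteq> t" for s
  proof -
    have "(g s - g t) /\<^sub>R (s - t) - D = (g s - g t - (s - t) *\<^sub>R D) /\<^sub>R (s - t)"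
      using that by (simp add: scaleR_diff_right)
    then show ?thesis by (simp add: divide_inverse mult.commute)
  qed
  then have "((\<lambda>s. norm (g s - g t - (s - t) *\<^sub>R D) / norm (s - t)) \<longlongrightarrow> 0) (at t) \<longleftrightarrow>
    ((\<lambda>s. norm ((g s - g t) /\<^sub>R (s - t) - D)) \<longlongrightarrow> 0) (at t)"
    by (intro Lim_cong_within) auto
  then show ?thesis
    by (simp add: has_vector_derivative_def has_derivative_iff_norm bounded_linear_scaleR_left
        tendsto_norm_zero_iff LIM_zero_iff)
qed

text \<open>The mean value inequality bounds the difference quotients by \<open>B\<close>, and
  dominated convergence applies along every sequence tending to \<open>t\<close>. Values in a Banach
  space allow the use for real convolutions and for complex characteristic exponents alike.\<close>

lemma has_vector_derivative_lebesgue_integral: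
  fixes f :: "real \<Rightarrow> 'a \<Rightarrow> 'b::{banach, second_countable_topology}"
  assumes e: "0 < e"
    and f: "\<And>s. \<bar>s - t\<bar> < e \<Longrightarrow> integrable M (f s)"
    and f': "\<And>s x. \<bar>s - t\<bar> < e \<Longrightarrow> x \<in> space M \<Longrightarrow> ((\<lambda>s. f s x) has_vector_derivative f' s x) (at s)"
    and B: "\<And>s x. \<bar>s - t\<bar> < e \<Longrightarrow> x \<in> space M \<Longrightarrow> norm (f' s x) \<le> B x"
    and int_B: "integrable M B"
  shows "((\<lambda>s. \<integral>x. f s x \<partial>M) has_vector_derivative (\<integral>x. f' t x \<partial>M)) (at t)"
    and "integrable M (f' t)"
proof -
  let ?Q = "\<lambda>s x. (f s x - f t x) /\<^sub>R (s - t)"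
  have bnd: "norm (?Q s x) \<le> B x" if s: "\<bar>s - t\<bar> < e" and x: "x \<in> space M" and "s \<noteq> t" for s x
  proof -
    have "norm (f s x - f t x) \<le> B x * norm (s - t)"
    proof (rule differentiable_bound[where S = "{t - e<..<t + e}" and f' = "\<lambda>s h. h *\<^sub>R f' s x"])
      fix u assume "u \<in> {t - e<..<t + e}"
      then have u: "\<bar>u - t\<bar> < e" by auto
      show "((\<lambda>s. f s x) has_derivative (\<lambda>h. h *\<^sub>R f' u x)) (at u within {t - e<..<t + e})"
        using f'[OF u x] unfolding has_vector_derivative_def by (rule has_derivative_at_withinI)
      show "onorm (\<lambda>h. h *\<^sub>R f' u x) \<le> B x"
        by (rule onorm_le) (use B[OF u x] in \<open>simp add: mult.commute[of "B x"] mult_left_mono\<close>)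
    qed (use s e in auto)
    then have "norm (f s x - f t x) / \<bar>s - t\<bar> \<le> B x"
      using \<open>s \<noteq> t\<close> by (simp add: pos_divide_le_eq)
    then show ?thesis by (simp add: divide_inverse mult.commute)
  qed
  have key: "integrable M (f' t) \<and> (\<lambda>n. \<integral>x. ?Q (X n) x \<partial>M) \<longlonglongrightarrow> (\<integral>x. f' t x \<partial>M)"
    if X: "X \<longlonglongrightarrow> t" "\<And>n. X n \<noteq> t" "\<And>n. \<bar>X n - t\<bar> < e" for X
  proof -
    have lim: "(\<lambda>n. ?Q (X n) x) \<longlonglongrightarrow> f' t x" if x: "x \<in> space M" for x
    proof -
      have "((\<lambda>s. ?Q s x) \<longlongrightarrow> f' t x) (at t)"
        using f'[OF _ x, of t] e unfolding has_vector_derivative_iff_quotient by simp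
      then show ?thesis
        by (rule filterlim_compose) (use X in \<open>auto simp: filterlim_at\<close>)
    qed
    have Qm: "?Q (X n) \<in> borel_measurable M" for n
      using f[of "X n"] f[of t] X e by auto
    have m: "f' t \<in> borel_measurable M"
      by (rule borel_measurable_LIMSEQ_metric[where f = "\<lambda>n. ?Q (X n)"]) (use Qm lim in auto)
    have AEs: "AE x in M. (\<lambda>n. ?Q (X n) x) \<longlonglongrightarrow> f' t x" using lim by auto
    have AEb: "AE x in M. norm (?Q (X n) x) \<le> B x" for n using bnd X by auto
    show ?thesis
      using integrable_dominated_convergence[OF m Qm int_B AEs AEb] integral_dominated_convergence[OF m Qm int_B AEs AEb]
      by auto
  qed
  \<comment> \<open>Integrability of the limit needs only one admissible sequence; the denominators
    start at 2 so that every term is strictly closer to \<open>t\<close> than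
    \<open>e\<close>.\<close>
  have "integrable M (f' t) \<and> (\<lambda>n. \<integral>x. ?Q (t + e / (n + 2)) x \<partial>M) \<longlonglongrightarrow> (\<integral>x. f' t x \<partial>M)"
  proof (rule key)
    have "(\<lambda>n. e / (real n + 2)) \<longlonglongrightarrow> 0" by real_asymp
    then show "(\<lambda>n. t + e / (real n + 2)) \<longlonglongrightarrow> t" using tendsto_add[OF tendsto_const] by fastforce
  qed (use e in \<open>auto simp: field_simps add_pos_nonneg\<close>)
  then show "integrable M (f' t)" by blast
  have "((\<lambda>s. ((\<integral>x. f s x \<partial>M) - (\<integral>x. f t x \<partial>M)) /\<^sub>R (s - t)) \<longlongrightarrow> (\<integral>x. f' t x \<partial>M)) (at t)"
    unfolding tendsto_at_iff_sequentially
  proof (intro allI impI)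
    fix X assume X: "\<forall>n. X n \<in> UNIV - {t}" "X \<longlonglongrightarrow> t"
    then obtain N where N: "\<And>n. n \<ge> N \<Longrightarrow> \<bar>X n - t\<bar> < e"
      using e unfolding LIMSEQ_def dist_real_def by metis
    have "(\<lambda>n. \<integral>x. ?Q (X (n + N)) x \<partial>M) \<longlonglongrightarrow> (\<integral>x. f' t x \<partial>M)"
      using key[of "\<lambda>n. X (n + N)"] X N by (auto intro: LIMSEQ_ignore_initial_segment)
    moreover have "(\<integral>x. ?Q (X (n + N)) x \<partial>M) = ((\<integral>x. f (X (n + N)) x \<partial>M) - (\<integral>x. f t x \<partial>M)) /\<^sub>R (X (n + N) - t)" for n
      using f[of "X (n + N)"] f[of t] N e by simp
    ultimately have "(\<lambda>n. ((\<integral>x. f (X (n + N)) x \<partial>M) - (\<integral>x. f t x \<partial>M)) /\<^sub>R (X (n + N) - t)) \<longlonglongrightarrow> (\<integral>x. f' t x \<partial>M)"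
      by (simp only:)
    then show "((\<lambda>s. ((\<integral>x. f s x \<partial>M) - (\<integral>x. f t x \<partial>M)) /\<^sub>R (s - t)) \<circ> X) \<longlonglongrightarrow> (\<integral>x. f' t x \<partial>M)"
      unfolding o_def by (rule LIMSEQ_offset)
  qed
  then show "((\<lambda>s. \<integral>x. f s x \<partial>M) has_vector_derivative (\<integral>x. f' t x \<partial>M)) (at t)"
    unfolding has_vector_derivative_iff_quotient .
qed

context spacing begin

section \<open>Integrability of inverse powers of the weight\<close>

lemma summable_lattice_1: "(\<lambda>n::int. 1 / (1 + (\<delta> * of_int n)\<^sup>2)) summable_on UNIV"
proof -
  have "summable (\<lambda>n::nat. 1 / \<delta>\<^sup>2 * (1 / real n ^ 2))"
    by (intro summable_mult) (use inverse_power_summable[of 2, where 'a = real] in \<open>simp add: inverse_eq_divide\<close>)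
  moreover have "norm (norm (1 / (1 + (\<delta> * real n)\<^sup>2))) \<le> 1 / \<delta>\<^sup>2 * (1 / real n ^ 2)" if "n \<ge> 1" for n
  proof -
    have p: "0 < (\<delta> * real n)\<^sup>2" using pos that by simp
    have "1 / (1 + (\<delta> * real n)\<^sup>2) \<le> 1 / (\<delta> * real n)\<^sup>2"
      using p by (intro divide_left_mono mult_pos_pos add_pos_pos) simp_all
    then show ?thesis by (simp add: power_mult_distrib)
  qed
  ultimately have "summable (\<lambda>n::nat. norm (1 / (1 + (\<delta> * n)\<^sup>2)))"
    by (rule summable_comparison_test'[where N = 1])
  then have s: "(\<lambda>n::nat. 1 / (1 + (\<delta> * n)\<^sup>2)) summable_on UNIV"
    by (rule norm_summable_imp_summable_on)
  have 1: "(\<lambda>n::int. 1 / (1 + (\<delta> * of_int n)\<^sup>2)) summable_on range int"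
    using s by (subst summable_on_reindex) (simp_all add: o_def)
  have 2: "(\<lambda>n::int. 1 / (1 + (\<delta> * of_int n)\<^sup>2)) summable_on range (\<lambda>n. - int n)"
    using s by (subst summable_on_reindex) (simp_all add: o_def inj_on_def)
  have "x \<in> range int \<union> range (\<lambda>n. - int n)" for x by (cases x rule: int_cases2) blast+
  then have "UNIV = range int \<union> range (\<lambda>n. - int n)" by blast
  with summable_on_union[OF 1 2] show ?thesis by simp
qed

text \<open>Parametrised by integer-valued functions on the coordinates, the sum over the lattice
  becomes a product of one-dimensional sums, each of which converges.\<close>

lemma nn_integral_lattice_prod:
  "(\<integral>\<^sup>+y. ennreal (\<Prod>j\<in>UNIV. 1 / (1 + (y $ j)\<^sup>2)) \<partial>count_space (lattice \<delta> :: (real^'d::finite) set)) < \<infinity>"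
proof -
  let ?f = "\<lambda>n::int. 1 / (1 + (\<delta> * of_int n)\<^sup>2)"
  have "Infinite_Set_Sum.abs_summable_on ?f UNIV"
    unfolding abs_summable_equivalent[symmetric] using summable_lattice_1 by simp
  then have "Infinite_Set_Sum.abs_summable_on (\<lambda>g. \<Prod>j\<in>(UNIV::'d set). ?f (g j)) (PiE UNIV (\<lambda>_. UNIV))"
    by (intro abs_summable_on_prod_PiE) auto
  then have "integrable (count_space UNIV) (\<lambda>g. \<Prod>j\<in>(UNIV::'d set). ?f (g j))"
    unfolding Infinite_Set_Sum.abs_summable_on_def by (simp add: PiE_def Pi_def)
  then have fin: "(\<integral>\<^sup>+g. ennreal (\<Prod>j\<in>(UNIV::'d set). ?f (g j)) \<partial>count_space UNIV) < \<infinity>"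
    by (simp add: integrable_iff_bounded abs_prod)
  have "bij_betw (\<lambda>g::'d \<Rightarrow> int. (\<chi> j. \<delta> * of_int (g j)) :: real^'d) UNIV (lattice \<delta>)"
  proof (rule bij_betwI')
    fix y :: "real^'d" assume "y \<in> lattice \<delta>"
    then have "\<forall>i. \<exists>n::int. y $ i = \<delta> * of_int n" by (simp add: lattice_def)
    then obtain n where "\<And>i. y $ i = \<delta> * of_int (n i :: int)" by metis
    then show "\<exists>g\<in>UNIV. y = (\<chi> j. \<delta> * of_int (g j))" by (intro bexI[of _ n]) (simp_all add: vec_eq_iff)
  qed (use pos in \<open>auto simp: vec_eq_iff fun_eq_iff lattice_def\<close>)
  from nn_integral_bij_count_space[OF this, of "\<lambda>y. ennreal (\<Prod>j\<in>UNIV. 1 / (1 + (y $ j)\<^sup>2))"] fin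
  show ?thesis by simp
qed

text \<open>The weight \<open>(1 + |x|\<^sup>2)\<^sup>d\<^sup>+\<^sup>1\<close> dominates \<open>(1 + t\<^sup>2) \<Prod>\<^sub>j (1 + x\<^sub>j\<^sup>2)\<close>.\<close>

lemma integrable_inverse_wt:
  "integrable (\<mu> :: 'd::finite point measure) (\<lambda>x. 1 / wt (CARD('d) + 1) x)"
proof (rule integrableI_bounded)
  let ?p = "\<lambda>y::real^'d. \<Prod>j\<in>UNIV. 1 / (1 + (y $ j)\<^sup>2)"
  have [measurable]: "wt n \<in> borel_measurable \<mu>" for n by (rule borel_measurable_\<mu>) measurable
  show "(\<lambda>x. 1 / wt (CARD('d) + 1) x) \<in> borel_measurable \<mu>" by measurable
  have "1 / wt (CARD('d) + 1) (t, y) \<le> (1 / (1 + t\<^sup>2)) * ?p y" for t and y :: "real^'d"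
  proof -
    have "(norm y)\<^sup>2 \<ge> (y $ j)\<^sup>2" for j
      using component_le_norm_cart[of y j] abs_le_square_iff[of "y $ j" "norm y"] by simp
    then have "(\<Prod>j\<in>(UNIV::'d set). 1 + (y $ j)\<^sup>2) \<le> (\<Prod>j\<in>(UNIV::'d set). 1 + (norm (t, y))\<^sup>2)"
      by (intro prod_mono) (simp add: norm_Pair add_increasing)
    then have "(1 + t\<^sup>2) * (\<Prod>j\<in>(UNIV::'d set). 1 + (y $ j)\<^sup>2) \<le> (1 + (norm (t, y))\<^sup>2) * (1 + (norm (t, y))\<^sup>2) ^ CARD('d)"
      by (intro mult_mono) (auto simp: norm_Pair intro!: prod_nonneg)
    then have "1 / wt (CARD('d) + 1) (t, y) \<le> 1 / ((1 + t\<^sup>2) * (\<Prod>j\<in>(UNIV::'d set). 1 + (y $ j)\<^sup>2))"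
      by (intro divide_left_mono) (auto simp: wt_def intro!: mult_pos_pos prod_pos zero_less_power add_pos_nonneg)
    then show ?thesis by (simp add: prod_dividef)
  qed
  then have "(\<integral>\<^sup>+x. ennreal (norm (1 / wt (CARD('d) + 1) x)) \<partial>(\<mu> :: 'd point measure))
     \<le> (\<integral>\<^sup>+x. ennreal (1 / (1 + (fst x)\<^sup>2)) * ennreal (?p (snd x)) \<partial>(\<mu> :: 'd point measure))"
    by (intro nn_integral_mono) (auto simp: ennreal_mult'[symmetric] prod_nonneg)
  also have "\<dots> = ennreal (\<delta> ^ CARD('d)) *
     (\<integral>\<^sup>+y. (\<integral>\<^sup>+t. ennreal (1 / (1 + t\<^sup>2)) * ennreal (?p y) \<partial>lborel) \<partial>count_space (lattice \<delta>))"
    by (subst nn_integral_\<mu>) (auto intro!: measurable_\<mu>_I)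
  also have "\<dots> = ennreal (\<delta> ^ CARD('d)) * ((\<integral>\<^sup>+t. ennreal (1 / (1 + t\<^sup>2)) \<partial>lborel) *
     (\<integral>\<^sup>+y. ennreal (?p y) \<partial>count_space (lattice \<delta>)))"
    by (simp add: nn_integral_multc nn_integral_cmult)
  also have "\<dots> < \<infinity>"
  proof -
    have "integrable lborel (\<lambda>t::real. 1 / (1 + t\<^sup>2))"
      using integrable_inverse_1_plus_square
      by (simp add: set_integrable_def einterval_def inverse_eq_divide)
    then have "(\<integral>\<^sup>+t. ennreal (1 / (1 + t\<^sup>2)) \<partial>lborel) < \<infinity>"
      by (simp add: integrable_iff_bounded)
    with nn_integral_lattice_prod[where 'd = 'd] show ?thesis
      by (simp add: ennreal_mult_less_top)
  qed
  finally show "(\<integral>\<^sup>+x. ennreal (norm (1 / wt (CARD('d) + 1) x)) \<partial>(\<mu> :: 'd point measure)) < \<infinity>" .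
qed

end

section \<open>Schwartz functions and convolution\<close>

lemma deriv_funpow_eqI:
  fixes F :: "nat \<Rightarrow> real \<Rightarrow> real"
  assumes "\<And>k t. (F k has_real_derivative F (Suc k) t) (at t)"
  shows "(deriv ^^ k) (F 0) = F k"
proof (induction k)
  case (Suc k)
  have "deriv (F k) = F (Suc k)" by (rule ext, rule DERIV_imp_deriv, rule assms)
  with Suc show ?case by simp
qed simp

lemma time_deriv_0 [simp]: "time_deriv 0 g = g"
  by (simp add: time_deriv_def)

context spacing begin

text \<open>The working criterion for Schwartz functions: exhibiting the whole tower of time
  derivatives at once replaces computations with iterated \<open>deriv\<close>. The tower must
  vanish off the cylinder to respect the normalisation in \<open>schwartz\<close>.\<close>

lemma
  fixes F :: "nat \<Rightarrow> 'd::finite fn"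
  assumes g: "F 0 = g" and off: "\<And>k x. x \<notin> Gam \<delta> \<Longrightarrow> F k x = 0"
    and der: "\<And>k y t. y \<in> lattice \<delta> \<Longrightarrow> ((\<lambda>s. F k (s, y)) has_real_derivative F (Suc k) (t, y)) (at t)"
    and bnd: "\<And>N k. \<exists>B. \<forall>x\<in>Gam \<delta>. wt N x * \<bar>F k x\<bar> \<le> B"
  shows schwartzI1: "g \<in> schwartz \<delta>" and schwartzI2: "time_deriv k g = F k"
proof -
  have d: "((\<lambda>s. F k (s, y)) has_real_derivative F (Suc k) (t, y)) (at t)" for k y t
  proof (cases "y \<in> lattice \<delta>")
    case False
    then have "F k (s, y) = 0" for k s by (intro off) (simp add: Gam_iff)
    then show ?thesis by simp
  qed (rule der)
  have e: "(deriv ^^ k) (\<lambda>s. g (s, y)) = (\<lambda>t. F k (t, y))" for k y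
    using deriv_funpow_eqI[of "\<lambda>k t. F k (t, y)"] d unfolding g[symmetric] by auto
  show D: "time_deriv k g = F k" for k
    unfolding time_deriv_def e by auto
  show "g \<in> schwartz \<delta>"
    unfolding schwartz_def mem_Collect_eq D e
  proof (intro conjI allI impI ballI)
    fix N k
    obtain B where "\<forall>x\<in>Gam \<delta>. wt N x * \<bar>F k x\<bar> \<le> B" using bnd by blast
    then show "bdd_above ((\<lambda>x. (1 + (norm x)\<^sup>2) ^ N * \<bar>F k x\<bar>) ` Gam \<delta>)"
      unfolding wt_def by (intro bdd_aboveI2) auto
  next
    fix x :: "'d point" assume "x \<notin> Gam \<delta>"
    then show "g x = 0" using off[of x 0] g by simp
  next
    fix k t and y :: "real^'d"
    show "(\<lambda>t. F k (t, y)) differentiable (at t)"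
      using d[of k y t] unfolding real_differentiable_def by blast
  qed
qed

lemma time_deriv_zero_off:
  assumes "g \<in> schwartz \<delta>" "x \<notin> Gam \<delta>" shows "time_deriv k g x = 0"
proof -
  obtain t y where x: "x = (t, y)" by fastforce
  have "(\<lambda>s. g (s, y)) = (\<lambda>_. 0)"
    using assms by (auto simp: x Gam_iff schwartz_def)
  moreover have "(deriv ^^ k) (\<lambda>_::real. 0::real) = (\<lambda>_. 0)"
    using deriv_funpow_eqI[of "\<lambda>_ _. 0"] by simp
  ultimately show ?thesis by (simp add: time_deriv_def x)
qed

lemma time_deriv_has_derivative:
  assumes "g \<in> schwartz \<delta>"
  shows "((\<lambda>s. time_deriv k g (s, y)) has_real_derivative time_deriv (Suc k) g (t, y)) (at t)"
proof (cases "y \<in> lattice \<delta>")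
  case True
  then have "(deriv ^^ k) (\<lambda>s. g (s, y)) differentiable (at t)"
    using assms by (auto simp: schwartz_def)
  then show ?thesis
    by (auto simp: time_deriv_def real_differentiable_def dest: DERIV_imp_deriv)
next
  case False
  then have "time_deriv k g (s, y) = 0" for k s
    by (intro time_deriv_zero_off[OF assms]) (simp add: Gam_iff)
  then show ?thesis by simp
qed

text \<open>Valid for all \<open>x\<close>, because the normalisation makes every derivative vanish
  off the cylinder; pointwise estimates below can therefore omit membership conditions.\<close>

lemma seminorm_bound:
  assumes "g \<in> schwartz \<delta>"
  shows "wt N x * \<bar>time_deriv k g x\<bar> \<le> schwartz_seminorm \<delta> N k g"
proof -
  have *: "wt N x * \<bar>time_deriv k g x\<bar> \<le> schwartz_seminorm \<delta> N k g" if "x \<in> Gam \<delta>" for x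
    unfolding schwartz_seminorm_def wt_def
    by (rule cSUP_upper) (use that assms in \<open>auto simp: schwartz_def\<close>)
  show ?thesis
  proof (cases "x \<in> Gam \<delta>")
    case False
    have "0 \<le> schwartz_seminorm \<delta> N k g" using *[OF Gam_0] by (rule order_trans[rotated]) simp
    then show ?thesis using time_deriv_zero_off[OF assms False] by simp
  qed (rule *)
qed

lemma seminorm_nonneg: "g \<in> schwartz \<delta> \<Longrightarrow> 0 \<le> schwartz_seminorm \<delta> N k g"
  by (rule order_trans[OF _ seminorm_bound[of g N 0 k]]) auto

lemma time_deriv_bound: "g \<in> schwartz \<delta> \<Longrightarrow> \<bar>time_deriv k g x\<bar> \<le> schwartz_seminorm \<delta> N k g / wt N x"
  using seminorm_bound[of g N x k] wt_pos[of N x] by (simp add: field_simps)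

lemma seminorm_le:
  "(\<And>x. x \<in> Gam \<delta> \<Longrightarrow> wt N x * \<bar>time_deriv k g x\<bar> \<le> B) \<Longrightarrow> schwartz_seminorm \<delta> N k g \<le> B"
  unfolding schwartz_seminorm_def wt_def by (rule cSUP_least) auto

lemma
  assumes "g \<in> schwartz \<delta>"
  shows time_deriv_schwartz: "time_deriv k g \<in> schwartz \<delta>"
    and time_deriv_time_deriv: "time_deriv j (time_deriv k g) = time_deriv (j + k) g"
proof -
  have b: "\<exists>B. \<forall>x\<in>Gam \<delta>. wt N x * \<bar>time_deriv (j + k) g x\<bar> \<le> B" for N j
    using seminorm_bound[OF assms] by blast
  show "time_deriv k g \<in> schwartz \<delta>"
    by (rule schwartzI1[where F = "\<lambda>j. time_deriv (j + k) g"])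
      (use b time_deriv_zero_off[OF assms] time_deriv_has_derivative[OF assms] in auto)
  show "time_deriv j (time_deriv k g) = time_deriv (j + k) g"
    by (rule schwartzI2[where F = "\<lambda>j. time_deriv (j + k) g"])
      (use b time_deriv_zero_off[OF assms] time_deriv_has_derivative[OF assms] in auto)
qed

lemma seminorm_time_deriv:
  "g \<in> schwartz \<delta> \<Longrightarrow> schwartz_seminorm \<delta> N j (time_deriv k g) = schwartz_seminorm \<delta> N (j + k) g"
  by (simp add: schwartz_seminorm_def time_deriv_time_deriv)

lemma
  assumes g: "g \<in> schwartz \<delta>" and h: "h \<in> schwartz \<delta>"
  shows lincomb_schwartz: "(\<lambda>x. a * g x + b * h x) \<in> schwartz \<delta>"
    and time_deriv_lincomb: "time_deriv k (\<lambda>x. a * g x + b * h x) = (\<lambda>x. a * time_deriv k g x + b * time_deriv k h x)"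
proof -
  let ?F = "\<lambda>k x. a * time_deriv k g x + b * time_deriv k h x"
  have bnd: "\<exists>B. \<forall>x\<in>Gam \<delta>. wt N x * \<bar>?F k x\<bar> \<le> B" for N k
  proof (intro exI ballI)
    fix x
    have "wt N x * \<bar>?F k x\<bar> \<le> wt N x * (\<bar>a\<bar> * \<bar>time_deriv k g x\<bar> + \<bar>b\<bar> * \<bar>time_deriv k h x\<bar>)"
      by (intro mult_left_mono order_trans[OF abs_triangle_ineq]) (simp_all add: abs_mult)
    also have "\<dots> = \<bar>a\<bar> * (wt N x * \<bar>time_deriv k g x\<bar>) + \<bar>b\<bar> * (wt N x * \<bar>time_deriv k h x\<bar>)"
      by (simp add: algebra_simps)
    also have "\<dots> \<le> \<bar>a\<bar> * schwartz_seminorm \<delta> N k g + \<bar>b\<bar> * schwartz_seminorm \<delta> N k h"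
      by (intro add_mono mult_left_mono seminorm_bound g h) auto
    finally show "wt N x * \<bar>?F k x\<bar> \<le> \<bar>a\<bar> * schwartz_seminorm \<delta> N k g + \<bar>b\<bar> * schwartz_seminorm \<delta> N k h" .
  qed
  have der: "((\<lambda>s. ?F k (s, y)) has_real_derivative ?F (Suc k) (t, y)) (at t)" for k y t
    by (intro DERIV_add DERIV_cmult time_deriv_has_derivative g h)
  show "(\<lambda>x. a * g x + b * h x) \<in> schwartz \<delta>"
    by (rule schwartzI1[where F = ?F]) (use bnd der time_deriv_zero_off[OF g] time_deriv_zero_off[OF h] in auto)
  show "time_deriv k (\<lambda>x. a * g x + b * h x) = ?F k"
    by (rule schwartzI2[where F = ?F]) (use bnd der time_deriv_zero_off[OF g] time_deriv_zero_off[OF h] in auto)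
qed

lemma zero_schwartz: "(\<lambda>_. 0) \<in> schwartz \<delta>"
  by (rule schwartzI1[where F = "\<lambda>_ _. 0"]) auto

lemma scale_schwartz: "g \<in> schwartz \<delta> \<Longrightarrow> (\<lambda>x. c * g x) \<in> schwartz \<delta>"
  using lincomb_schwartz[of g g c 0] by simp

lemma diff_schwartz: "g \<in> schwartz \<delta> \<Longrightarrow> h \<in> schwartz \<delta> \<Longrightarrow> (\<lambda>x. g x - h x) \<in> schwartz \<delta>"
  using lincomb_schwartz[of g h 1 "-1"] by simp

lemma time_deriv_diff:
  "g \<in> schwartz \<delta> \<Longrightarrow> h \<in> schwartz \<delta> \<Longrightarrow>
    time_deriv k (\<lambda>x. g x - h x) = (\<lambda>x. time_deriv k g x - time_deriv k h x)"
  using time_deriv_lincomb[of g h k 1 "-1"] by simp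

lemma seminorm_scale:
  assumes "g \<in> schwartz \<delta>"
  shows "schwartz_seminorm \<delta> N k (\<lambda>x. c * g x) \<le> \<bar>c\<bar> * schwartz_seminorm \<delta> N k g"
proof (rule seminorm_le)
  fix x
  have "wt N x * \<bar>time_deriv k (\<lambda>x. c * g x) x\<bar> = \<bar>c\<bar> * (wt N x * \<bar>time_deriv k g x\<bar>)"
    using time_deriv_lincomb[OF assms assms, of k c 0] by (simp add: abs_mult)
  also have "\<dots> \<le> \<bar>c\<bar> * schwartz_seminorm \<delta> N k g"
    by (intro mult_left_mono seminorm_bound assms) simp
  finally show "wt N x * \<bar>time_deriv k (\<lambda>x. c * g x) x\<bar> \<le> \<bar>c\<bar> * schwartz_seminorm \<delta> N k g" .
qed

lemma seminorm_triangle: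
  assumes g: "f \<in> schwartz \<delta>" "g \<in> schwartz \<delta>" "h \<in> schwartz \<delta>"
  shows "schwartz_seminorm \<delta> N k (\<lambda>x. f x - h x) \<le>
    schwartz_seminorm \<delta> N k (\<lambda>x. f x - g x) + schwartz_seminorm \<delta> N k (\<lambda>x. g x - h x)"
proof (rule seminorm_le)
  fix x
  have "wt N x * \<bar>time_deriv k (\<lambda>x. f x - h x) x\<bar> \<le>
     wt N x * \<bar>time_deriv k (\<lambda>x. f x - g x) x\<bar> + wt N x * \<bar>time_deriv k (\<lambda>x. g x - h x) x\<bar>"
    unfolding time_deriv_diff[OF g(1,3)] time_deriv_diff[OF g(1,2)] time_deriv_diff[OF g(2,3)] distrib_left[symmetric]
    by (intro mult_left_mono) auto
  also have "\<dots> \<le> schwartz_seminorm \<delta> N k (\<lambda>x. f x - g x) + schwartz_seminorm \<delta> N k (\<lambda>x. g x - h x)"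
    by (intro add_mono seminorm_bound diff_schwartz g)
  finally show "wt N x * \<bar>time_deriv k (\<lambda>x. f x - h x) x\<bar> \<le> \<dots>" .
qed

section \<open>Rapid decrease in the integral sense, and convolution\<close>

lemma schwartz_measurable:
  assumes "g \<in> schwartz \<delta>" shows "g \<in> borel_measurable \<mu>"
proof (rule measurable_\<mu>_I)
  fix y
  have "continuous_on UNIV (\<lambda>t. g (t, y))"
    using time_deriv_has_derivative[OF assms, of 0 y]
    by (intro continuous_at_imp_continuous_on ballI) (auto intro: DERIV_isCont)
  then show "(\<lambda>t. g (t, y)) \<in> borel_measurable borel" by (rule borel_measurable_continuous_onI)
qed

text \<open>Decay is measured by weighted L1 norms and no smoothness is asked for, so that the Green
  function belongs to this class in spite of its jump.\<close>

definition rapid :: "'d::finite fn \<Rightarrow> bool" where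
  "rapid h \<longleftrightarrow> h \<in> borel_measurable \<mu> \<and> (\<forall>N. integrable \<mu> (\<lambda>x. wt N x * h x))"

abbreviation rapid_norm :: "nat \<Rightarrow> 'd::finite fn \<Rightarrow> real" where
  "rapid_norm N h \<equiv> LINT x|\<mu>. wt N x * \<bar>h x\<bar>"

lemma wt_measurable_\<mu> [measurable]: "wt N \<in> borel_measurable \<mu>"
  by (rule borel_measurable_\<mu>) measurable

lemma rapid_measurable: "rapid h \<Longrightarrow> h \<in> borel_measurable \<mu>"
  by (simp add: rapid_def)

lemma rapid_integrable: "rapid h \<Longrightarrow> integrable \<mu> (\<lambda>x. wt N x * h x)"
  by (simp add: rapid_def)

lemma rapid_integrable_abs: "rapid h \<Longrightarrow> integrable \<mu> (\<lambda>x. wt N x * \<bar>h x\<bar>)"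
  using integrable_abs[OF rapid_integrable[of h N]] by (simp add: abs_mult)

lemma rapid_integrable_0: "rapid h \<Longrightarrow> integrable \<mu> h"
  using rapid_integrable[of h 0] by simp

lemma rapid_dominated:
  assumes "rapid h" "f \<in> borel_measurable \<mu>" "\<And>x. x \<in> Gam \<delta> \<Longrightarrow> \<bar>f x\<bar> \<le> C * \<bar>h x\<bar>"
  shows "rapid f"
  unfolding rapid_def
proof (intro conjI allI)
  fix N
  show "integrable \<mu> (\<lambda>x. wt N x * f x)"
  proof (rule Bochner_Integration.integrable_bound)
    show "integrable \<mu> (\<lambda>x. C * (wt N x * \<bar>h x\<bar>))"
      using rapid_integrable_abs[OF assms(1)] by simp
    show "(\<lambda>x. wt N x * f x) \<in> borel_measurable \<mu>" using assms(2) by measurable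
    have "wt N x * \<bar>f x\<bar> \<le> wt N x * (C * \<bar>h x\<bar>)" if "x \<in> Gam \<delta>" for x
      by (intro mult_left_mono assms(3) that) simp
    then have "\<bar>wt N x * f x\<bar> \<le> C * (wt N x * \<bar>h x\<bar>)" if "x \<in> space \<mu>" for x
      using that by (simp add: abs_mult mult.left_commute)
    then show "AE x in \<mu>. norm (wt N x * f x) \<le> norm (C * (wt N x * \<bar>h x\<bar>))"
      unfolding real_norm_def by (intro AE_I2 order_trans[OF _ abs_ge_self])
  qed
qed fact

lemma schwartz_rapid:
  fixes g :: "'d::finite fn"
  assumes "g \<in> schwartz \<delta>" shows "rapid g"
  unfolding rapid_def
proof (intro conjI allI)
  note [measurable] = schwartz_measurable[OF assms]
  show "g \<in> borel_measurable \<mu>" by measurable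
  fix N
  show "integrable \<mu> (\<lambda>x. wt N x * g x)"
  proof (rule Bochner_Integration.integrable_bound)
    let ?M = "CARD('d) + 1"
    show "integrable \<mu> (\<lambda>x::'d point. schwartz_seminorm \<delta> (?M + N) 0 g * (1 / wt ?M x))"
      by (intro integrable_mult_right integrable_inverse_wt)
    have "wt N x * \<bar>g x\<bar> \<le> schwartz_seminorm \<delta> (?M + N) 0 g * (1 / wt ?M x)" for x
      using seminorm_bound[OF assms, of "?M + N" x 0] wt_pos[of ?M x] unfolding wt_add
      by (simp add: field_simps)
    then have "\<bar>wt N x * g x\<bar> \<le> schwartz_seminorm \<delta> (?M + N) 0 g * (1 / wt ?M x)" for x
      by (simp add: abs_mult)
    then show "AE x in \<mu>. norm (wt N x * g x) \<le> norm (schwartz_seminorm \<delta> (?M + N) 0 g * (1 / wt ?M x))"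
      unfolding real_norm_def by (intro AE_I2 order_trans[OF _ abs_ge_self])
  qed measurable
qed

text \<open>Put to 0 off the cylinder, so that a convolution is already in the normal form that
  \<open>schwartz\<close> demands.\<close>

definition conv :: "'d::finite fn \<Rightarrow> 'd fn \<Rightarrow> 'd fn" where
  "conv r h = (\<lambda>z. if z \<in> Gam \<delta> then LINT x|\<mu>. r (z - x) * h x else 0)"

lemma conv_integrable:
  fixes r h :: "'d::finite fn"
  assumes "r \<in> borel_measurable \<mu>" "\<And>x. \<bar>r x\<bar> \<le> B" "integrable \<mu> h" "z \<in> Gam \<delta>"
  shows "integrable \<mu> (\<lambda>x. r (z - x) * h x)"
proof (rule Bochner_Integration.integrable_bound)
  show "integrable \<mu> (\<lambda>x. B * \<bar>h x\<bar>)" using assms by simp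
  show "(\<lambda>x. r (z - x) * h x) \<in> borel_measurable \<mu>"
    by (intro borel_measurable_times measurable_reflect assms borel_measurable_integrable)
  have "0 \<le> B" using assms(2)[of 0] by linarith
  then have "\<bar>r (z - x)\<bar> * \<bar>h x\<bar> \<le> \<bar>B\<bar> * \<bar>\<bar>h x\<bar>\<bar>" for x
    using mult_right_mono[OF assms(2)[of "z - x"], of "\<bar>h x\<bar>"] by simp
  then show "AE x in \<mu>. norm (r (z - x) * h x) \<le> norm (B * \<bar>h x\<bar>)"
    unfolding real_norm_def abs_mult by (intro AE_I2)
qed

lemma schwartz_bounded: "g \<in> schwartz \<delta> \<Longrightarrow> \<bar>time_deriv k g x\<bar> \<le> schwartz_seminorm \<delta> 0 k g"
  using seminorm_bound[of g 0 x k] by simp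

lemma conv_schwartz_integrable:
  "r \<in> schwartz \<delta> \<Longrightarrow> integrable \<mu> h \<Longrightarrow> z \<in> Gam \<delta> \<Longrightarrow> integrable \<mu> (\<lambda>x. r (z - x) * h x)"
  using schwartz_bounded[of r 0] by (intro conv_integrable schwartz_measurable) auto

text \<open>Peetre's inequality splits the weight at \<open>z\<close> into a weight at
  \<open>z - x\<close>, absorbed by the seminorm of \<open>r\<close>, and a weight at
  \<open>x\<close>, absorbed by the weighted L1 norm of \<open>h\<close>.\<close>

lemma conv_bound:
  assumes r: "r \<in> schwartz \<delta>" and h: "rapid h"
  shows "wt N z * \<bar>conv r h z\<bar> \<le> 2 ^ N * schwartz_seminorm \<delta> N 0 r * rapid_norm N h"
proof (cases "z \<in> Gam \<delta>")
  case True
  let ?q = "schwartz_seminorm \<delta> N 0 r"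
  have "wt N z * \<bar>conv r h z\<bar> = \<bar>LINT x|\<mu>. wt N z * (r (z - x) * h x)\<bar>"
    using True by (simp add: conv_def abs_mult)
  also have "\<dots> \<le> (LINT x|\<mu>. 2 ^ N * ?q * (wt N x * \<bar>h x\<bar>))"
  proof (rule integral_abs_bound_integral)
    show "integrable \<mu> (\<lambda>x. wt N z * (r (z - x) * h x))"
      using conv_schwartz_integrable[OF r rapid_integrable_0[OF h] True] by simp
    show "integrable \<mu> (\<lambda>x. 2 ^ N * ?q * (wt N x * \<bar>h x\<bar>))"
      using rapid_integrable_abs[OF h] by simp
    fix x
    have "wt N z * \<bar>r (z - x)\<bar> \<le> 2 ^ N * wt N (z - x) * wt N x * \<bar>r (z - x)\<bar>"
      using wt_plus_le[of N "z - x" x] by (intro mult_right_mono) auto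
    also have "\<dots> = 2 ^ N * wt N x * (wt N (z - x) * \<bar>time_deriv 0 r (z - x)\<bar>)" by (simp add: mult_ac)
    also have "\<dots> \<le> 2 ^ N * wt N x * ?q"
      by (intro mult_left_mono seminorm_bound r) simp
    finally have "wt N z * \<bar>r (z - x)\<bar> * \<bar>h x\<bar> \<le> 2 ^ N * wt N x * ?q * \<bar>h x\<bar>"
      by (rule mult_right_mono) simp
    then show "\<bar>wt N z * (r (z - x) * h x)\<bar> \<le> 2 ^ N * ?q * (wt N x * \<bar>h x\<bar>)"
      by (simp add: abs_mult mult_ac)
  qed
  finally show ?thesis by simp
next
  case False
  then show ?thesis using seminorm_nonneg[OF r]
    by (auto simp: conv_def intro!: mult_nonneg_nonneg integral_nonneg_AE)
qed

text \<open>All time derivatives are put on the smooth factor \<open>r\<close>, so the result is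
  smooth for a discontinuous \<open>h\<close>. The constant bound on the derivative of
  \<open>r\<close> times the integrable \<open>h\<close> is the dominating function.\<close>

lemma
  assumes r: "r \<in> schwartz \<delta>" and h: "rapid h"
  shows conv_schwartz: "conv r h \<in> schwartz \<delta>"
    and time_deriv_conv: "time_deriv k (conv r h) = conv (time_deriv k r) h"
proof -
  have b: "\<exists>B. \<forall>x\<in>Gam \<delta>. wt N x * \<bar>conv (time_deriv k r) h x\<bar> \<le> B" for N k
    using conv_bound[OF time_deriv_schwartz[OF r] h] by blast
  have d: "((\<lambda>s. conv (time_deriv k r) h (s, y)) has_real_derivative conv (time_deriv (Suc k) r) h (t, y)) (at t)"
    if y: "y \<in> lattice \<delta>" for k y t
  proof -
    have z: "(s, y) \<in> Gam \<delta>" for s using y by (simp add: Gam_iff)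
    have "((\<lambda>s. LINT x|\<mu>. time_deriv k r ((s, y) - x) * h x) has_vector_derivative
       (LINT x|\<mu>. time_deriv (Suc k) r ((t, y) - x) * h x)) (at t)"
    proof (rule has_vector_derivative_lebesgue_integral(1)[where e = 1])
      show "integrable \<mu> (\<lambda>x. time_deriv k r ((s, y) - x) * h x)" for s
        by (rule conv_schwartz_integrable[OF time_deriv_schwartz[OF r] rapid_integrable_0[OF h] z])
      show "((\<lambda>s. time_deriv k r ((s, y) - x) * h x) has_vector_derivative
        time_deriv (Suc k) r ((s, y) - x) * h x) (at s)" for s x
        unfolding has_real_derivative_iff_has_vector_derivative[symmetric] minus_prod_def fst_conv snd_conv
        by (rule DERIV_cmult_right)
          (rule DERIV_shift[THEN iffD1, of _ _ s "- fst x", simplified,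
             OF time_deriv_has_derivative[OF r, of k "y - snd x" "s - fst x"], simplified])
      show "norm (time_deriv (Suc k) r ((s, y) - x) * h x) \<le> schwartz_seminorm \<delta> 0 (Suc k) r * \<bar>h x\<bar>" for s x
        unfolding real_norm_def abs_mult by (intro mult_right_mono schwartz_bounded r) simp
      show "integrable \<mu> (\<lambda>x. schwartz_seminorm \<delta> 0 (Suc k) r * \<bar>h x\<bar>)"
        using rapid_integrable_0[OF h] by simp
    qed simp
    then show ?thesis
      by (simp add: conv_def z has_real_derivative_iff_has_vector_derivative)
  qed
  show "conv r h \<in> schwartz \<delta>"
    by (rule schwartzI1[where F = "\<lambda>k. conv (time_deriv k r) h"]) (use b d in \<open>auto simp: conv_def\<close>)
  show "time_deriv k (conv r h) = conv (time_deriv k r) h"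
    by (rule schwartzI2[where F = "\<lambda>k. conv (time_deriv k r) h"]) (use b d in \<open>auto simp: conv_def\<close>)
qed

lemma seminorm_conv:
  assumes r: "r \<in> schwartz \<delta>" and h: "rapid h"
  shows "schwartz_seminorm \<delta> N k (conv r h) \<le> 2 ^ N * schwartz_seminorm \<delta> N k r * rapid_norm N h"
  using conv_bound[OF time_deriv_schwartz[OF r, of k] h, of N]
  by (intro seminorm_le) (simp add: time_deriv_conv[OF r h] seminorm_time_deriv[OF r])

lemma conv_commute:
  assumes "h \<in> borel_measurable \<mu>" "r \<in> borel_measurable \<mu>"
  shows "conv r h = conv h r"
proof -
  have "(LINT x|\<mu>. r (z - x) * h x) = (LINT x|\<mu>. h (z - x) * r x)" if z: "z \<in> Gam \<delta>" for z
  proof -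
    have "(LINT x|\<mu>. (\<lambda>x. h (z - x) * r x) (z - x)) = (LINT x|\<mu>. h (z - x) * r x)"
      by (rule integral_reflect) (intro borel_measurable_times measurable_reflect assms z, rule z)
    then show ?thesis by (simp add: mult.commute)
  qed
  then show ?thesis by (auto simp: conv_def fun_eq_iff)
qed

end

section \<open>Tempered functionals\<close>

text \<open>Over n equal steps the increments sum to at most n times
  \<open>A * (2 * b / n)^2\<close>, which tends to 0. This stands in for a Riemann sum argument when
  a functional is exchanged with an integral over time.\<close>

lemma eq_of_quadratic_increments:
  fixes D :: "real \<Rightarrow> real"
  assumes b: "0 \<le> b"
    and D: "\<And>s t. - b \<le> s \<Longrightarrow> s \<le> t \<Longrightarrow> t \<le> b \<Longrightarrow> \<bar>D t - D s\<bar> \<le> A * (t - s)\<^sup>2"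
  shows "D b = D (- b)"
proof -
  have step: "\<bar>D b - D (- b)\<bar> \<le> A * (2 * b)\<^sup>2 / real (Suc n)" for n
  proof -
    define h where "h = 2 * b / real (Suc n)"
    have h: "0 \<le> h" "real (Suc n) * h = 2 * b" using b by (simp_all add: h_def)
    have "\<bar>D (- b + real k * h) - D (- b)\<bar> \<le> real k * (A * h\<^sup>2)" if "k \<le> Suc n" for k
      using that
    proof (induction k)
      case (Suc k)
      have 1: "real (Suc k) * h \<le> 2 * b"
        using mult_right_mono[of "real (Suc k)" "real (Suc n)" h] Suc.prems h by simp
      have "\<bar>D (- b + real (Suc k) * h) - D (- b + real k * h)\<bar> \<le> A * (- b + real (Suc k) * h - (- b + real k * h))\<^sup>2"
        by (rule D) (use 1 h in \<open>auto simp: algebra_simps\<close>)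
      also have "- b + real (Suc k) * h - (- b + real k * h) = h" by (simp add: algebra_simps)
      finally show ?case using Suc by (simp add: distrib_right)
    qed simp
    from this[of "Suc n"] have "\<bar>D b - D (- b)\<bar> \<le> real (Suc n) * (A * h\<^sup>2)"
      using h by simp
    also have "\<dots> = A * (real (Suc n) * h)\<^sup>2 / real (Suc n)" by (simp add: power2_eq_square)
    finally show ?thesis by (simp only: h)
  qed
  have "(\<lambda>n. A * (2 * b)\<^sup>2 / real (Suc n)) \<longlonglongrightarrow> 0" by real_asymp
  from LIMSEQ_le_const[OF this, of "\<bar>D b - D (- b)\<bar>"] step show ?thesis by auto
qed

context spacing begin

definition psum :: "nat \<Rightarrow> 'd::finite fn \<Rightarrow> real" where
  "psum K g = (\<Sum>N\<le>K. \<Sum>k\<le>K. schwartz_seminorm \<delta> N k g)"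

text \<open>The quantitative form of continuity, a bound by finitely many seminorms. Unlike
  membership in \<open>schwartz_dual\<close> it passes directly to compositions with convolutions
  and yields explicit error estimates.\<close>

definition tempered :: "('d::finite fn \<Rightarrow> real) \<Rightarrow> bool" where
  "tempered T \<longleftrightarrow>
    (\<forall>g\<in>schwartz \<delta>. \<forall>h\<in>schwartz \<delta>. \<forall>a b. T (\<lambda>x. a * g x + b * h x) = a * T g + b * T h) \<and>
    (\<exists>K C. 0 \<le> C \<and> (\<forall>g\<in>schwartz \<delta>. \<bar>T g\<bar> \<le> C * psum K g))"

lemma psum_nonneg: "g \<in> schwartz \<delta> \<Longrightarrow> 0 \<le> psum K g"
  unfolding psum_def by (intro sum_nonneg seminorm_nonneg)

lemma seminorm_le_psum: "g \<in> schwartz \<delta> \<Longrightarrow> N \<le> K \<Longrightarrow> k \<le> K \<Longrightarrow> schwartz_seminorm \<delta> N k g \<le> psum K g"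
  unfolding psum_def
  by (rule order_trans[OF member_le_sum[of k "{..K}" "\<lambda>k. schwartz_seminorm \<delta> N k g"]
    member_le_sum[of N "{..K}" "\<lambda>N. \<Sum>k\<le>K. schwartz_seminorm \<delta> N k g"]])
    (auto intro!: sum_nonneg seminorm_nonneg)

text \<open>The subbasic balls may be centred anywhere; the triangle inequality recentres them at
  \<open>g\<close>, and the finitely many conditions met in an intersection merge into one
  \<open>K\<close> and one \<open>\<epsilon>\<close>.\<close>

lemma schwartz_topology_nhds:
  assumes "openin (schwartz_topology \<delta>) U" "g \<in> U" "g \<in> schwartz \<delta>"
  shows "\<exists>K \<epsilon>. 0 < \<epsilon> \<and> (\<forall>h\<in>schwartz \<delta>.
    (\<forall>N\<le>K. \<forall>k\<le>K. schwartz_seminorm \<delta> N k (\<lambda>x. h x - g x) < \<epsilon>) \<longrightarrow> h \<in> U)"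
proof -
  have "generate_topology_on {{h \<in> schwartz \<delta>. schwartz_seminorm \<delta> N k (\<lambda>x. h x - g x) < \<epsilon>} | g N k \<epsilon>.
        g \<in> schwartz \<delta> \<and> 0 < \<epsilon>} U"
    using assms(1) unfolding schwartz_topology_def openin_topology_generated_by_iff .
  then show ?thesis using assms(2)
  proof (induction U)
    case (Int a b)
    then obtain K1 e1 K2 e2 where e: "0 < e1" "0 < e2"
      and 1: "\<forall>h\<in>schwartz \<delta>. (\<forall>N\<le>K1. \<forall>k\<le>K1. schwartz_seminorm \<delta> N k (\<lambda>x. h x - g x) < e1) \<longrightarrow> h \<in> a"
      and 2: "\<forall>h\<in>schwartz \<delta>. (\<forall>N\<le>K2. \<forall>k\<le>K2. schwartz_seminorm \<delta> N k (\<lambda>x. h x - g x) < e2) \<longrightarrow> h \<in> b"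
      by blast
    show ?case
    proof (rule exI[of _ "max K1 K2"], rule exI[of _ "min e1 e2"], intro conjI ballI impI)
      fix h assume h: "h \<in> schwartz \<delta>"
        "\<forall>N\<le>max K1 K2. \<forall>k\<le>max K1 K2. schwartz_seminorm \<delta> N k (\<lambda>x. h x - g x) < min e1 e2"
      then have "\<forall>N\<le>K1. \<forall>k\<le>K1. schwartz_seminorm \<delta> N k (\<lambda>x. h x - g x) < e1"
        "\<forall>N\<le>K2. \<forall>k\<le>K2. schwartz_seminorm \<delta> N k (\<lambda>x. h x - g x) < e2" by simp_all
      with 1 2 h show "h \<in> a \<inter> b" by blast
    qed (use e in simp)
  next
    case (UN \<U>)
    then obtain k where "k \<in> \<U>" "g \<in> k" by blast
    with UN.IH[OF this] show ?case by blast
  next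
    case (Basis s)
    then obtain g0 N k \<epsilon> where s: "s = {h \<in> schwartz \<delta>. schwartz_seminorm \<delta> N k (\<lambda>x. h x - g0 x) < \<epsilon>}"
      and g0: "g0 \<in> schwartz \<delta>" by blast
    let ?e = "\<epsilon> - schwartz_seminorm \<delta> N k (\<lambda>x. g x - g0 x)"
    show ?case
    proof (rule exI[of _ "max N k"], rule exI[of _ ?e], intro conjI ballI impI)
      show "0 < ?e" using Basis.prems unfolding s by simp
      fix h assume h: "h \<in> schwartz \<delta>"
        "\<forall>N'\<le>max N k. \<forall>k'\<le>max N k. schwartz_seminorm \<delta> N' k' (\<lambda>x. h x - g x) < ?e"
      then have "schwartz_seminorm \<delta> N k (\<lambda>x. h x - g x) < ?e" by simp
      with seminorm_triangle[OF h(1) assms(3) g0, of N k] h(1) show "h \<in> s" unfolding s by simp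
    qed
  qed blast
qed

text \<open>The preimage of the interval from -1 to 1 is a neighbourhood of 0 and so contains a
  seminorm ball; homogeneity turns this into a linear bound.\<close>

lemma dual_tempered:
  fixes \<omega> :: "'d::finite fn \<Rightarrow> real"
  assumes "\<omega> \<in> schwartz_dual \<delta>"
  shows "tempered \<omega>"
proof -
  have add: "\<omega> (\<lambda>x. g x + h x) = \<omega> g + \<omega> h" if "g \<in> schwartz \<delta>" "h \<in> schwartz \<delta>" for g h
    using assms that unfolding schwartz_dual_def by blast
  have scale: "\<omega> (\<lambda>x. c * g x) = c * \<omega> g" if "g \<in> schwartz \<delta>" for c g
    using assms that unfolding schwartz_dual_def by blast
  have cont: "continuous_map (schwartz_topology \<delta>) euclideanreal \<omega>"
    using assms unfolding schwartz_dual_def by blast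
  let ?U = "{g \<in> topspace (schwartz_topology \<delta>). \<omega> g \<in> {-1<..<1}}"
  have U: "openin (schwartz_topology \<delta>) ?U"
    using cont unfolding continuous_map_def by auto
  \<comment> \<open>The carrier of a generated topology is just the union of its subbasis, so
    membership of 0 is read off from a unit ball about 0.\<close>
  have z: "(\<lambda>_::'d point. 0) \<in> topspace (schwartz_topology \<delta>)"
  proof -
    have "openin (schwartz_topology \<delta>) {h \<in> schwartz \<delta>. schwartz_seminorm \<delta> 0 0 (\<lambda>x::'d point. h x - 0) < 1}"
      unfolding schwartz_topology_def
      by (rule topology_generated_by_Basis, rule CollectI, rule exI[of _ "\<lambda>_. 0"], rule exI[of _ 0],
          rule exI[of _ 0], rule exI[of _ 1]) (simp add: zero_schwartz)
    from openin_subset[OF this] have "h \<in> topspace (schwartz_topology \<delta>)"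
      if "h \<in> schwartz \<delta>" "schwartz_seminorm \<delta> 0 0 h < 1" for h :: "'d fn" using that by auto
    moreover have "schwartz_seminorm \<delta> 0 0 (\<lambda>_::'d point. 0) \<le> 0" by (rule seminorm_le) simp
    ultimately show ?thesis using zero_schwartz by fastforce
  qed
  have "\<omega> (\<lambda>_. 0) = 0" using scale[OF zero_schwartz, of 0] by simp
  with z have "(\<lambda>_. 0) \<in> ?U" by simp
  from schwartz_topology_nhds[OF U this zero_schwartz] obtain K \<epsilon> where \<epsilon>: "0 < \<epsilon>"
    and K0: "\<forall>h\<in>schwartz \<delta>. (\<forall>N\<le>K. \<forall>k\<le>K. schwartz_seminorm \<delta> N k (\<lambda>x. h x - 0) < \<epsilon>) \<longrightarrow> h \<in> ?U"
    by blast
  have K: "h \<in> ?U" if "h \<in> schwartz \<delta>" "\<forall>N\<le>K. \<forall>k\<le>K. schwartz_seminorm \<delta> N k h < \<epsilon>" for h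
    using K0[rule_format, OF that(1)] that(2) by simp
  have "\<bar>\<omega> g\<bar> \<le> 1 / \<epsilon> * psum K g" if g: "g \<in> schwartz \<delta>" for g
  proof (rule field_le_epsilon)
    fix e :: real assume e: "0 < e"
    \<comment> \<open>\<open>psum K g\<close> may vanish; the extra \<open>e * \<epsilon>\<close>
      keeps the denominator of the rescaling positive and contributes exactly the slack
      \<open>e\<close> in the end.\<close>
    let ?p = "psum K g + e * \<epsilon>"
    have p: "0 < ?p" using psum_nonneg[OF g, of K] e \<epsilon> by (simp add: add_nonneg_pos)
    have "(\<lambda>x. \<epsilon> / ?p * g x) \<in> ?U"
    proof (rule K, rule scale_schwartz[OF g], intro allI impI)
      fix N k assume "N \<le> K" "k \<le> K"
      have "schwartz_seminorm \<delta> N k (\<lambda>x. \<epsilon> / ?p * g x) \<le> \<epsilon> / ?p * schwartz_seminorm \<delta> N k g"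
        using seminorm_scale[OF g, of N k "\<epsilon> / ?p"] \<epsilon> p by simp
      also have "\<dots> < \<epsilon> / ?p * ?p"
        using seminorm_le_psum[OF g \<open>N \<le> K\<close> \<open>k \<le> K\<close>] \<epsilon> p e
        by (intro mult_strict_left_mono) (auto intro: le_less_trans)
      finally show "schwartz_seminorm \<delta> N k (\<lambda>x. \<epsilon> / ?p * g x) < \<epsilon>" using p by simp
    qed
    then have "\<bar>\<omega> (\<lambda>x. \<epsilon> / ?p * g x)\<bar> < 1" by auto
    then have "\<bar>\<epsilon> / ?p * \<omega> g\<bar> < 1" unfolding scale[OF g] .
    then have "\<epsilon> * \<bar>\<omega> g\<bar> < ?p" using p \<epsilon> by (simp add: abs_mult field_simps)
    then show "\<bar>\<omega> g\<bar> \<le> 1 / \<epsilon> * psum K g + e" using \<epsilon> by (simp add: field_simps)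
  qed
  moreover have "\<omega> (\<lambda>x. a * g x + b * h x) = a * \<omega> g + b * \<omega> h" if "g \<in> schwartz \<delta>" "h \<in> schwartz \<delta>" for g h a b
    using that by (simp add: add scale scale_schwartz)
  ultimately show ?thesis using \<epsilon> unfolding tempered_def by (auto intro!: exI[of _ K] exI[of _ "1 / \<epsilon>"])
qed

lemma tempered_lincomb:
  "tempered T \<Longrightarrow> g \<in> schwartz \<delta> \<Longrightarrow> h \<in> schwartz \<delta> \<Longrightarrow> T (\<lambda>x. a * g x + b * h x) = a * T g + b * T h"
  unfolding tempered_def by blast

lemma tempered_zero: "tempered T \<Longrightarrow> T (\<lambda>_. 0) = 0"
  using tempered_lincomb[of T "\<lambda>_. 0" "\<lambda>_. 0" 0 0] zero_schwartz by simp

lemma tempered_diff: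
  "tempered T \<Longrightarrow> g \<in> schwartz \<delta> \<Longrightarrow> h \<in> schwartz \<delta> \<Longrightarrow> T (\<lambda>x. g x - h x) = T g - T h"
  using tempered_lincomb[of T g h 1 "-1"] by simp

lemma tempered_add:
  "tempered T \<Longrightarrow> g \<in> schwartz \<delta> \<Longrightarrow> h \<in> schwartz \<delta> \<Longrightarrow> T (\<lambda>x. g x + h x) = T g + T h"
  using tempered_lincomb[of T g h 1 1] by simp

lemma conv_lincomb_left:
  assumes g: "g \<in> schwartz \<delta>" and h: "h \<in> schwartz \<delta>" and H: "rapid H"
  shows "conv (\<lambda>x. a * g x + b * h x) H = (\<lambda>x. a * conv g H x + b * conv h H x)"
proof
  fix z
  show "conv (\<lambda>x. a * g x + b * h x) H z = a * conv g H z + b * conv h H z"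
  proof (cases "z \<in> Gam \<delta>")
    case True
    note [simp] = conv_schwartz_integrable[OF g rapid_integrable_0[OF H] True]
      conv_schwartz_integrable[OF h rapid_integrable_0[OF H] True]
    have "(LINT x|\<mu>. (a * g (z - x) + b * h (z - x)) * H x) =
      (LINT x|\<mu>. a * (g (z - x) * H x) + b * (h (z - x) * H x))"
      by (intro Bochner_Integration.integral_cong) (simp_all add: algebra_simps)
    also have "\<dots> = a * (LINT x|\<mu>. g (z - x) * H x) + b * (LINT x|\<mu>. h (z - x) * H x)"
      by simp
    finally show ?thesis using True by (simp add: conv_def)
  qed (simp add: conv_def)
qed

lemma conv_lincomb_right:
  assumes r: "r \<in> schwartz \<delta>" and g: "rapid g" and h: "rapid h"
  shows "conv r (\<lambda>x. a * g x + b * h x) = (\<lambda>x. a * conv r g x + b * conv r h x)"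
proof
  fix z
  show "conv r (\<lambda>x. a * g x + b * h x) z = a * conv r g z + b * conv r h z"
  proof (cases "z \<in> Gam \<delta>")
    case True
    note [simp] = conv_schwartz_integrable[OF r rapid_integrable_0[OF g] True]
      conv_schwartz_integrable[OF r rapid_integrable_0[OF h] True]
    have "(LINT x|\<mu>. r (z - x) * (a * g x + b * h x)) =
      (LINT x|\<mu>. a * (r (z - x) * g x) + b * (r (z - x) * h x))"
      by (intro Bochner_Integration.integral_cong) (simp_all add: algebra_simps)
    also have "\<dots> = a * (LINT x|\<mu>. r (z - x) * g x) + b * (LINT x|\<mu>. r (z - x) * h x)"
      by simp
    finally show ?thesis using True by (simp add: conv_def)
  qed (simp add: conv_def)
qed

lemma rapid_norm_mono: "rapid h \<Longrightarrow> M \<le> N \<Longrightarrow> rapid_norm M h \<le> rapid_norm N h"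
  by (intro integral_mono rapid_integrable_abs mult_right_mono wt_mono_exp) auto

lemma rapid_norm_nonneg: "0 \<le> rapid_norm N h"
  by (intro integral_nonneg_AE) auto

lemma psum_conv:
  assumes r: "r \<in> schwartz \<delta>" and h: "rapid h"
  shows "psum K (conv r h) \<le> 2 ^ K * rapid_norm K h * psum K r"
  unfolding psum_def sum_distrib_left
proof (intro sum_mono)
  fix N k assume N: "N \<in> {..K}"
  have "schwartz_seminorm \<delta> N k (conv r h) \<le> (2 ^ N * rapid_norm N h) * schwartz_seminorm \<delta> N k r"
    using seminorm_conv[OF r h, of N k] by (simp add: mult_ac)
  also have "\<dots> \<le> (2 ^ K * rapid_norm K h) * schwartz_seminorm \<delta> N k r"
    using N by (intro mult_right_mono mult_mono rapid_norm_mono power_increasing seminorm_nonneg r h rapid_norm_nonneg) auto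
  finally show "schwartz_seminorm \<delta> N k (conv r h) \<le> 2 ^ K * rapid_norm K h * schwartz_seminorm \<delta> N k r" .
qed

text \<open>Continuity of convolution with a fixed \<open>H\<close>, transposed to functionals. With
  \<open>H\<close> the reflected Green function this defines the random distribution path by path,
  with the same order \<open>K\<close> as the noise.\<close>

lemma tempered_conv:
  assumes T: "tempered T" and H: "rapid H"
  shows "tempered (\<lambda>g. T (conv g H))"
proof -
  obtain K C where C: "0 \<le> C" "\<And>g. g \<in> schwartz \<delta> \<Longrightarrow> \<bar>T g\<bar> \<le> C * psum K g"
    using T unfolding tempered_def by blast
  have "\<bar>T (conv g H)\<bar> \<le> C * (2 ^ K * rapid_norm K H) * psum K g" if g: "g \<in> schwartz \<delta>" for g
    using order_trans[OF C(2)[OF conv_schwartz[OF g H]] mult_left_mono[OF psum_conv[OF g H] C(1)]]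
    by (simp add: mult_ac)
  moreover have "T (conv (\<lambda>x. a * g x + b * h x) H) = a * T (conv g H) + b * T (conv h H)"
    if "g \<in> schwartz \<delta>" "h \<in> schwartz \<delta>" for g h a b
    using that by (simp add: conv_lincomb_left H tempered_lincomb[OF T] conv_schwartz)
  ultimately show ?thesis unfolding tempered_def using C(1) rapid_norm_nonneg[of K H]
    by (auto intro!: exI[of _ K] exI[of _ "C * (2 ^ K * rapid_norm K H)"])
qed

section \<open>Translates of a test function under a tempered functional\<close>

definition shift :: "'d::finite point \<Rightarrow> 'd fn \<Rightarrow> 'd fn" where
  "shift x r = (\<lambda>z. r (z - x))"

lemma wt_shift_bound:
  assumes "r \<in> schwartz \<delta>"
  shows "wt N z * \<bar>time_deriv k r (z - x)\<bar> \<le> 2 ^ N * wt N x * schwartz_seminorm \<delta> N k r"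
proof -
  have "wt N z * \<bar>time_deriv k r (z - x)\<bar> \<le> 2 ^ N * wt N (z - x) * wt N x * \<bar>time_deriv k r (z - x)\<bar>"
    using wt_plus_le[of N "z - x" x] by (intro mult_right_mono) auto
  also have "\<dots> = 2 ^ N * wt N x * (wt N (z - x) * \<bar>time_deriv k r (z - x)\<bar>)" by (simp add: mult_ac)
  also have "\<dots> \<le> 2 ^ N * wt N x * schwartz_seminorm \<delta> N k r"
    by (intro mult_left_mono seminorm_bound assms) simp
  finally show ?thesis .
qed

lemma
  assumes r: "r \<in> schwartz \<delta>" and x: "x \<in> Gam \<delta>"
  shows shift_schwartz: "shift x r \<in> schwartz \<delta>"
    and time_deriv_shift: "time_deriv k (shift x r) = shift x (time_deriv k r)"
proof -
  have b: "\<exists>B. \<forall>z\<in>Gam \<delta>. wt N z * \<bar>shift x (time_deriv k r) z\<bar> \<le> B" for N k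
    unfolding shift_def using wt_shift_bound[OF r] by blast
  have d: "((\<lambda>s. shift x (time_deriv k r) (s, y)) has_real_derivative shift x (time_deriv (Suc k) r) (t, y)) (at t)"
    for k y t
    unfolding shift_def minus_prod_def fst_conv snd_conv
    by (rule DERIV_shift[THEN iffD1, of _ _ t "- fst x", simplified,
             OF time_deriv_has_derivative[OF r, of k "y - snd x" "t - fst x"], simplified])
  have o: "shift x (time_deriv k r) z = 0" if "z \<notin> Gam \<delta>" for k z
    unfolding shift_def using that x by (intro time_deriv_zero_off r) (simp add: Gam_diff_iff)
  show "shift x r \<in> schwartz \<delta>"
    by (rule schwartzI1[where F = "\<lambda>k. shift x (time_deriv k r)"]) (use b d o in auto)
  show "time_deriv k (shift x r) = shift x (time_deriv k r)"
    by (rule schwartzI2[where F = "\<lambda>k. shift x (time_deriv k r)"]) (use b d o in auto)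
qed

text \<open>The mean value theorem in the time shift: it costs one more time derivative and Peetre's
  factor for the shift, which is largest at the end \<open>b\<close> of the range.\<close>

lemma shift_lipschitz:
  assumes r: "r \<in> schwartz \<delta>" and t: "\<bar>t\<bar> \<le> b" "\<bar>t'\<bar> \<le> b"
  shows "wt N z * \<bar>time_deriv k r (z - (t, y)) - time_deriv k r (z - (t', y))\<bar> \<le>
    2 ^ N * wt N (b, y) * schwartz_seminorm \<delta> N (Suc k) r * \<bar>t - t'\<bar>"
proof -
  let ?B = "2 ^ N * wt N (b, y) * schwartz_seminorm \<delta> N (Suc k) r"
  let ?f = "\<lambda>k s. time_deriv k r (fst z - s, snd z - y)"
  have "norm (?f k t - ?f k t') \<le> (?B / wt N z) * norm (t - t')"
  proof (rule field_differentiable_bound[where S = "{-b..b}" and f' = "\<lambda>s. - ?f (Suc k) s"])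
    fix s assume s: "s \<in> {-b..b}"
    have "((\<lambda>s. time_deriv k r (s, snd z - y)) has_real_derivative ?f (Suc k) s) (at (fst z - s))"
      by (rule time_deriv_has_derivative[OF r])
    then have "(?f k has_real_derivative ?f (Suc k) s * (- 1)) (at s)"
      by (rule DERIV_chain2[where g = "\<lambda>s. fst z - s"]) (auto intro!: derivative_eq_intros)
    then have "(?f k has_real_derivative - ?f (Suc k) s) (at s)" by simp
    then show "(?f k has_real_derivative - ?f (Suc k) s) (at s within {-b..b})"
      by (rule has_field_derivative_at_within)
    have "wt N z * \<bar>time_deriv (Suc k) r (z - (s, y))\<bar> \<le> 2 ^ N * wt N (s, y) * schwartz_seminorm \<delta> N (Suc k) r"
      by (rule wt_shift_bound[OF r])
    also have "\<dots> \<le> ?B"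
      using s by (intro mult_right_mono mult_left_mono wt_mono_norm seminorm_nonneg r)
        (auto simp: norm_Pair abs_le_square_iff[symmetric])
    finally show "norm (- ?f (Suc k) s) \<le> ?B / wt N z"
      using wt_pos[of N z] by (simp add: minus_prod_def field_simps)
  qed (use t in auto)
  then show ?thesis using wt_pos[of N z] by (simp add: minus_prod_def field_simps)
qed

text \<open>Serves the two kinds of functions that live on a single time line: cuts to a one-site
  slab, and products with a mollifier.\<close>

lemma
  fixes f :: "'d::finite fn"
  assumes f: "f \<in> borel_measurable \<mu>" and y: "y \<in> lattice \<delta>"
    and off: "\<And>x. x \<in> Gam \<delta> \<Longrightarrow> snd x \<noteq> y \<Longrightarrow> f x = 0"
  shows integrable_site: "integrable \<mu> f \<longleftrightarrow> integrable lborel (\<lambda>t. f (t, y))"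
    and integral_site: "(LINT x|\<mu>. f x) = \<delta> ^ CARD('d) * (LINT t|lborel. f (t, y))"
proof -
  have [measurable]: "(\<lambda>t. f (t, y)) \<in> borel_measurable borel" by (rule measurable_\<mu>_D[OF f y])
  \<comment> \<open>A general \<open>g\<close> with \<open>g 0 = 0\<close> covers the norm, the
    positive part and the negative part in one computation.\<close>
  have nn: "(\<integral>\<^sup>+x. g (f x) \<partial>\<mu>) = ennreal (\<delta> ^ CARD('d)) * (\<integral>\<^sup>+t. g (f (t, y)) \<partial>lborel)"
    if [measurable]: "g \<in> borel_measurable borel" and g0: "g 0 = 0" for g :: "real \<Rightarrow> ennreal"
  proof -
    have "(\<integral>\<^sup>+x. g (f x) \<partial>\<mu>) =
      ennreal (\<delta> ^ CARD('d)) * (\<integral>\<^sup>+z. (\<integral>\<^sup>+t. g (f (t, z)) \<partial>lborel) \<partial>count_space (lattice \<delta>))"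
      using f by (intro nn_integral_\<mu>) measurable
    also have "(\<integral>\<^sup>+z. (\<integral>\<^sup>+t. g (f (t, z)) \<partial>lborel) \<partial>count_space (lattice \<delta>)) =
      (\<Sum>z\<in>{y}. (\<integral>\<^sup>+t. g (f (t, z)) \<partial>lborel))"
      by (rule nn_integral_count_space') (use y off g0 in \<open>auto simp: Gam_iff\<close>)
    finally show ?thesis by simp
  qed
  have d: "0 < \<delta> ^ CARD('d)" using pos by simp
  show i: "integrable \<mu> f \<longleftrightarrow> integrable lborel (\<lambda>t. f (t, y))"
    unfolding integrable_iff_bounded using nn[of "\<lambda>u. ennreal (norm u)"] f d pos
    by (auto simp: ennreal_mult_less_top ennreal_zero_less_mult_iff less_top)
  show "(LINT x|\<mu>. f x) = \<delta> ^ CARD('d) * (LINT t|lborel. f (t, y))"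
  proof (cases "integrable \<mu> f")
    case True
    then have "(LINT x|\<mu>. f x) = enn2real (\<integral>\<^sup>+x. ennreal (f x) \<partial>\<mu>) - enn2real (\<integral>\<^sup>+x. ennreal (- f x) \<partial>\<mu>)"
      by (rule real_lebesgue_integral_def)
    also have "\<dots> = \<delta> ^ CARD('d) * (enn2real (\<integral>\<^sup>+t. ennreal (f (t, y)) \<partial>lborel) - enn2real (\<integral>\<^sup>+t. ennreal (- f (t, y)) \<partial>lborel))"
      using nn[of ennreal] nn[of "\<lambda>u. ennreal (- u)"] d by (simp add: enn2real_mult right_diff_distrib)
    also have "\<dots> = \<delta> ^ CARD('d) * (LINT t|lborel. f (t, y))"
      using True[unfolded i] by (simp add: real_lebesgue_integral_def)
    finally show ?thesis .
  next
    case False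
    with i show ?thesis by (simp add: not_integrable_integral_eq)
  qed
qed

definition cut :: "'d::finite point set \<Rightarrow> 'd fn \<Rightarrow> 'd fn" where
  "cut A h = (\<lambda>x. indicator A x * h x)"

text \<open>Half open in time, so that consecutive slabs are disjoint and join to a slab; a slab of
  zero duration is empty.\<close>

definition slab :: "real \<Rightarrow> real \<Rightarrow> (real^'d::finite) set \<Rightarrow> 'd point set" where
  "slab s t F = {s<..t} \<times> F"

lemma slab_measurable: "finite F \<Longrightarrow> slab s t F \<in> sets borel"
  unfolding slab_def by (subst borel_prod[symmetric]) (intro pair_measureI, auto simp: finite_imp_closed)

lemma cut_rapid:
  assumes "A \<in> sets borel" "rapid h"
  shows "rapid (cut A h)"
proof (rule rapid_dominated[OF assms(2), where C = 1])
  have "indicator A \<in> borel_measurable \<mu>" using assms(1) by (intro borel_measurable_\<mu>) simp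
  then show "cut A h \<in> borel_measurable \<mu>"
    unfolding cut_def using rapid_measurable[OF assms(2)] by (intro borel_measurable_times)
qed (simp add: cut_def indicator_def)

lemma time_deriv_shift_apply:
  "r \<in> schwartz \<delta> \<Longrightarrow> x \<in> Gam \<delta> \<Longrightarrow> time_deriv k (shift x r) z = time_deriv k r (z - x)"
  unfolding time_deriv_shift by (simp add: shift_def)

text \<open>One constant for two estimates. The first says that \<open>T\<close> of a translate is
  locally Lipschitz in the time shift. The second compares a convolution over a short slab with the
  total mass put at the starting time \<open>s\<close>: the kernels differ by a translate over at
  most \<open>t - s\<close>, which costs that factor times the L1 mass.\<close>

lemma shift_tempered_lipschitz:
  fixes y :: "real^'d::finite"
  assumes T: "tempered T" and r: "r \<in> schwartz \<delta>" and y: "y \<in> lattice \<delta>"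
  shows "\<exists>C\<ge>0. (\<forall>t t'. \<bar>t\<bar> \<le> b \<longrightarrow> \<bar>t'\<bar> \<le> b \<longrightarrow> \<bar>T (shift (t, y) r) - T (shift (t', y) r)\<bar> \<le> C * \<bar>t - t'\<bar>) \<and>
    (\<forall>s t h. rapid h \<longrightarrow> - b \<le> s \<longrightarrow> s \<le> t \<longrightarrow> t \<le> b \<longrightarrow> (\<forall>x. x \<notin> slab s t {y} \<longrightarrow> h x = 0) \<longrightarrow>
      \<bar>T (conv r h) - (LINT x|\<mu>. h x) * T (shift (s, y) r)\<bar> \<le> C * (t - s) * (LINT x|\<mu>. \<bar>h x\<bar>))"
proof -
  obtain K C where C: "0 \<le> C" "\<And>g. g \<in> schwartz \<delta> \<Longrightarrow> \<bar>T g\<bar> \<le> C * psum K g"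
    using T unfolding tempered_def by blast
  define L where "L = (\<Sum>N\<le>K. \<Sum>k\<le>K. 2 ^ N * wt N (b, y) * schwartz_seminorm \<delta> N (Suc k) r)"
  have L0: "0 \<le> L" unfolding L_def by (intro sum_nonneg mult_nonneg_nonneg seminorm_nonneg r) auto
  have G: "(t, y) \<in> Gam \<delta>" for t using y by (simp add: Gam_iff)
  have psum_le: "psum K g \<le> L * c"
    if "\<And>N k z. z \<in> Gam \<delta> \<Longrightarrow> wt N z * \<bar>time_deriv k g z\<bar> \<le> 2 ^ N * wt N (b, y) * schwartz_seminorm \<delta> N (Suc k) r * c" for g c
    unfolding L_def psum_def sum_distrib_right by (intro sum_mono seminorm_le that)
  show ?thesis
  proof (intro exI[of _ "C * L"] conjI allI impI)
    fix t t' assume t: "\<bar>t\<bar> \<le> b" "\<bar>t'\<bar> \<le> b"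
    note s = shift_schwartz[OF r G]
    have "psum K (\<lambda>x. shift (t, y) r x - shift (t', y) r x) \<le> L * \<bar>t - t'\<bar>"
    proof (rule psum_le)
      fix N k z
      show "wt N z * \<bar>time_deriv k (\<lambda>x. shift (t, y) r x - shift (t', y) r x) z\<bar> \<le>
        2 ^ N * wt N (b, y) * schwartz_seminorm \<delta> N (Suc k) r * \<bar>t - t'\<bar>"
        unfolding time_deriv_diff[OF s s] time_deriv_shift_apply[OF r G] by (rule shift_lipschitz[OF r t])
    qed
    then have "\<bar>T (\<lambda>x. shift (t, y) r x - shift (t', y) r x)\<bar> \<le> C * (L * \<bar>t - t'\<bar>)"
      by (rule order_trans[OF C(2)[OF diff_schwartz[OF s s]] mult_left_mono[OF _ C(1)]])
    then show "\<bar>T (shift (t, y) r) - T (shift (t', y) r)\<bar> \<le> C * L * \<bar>t - t'\<bar>"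
      by (simp add: tempered_diff[OF T s s] mult_ac)
  next
    fix s t h assume h: "rapid h" and s: "- b \<le> s" "s \<le> t" "t \<le> b"
      and off: "\<forall>x. x \<notin> slab s t {y} \<longrightarrow> h x = 0"
    let ?c = "LINT x|\<mu>. h x"
    let ?u = "\<lambda>x. 1 * conv r h x + (- ?c) * shift (s, y) r x"
    note sch = conv_schwartz[OF r h] shift_schwartz[OF r G]
    have "psum K ?u \<le> L * ((t - s) * (LINT x|\<mu>. \<bar>h x\<bar>))"
    proof (rule psum_le)
      fix N k and z :: "'d point" assume z: "z \<in> Gam \<delta>"
      let ?B = "2 ^ N * wt N (b, y) * schwartz_seminorm \<delta> N (Suc k) r"
      note i1 = conv_schwartz_integrable[OF time_deriv_schwartz[OF r] rapid_integrable_0[OF h] z, of k]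
      have i2: "integrable \<mu> (\<lambda>x. time_deriv k r (z - (s, y)) * h x)"
        using rapid_integrable_0[OF h] by simp
      have "time_deriv k ?u z = conv (time_deriv k r) h z - ?c * shift (s, y) (time_deriv k r) z"
        unfolding time_deriv_lincomb[OF sch] time_deriv_conv[OF r h] time_deriv_shift[OF r G] by simp
      also have "\<dots> = (LINT x|\<mu>. time_deriv k r (z - x) * h x) - (LINT x|\<mu>. time_deriv k r (z - (s, y)) * h x)"
        using z by (simp add: conv_def shift_def)
      also have "\<dots> = (LINT x|\<mu>. (time_deriv k r (z - x) - time_deriv k r (z - (s, y))) * h x)"
        using i1 i2 by (simp add: left_diff_distrib)
      finally have "wt N z * \<bar>time_deriv k ?u z\<bar> =
        \<bar>LINT x|\<mu>. wt N z * ((time_deriv k r (z - x) - time_deriv k r (z - (s, y))) * h x)\<bar>"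
        by (simp add: abs_mult)
      also have "\<dots> \<le> (LINT x|\<mu>. ?B * (t - s) * \<bar>h x\<bar>)"
      proof (rule integral_abs_bound_integral)
        show "integrable \<mu> (\<lambda>x. wt N z * ((time_deriv k r (z - x) - time_deriv k r (z - (s, y))) * h x))"
          using i1 i2 by (simp add: left_diff_distrib)
        show "integrable \<mu> (\<lambda>x. ?B * (t - s) * \<bar>h x\<bar>)" using rapid_integrable_0[OF h] by simp
        fix x
        show "\<bar>wt N z * ((time_deriv k r (z - x) - time_deriv k r (z - (s, y))) * h x)\<bar> \<le> ?B * (t - s) * \<bar>h x\<bar>"
        proof (cases "x \<in> slab s t {y}")
          case True
          then obtain u where u: "x = (u, y)" "s < u" "u \<le> t" by (auto simp: slab_def)
          have "wt N z * \<bar>time_deriv k r (z - x) - time_deriv k r (z - (s, y))\<bar> \<le> ?B * \<bar>u - s\<bar>"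
            unfolding u(1) by (rule shift_lipschitz[OF r]) (use u s in auto)
          also have "\<dots> \<le> ?B * (t - s)"
            using u by (intro mult_left_mono mult_nonneg_nonneg seminorm_nonneg r) auto
          finally show ?thesis by (simp add: abs_mult mult.assoc[symmetric] mult_right_mono)
        next
          case False
          then have "h x = 0" using off by blast
          then show ?thesis by simp
        qed
      qed
      finally show "wt N z * \<bar>time_deriv k ?u z\<bar> \<le> ?B * ((t - s) * (LINT x|\<mu>. \<bar>h x\<bar>))"
        by (simp add: mult_ac)
    qed
    then have "\<bar>T ?u\<bar> \<le> C * (L * ((t - s) * (LINT x|\<mu>. \<bar>h x\<bar>)))"
      by (rule order_trans[OF C(2)[OF lincomb_schwartz[OF sch]] mult_left_mono[OF _ C(1)]])
    then show "\<bar>T (conv r h) - ?c * T (shift (s, y) r)\<bar> \<le> C * L * (t - s) * (LINT x|\<mu>. \<bar>h x\<bar>)"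
      unfolding tempered_lincomb[OF T sch] by (simp add: mult_ac)
  qed (use C L0 in auto)
qed

lemma shift_tempered_continuous:
  assumes T: "tempered T" and r: "r \<in> schwartz \<delta>" and y: "y \<in> lattice \<delta>"
  shows "isCont (\<lambda>t. T (shift (t, y) r)) t0"
proof -
  obtain C where C: "0 \<le> C"
    "\<And>t t'. \<bar>t\<bar> \<le> \<bar>t0\<bar> + 1 \<Longrightarrow> \<bar>t'\<bar> \<le> \<bar>t0\<bar> + 1 \<Longrightarrow> \<bar>T (shift (t, y) r) - T (shift (t', y) r)\<bar> \<le> C * \<bar>t - t'\<bar>"
    using shift_tempered_lipschitz[OF T r y, of "\<bar>t0\<bar> + 1"] by blast
  have "((\<lambda>t. T (shift (t, y) r) - T (shift (t0, y) r)) \<longlongrightarrow> 0) (at t0)"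
  proof (rule Lim_null_comparison)
    have "\<forall>\<^sub>F t in at t0. \<bar>t - t0\<bar> < 1"
      unfolding eventually_at dist_real_def by (intro exI[of _ 1]) auto
    then show "\<forall>\<^sub>F t in at t0. norm (T (shift (t, y) r) - T (shift (t0, y) r)) \<le> C * \<bar>t - t0\<bar>"
      by eventually_elim (auto intro!: C(2))
    have "((\<lambda>t. C * \<bar>t - t0\<bar>) \<longlongrightarrow> C * \<bar>t0 - t0\<bar>) (at t0)" by (intro tendsto_intros)
    then show "((\<lambda>t. C * \<bar>t - t0\<bar>) \<longlongrightarrow> 0) (at t0)" by simp
  qed
  then show ?thesis unfolding isCont_def by (simp add: LIM_zero_iff)
qed

lemma shift_tempered_measurable:
  assumes "tempered T" "r \<in> schwartz \<delta>"
  shows "(\<lambda>x. T (shift x r)) \<in> borel_measurable \<mu>"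
  by (rule measurable_\<mu>_I, rule borel_measurable_continuous_onI)
    (auto intro!: continuous_at_imp_continuous_on shift_tempered_continuous assms)

text \<open>A regularised distribution grows at most polynomially, with exponent the order of
  \<open>T\<close>. This is what makes its integral against a rapidly decreasing function
  converge.\<close>

lemma shift_tempered_bound:
  assumes T: "tempered T" and r: "r \<in> schwartz \<delta>"
  shows "\<exists>K C. \<forall>x\<in>Gam \<delta>. \<bar>T (shift x r)\<bar> \<le> C * wt K x"
proof -
  obtain K C where C: "0 \<le> C" "\<And>g. g \<in> schwartz \<delta> \<Longrightarrow> \<bar>T g\<bar> \<le> C * psum K g"
    using T unfolding tempered_def by blast
  have "\<bar>T (shift x r)\<bar> \<le> C * (2 ^ K * psum K r) * wt K x" if x: "x \<in> Gam \<delta>" for x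
  proof -
    have "psum K (shift x r) \<le> (2 ^ K * wt K x) * psum K r"
      unfolding psum_def sum_distrib_left
    proof (intro sum_mono)
      fix N k assume N: "N \<in> {..K}"
      have "schwartz_seminorm \<delta> N k (shift x r) \<le> 2 ^ N * wt N x * schwartz_seminorm \<delta> N k r"
        by (rule seminorm_le) (simp only: time_deriv_shift_apply[OF r x] wt_shift_bound[OF r])
      also have "\<dots> \<le> 2 ^ K * wt K x * schwartz_seminorm \<delta> N k r"
        using N by (intro mult_right_mono mult_mono wt_mono_exp power_increasing seminorm_nonneg r) auto
      finally show "schwartz_seminorm \<delta> N k (shift x r) \<le> 2 ^ K * wt K x * schwartz_seminorm \<delta> N k r" .
    qed
    then have "C * psum K (shift x r) \<le> C * ((2 ^ K * wt K x) * psum K r)"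
      by (rule mult_left_mono[OF _ C(1)])
    with C(2)[OF shift_schwartz[OF r x]] show ?thesis by (simp add: mult_ac)
  qed
  then show ?thesis by blast
qed

lemma integrable_shift_tempered:
  assumes T: "tempered T" and r: "r \<in> schwartz \<delta>" and h: "rapid h"
  shows "integrable \<mu> (\<lambda>x. T (shift x r) * h x)"
proof -
  obtain K C where C: "\<And>x. x \<in> Gam \<delta> \<Longrightarrow> \<bar>T (shift x r)\<bar> \<le> C * wt K x"
    using shift_tempered_bound[OF T r] by blast
  show ?thesis
  proof (rule Bochner_Integration.integrable_bound)
    show "integrable \<mu> (\<lambda>x. C * (wt K x * \<bar>h x\<bar>))" using rapid_integrable_abs[OF h] by simp
    show "(\<lambda>x. T (shift x r) * h x) \<in> borel_measurable \<mu>"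
      by (intro borel_measurable_times shift_tempered_measurable T r rapid_measurable h)
    have "\<bar>T (shift x r) * h x\<bar> \<le> C * (wt K x * \<bar>h x\<bar>)" if "x \<in> space \<mu>" for x
      using mult_right_mono[OF C, of x "\<bar>h x\<bar>"] that by (simp add: abs_mult mult.assoc)
    then show "AE x in \<mu>. norm (T (shift x r) * h x) \<le> norm (C * (wt K x * \<bar>h x\<bar>))"
      unfolding real_norm_def by (intro AE_I2 order_trans[OF _ abs_ge_self])
  qed
qed

section \<open>Exchanging a tempered functional with the convolution integral\<close>

definition commutes :: "('d::finite fn \<Rightarrow> real) \<Rightarrow> 'd fn \<Rightarrow> 'd fn \<Rightarrow> bool" where
  "commutes T r h \<longleftrightarrow> T (conv r h) = (LINT x|\<mu>. T (shift x r) * h x)"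

lemma commutes_add:
  assumes T: "tempered T" and r: "r \<in> schwartz \<delta>" and g: "rapid g" "commutes T r g" and h: "rapid h" "commutes T r h"
  shows "commutes T r (\<lambda>x. g x + h x)"
proof -
  have "conv r (\<lambda>x. g x + h x) = (\<lambda>x. conv r g x + conv r h x)"
    using conv_lincomb_right[OF r g(1) h(1), of 1 1] by simp
  then have "T (conv r (\<lambda>x. g x + h x)) = T (conv r g) + T (conv r h)"
    by (simp only: tempered_add[OF T conv_schwartz[OF r g(1)] conv_schwartz[OF r h(1)]])
  also have "\<dots> = (LINT x|\<mu>. T (shift x r) * g x + T (shift x r) * h x)"
    using g(2) h(2) by (simp add: commutes_def integrable_shift_tempered[OF T r] g(1) h(1))
  finally show ?thesis by (simp add: commutes_def distrib_left)
qed

lemma conv_zero: "conv r (\<lambda>_. 0) = (\<lambda>_. 0)"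
  by (simp add: conv_def fun_eq_iff)

text \<open>Boundedness of \<open>h\<close> makes the mass of a slab proportional to its duration,
  which supplies the second factor \<open>t - s\<close> of the quadratic increments.\<close>

lemma integral_slab_le:
  fixes y :: "real^'d::finite"
  assumes h: "rapid h" and B: "\<And>x. \<bar>h x\<bar> \<le> B" and y: "y \<in> lattice \<delta>" and s: "s \<le> t"
  shows "(LINT x|\<mu>. \<bar>cut (slab s t {y}) h x\<bar>) \<le> B * \<delta> ^ CARD('d) * (t - s)"
proof -
  let ?A = "slab s t {y}"
  have i: "integrable \<mu> (\<lambda>x. \<bar>cut ?A h x\<bar>)"
    by (intro integrable_abs rapid_integrable_0 cut_rapid slab_measurable h) simp
  have z: "x \<in> Gam \<delta> \<Longrightarrow> snd x \<noteq> y \<Longrightarrow> \<bar>cut ?A h x\<bar> = 0" for x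
    by (cases x) (auto simp: cut_def slab_def)
  have "(LINT x|\<mu>. \<bar>cut ?A h x\<bar>) = \<delta> ^ CARD('d) * (LINT u|lborel. \<bar>cut ?A h (u, y)\<bar>)"
    by (rule integral_site[OF borel_measurable_integrable[OF i] y z])
  also have "(LINT u|lborel. \<bar>cut ?A h (u, y)\<bar>) \<le> (LINT u|lborel. B * indicator {s<..t} u)"
  proof (rule integral_mono)
    show "integrable lborel (\<lambda>u. \<bar>cut ?A h (u, y)\<bar>)"
      using i integrable_site[OF borel_measurable_integrable[OF i] y z] by simp
    show "\<bar>cut ?A h (u, y)\<bar> \<le> B * indicator {s<..t} u" for u
      using B by (auto simp: cut_def slab_def indicator_def)
  qed (use s in \<open>auto intro!: integrable_mult_right integrable_real_indicator simp: emeasure_lborel_Ioc\<close>)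
  also have "(LINT u|lborel. B * indicator {s<..t} u) = B * (t - s)"
    using s by simp
  finally show ?thesis using pos by (simp add: mult_ac)
qed

text \<open>\<open>D t\<close> is the defect of the exchange for the slab from \<open>-b\<close> to
  \<open>t\<close>. Its increments are quadratic, one factor coming from the Lipschitz estimate and
  one from the mass, so \<open>D\<close> does not change; at \<open>-b\<close> the slab is empty and
  \<open>D\<close> is 0.\<close>

lemma commutes_slab_site:
  fixes y :: "real^'d::finite"
  assumes T: "tempered T" and r: "r \<in> schwartz \<delta>" and h: "rapid h" and B: "\<And>x. \<bar>h x\<bar> \<le> B"
    and y: "y \<in> lattice \<delta>" and b: "0 \<le> b"
  shows "commutes T r (cut (slab (- b) b {y}) h)"
proof -
  let ?f = "\<lambda>x. T (shift x r)"
  let ?h = "\<lambda>s t. cut (slab s t {y}) h"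
  define D where "D t = T (conv r (?h (- b) t)) - (LINT x|\<mu>. ?f x * ?h (- b) t x)" for t
  note rap = cut_rapid[OF slab_measurable h, of "{y}", simplified]
  obtain C where C: "0 \<le> C"
    and C1: "\<And>t t'. \<bar>t\<bar> \<le> b \<Longrightarrow> \<bar>t'\<bar> \<le> b \<Longrightarrow> \<bar>T (shift (t, y) r) - T (shift (t', y) r)\<bar> \<le> C * \<bar>t - t'\<bar>"
    and C2: "\<And>s t h. rapid h \<Longrightarrow> - b \<le> s \<Longrightarrow> s \<le> t \<Longrightarrow> t \<le> b \<Longrightarrow> (\<forall>x. x \<notin> slab s t {y} \<longrightarrow> h x = 0) \<Longrightarrow>
      \<bar>T (conv r h) - (LINT x|\<mu>. h x) * T (shift (s, y) r)\<bar> \<le> C * (t - s) * (LINT x|\<mu>. \<bar>h x\<bar>)"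
    using shift_tempered_lipschitz[OF T r y, of b] by blast
  have "D b = D (- b)"
  proof (rule eq_of_quadratic_increments[OF b, where A = "2 * C * (B * \<delta> ^ CARD('d))"])
    fix s t assume st: "- b \<le> s" "s \<le> t" "t \<le> b"
    have split: "?h (- b) t = (\<lambda>x. 1 * ?h (- b) s x + 1 * ?h s t x)"
      using st by (auto simp: cut_def slab_def indicator_def fun_eq_iff)
    have "T (conv r (?h (- b) t)) = T (conv r (?h (- b) s)) + T (conv r (?h s t))"
      unfolding split conv_lincomb_right[OF r rap rap] tempered_lincomb[OF T conv_schwartz[OF r rap] conv_schwartz[OF r rap]]
      by simp
    moreover have "(LINT x|\<mu>. ?f x * ?h (- b) t x) = (LINT x|\<mu>. ?f x * ?h (- b) s x) + (LINT x|\<mu>. ?f x * ?h s t x)"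
      unfolding split using integrable_shift_tempered[OF T r rap] by (simp add: distrib_left)
    ultimately have "D t - D s = T (conv r (?h s t)) - (LINT x|\<mu>. ?f x * ?h s t x)"
      by (simp add: D_def)
    \<comment> \<open>Both the functional of the convolution and the integral are compared with the
      same quantity, in which \<open>?f\<close> is frozen at the start of the slab.\<close>
    also have "\<dots> = (T (conv r (?h s t)) - (LINT x|\<mu>. ?h s t x) * ?f (s, y)) -
       (LINT x|\<mu>. (?f x - ?f (s, y)) * ?h s t x)"
      using integrable_shift_tempered[OF T r rap] rapid_integrable_0[OF rap]
      by (simp add: left_diff_distrib mult.commute[of _ "?f (s, y)"])
    finally have "\<bar>D t - D s\<bar> \<le> \<bar>T (conv r (?h s t)) - (LINT x|\<mu>. ?h s t x) * ?f (s, y)\<bar> +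
       \<bar>LINT x|\<mu>. (?f x - ?f (s, y)) * ?h s t x\<bar>" by simp
    also have "\<bar>T (conv r (?h s t)) - (LINT x|\<mu>. ?h s t x) * ?f (s, y)\<bar> \<le> C * (t - s) * (LINT x|\<mu>. \<bar>?h s t x\<bar>)"
      by (rule C2[OF rap st]) (simp add: cut_def)
    also have "\<bar>LINT x|\<mu>. (?f x - ?f (s, y)) * ?h s t x\<bar> \<le> (LINT x|\<mu>. C * (t - s) * \<bar>?h s t x\<bar>)"
    proof (rule integral_abs_bound_integral)
      show "integrable \<mu> (\<lambda>x. (?f x - ?f (s, y)) * ?h s t x)"
        using integrable_shift_tempered[OF T r rap] rapid_integrable_0[OF rap] by (simp add: left_diff_distrib)
      show "integrable \<mu> (\<lambda>x. C * (t - s) * \<bar>?h s t x\<bar>)" using rapid_integrable_0[OF rap] by simp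
      fix x
      show "\<bar>(?f x - ?f (s, y)) * ?h s t x\<bar> \<le> C * (t - s) * \<bar>?h s t x\<bar>"
      proof (cases "x \<in> slab s t {y}")
        case True
        then obtain u where u: "x = (u, y)" "s < u" "u \<le> t" by (auto simp: slab_def)
        have "\<bar>?f x - ?f (s, y)\<bar> \<le> C * \<bar>u - s\<bar>" unfolding u(1) by (rule C1) (use u st in auto)
        also have "\<dots> \<le> C * (t - s)" using u C by (intro mult_left_mono) auto
        finally show ?thesis by (simp add: abs_mult mult_right_mono)
      qed (simp add: cut_def)
    qed
    also have "C * (t - s) * (LINT x|\<mu>. \<bar>?h s t x\<bar>) + (LINT x|\<mu>. C * (t - s) * \<bar>?h s t x\<bar>) =
      2 * C * (t - s) * (LINT x|\<mu>. \<bar>?h s t x\<bar>)" by simp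
    also have "\<dots> \<le> 2 * C * (t - s) * (B * \<delta> ^ CARD('d) * (t - s))"
      using C st by (intro mult_left_mono integral_slab_le h B y) auto
    finally show "\<bar>D t - D s\<bar> \<le> 2 * C * (B * \<delta> ^ CARD('d)) * (t - s)\<^sup>2"
      by (simp add: power2_eq_square algebra_simps)
  qed
  also have "D (- b) = 0"
  proof -
    have "?h (- b) (- b) = (\<lambda>_. 0)" by (simp add: cut_def slab_def fun_eq_iff)
    then show ?thesis by (simp add: D_def conv_zero tempered_zero[OF T])
  qed
  finally show ?thesis by (simp add: D_def commutes_def)
qed

lemma commutes_slab:
  assumes T: "tempered T" and r: "r \<in> schwartz \<delta>" and h: "rapid h" and B: "\<And>x. \<bar>h x\<bar> \<le> B"
    and b: "0 \<le> b" and "finite F" "F \<subseteq> lattice \<delta>"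
  shows "commutes T r (cut (slab (- b) b F) h)"
  using assms(6,7)
proof (induction F rule: finite_induct)
  case empty
  then show ?case by (simp add: cut_def slab_def commutes_def conv_zero tempered_zero[OF T])
next
  case (insert y F)
  have "cut (slab (- b) b (insert y F)) h = (\<lambda>x. cut (slab (- b) b {y}) h x + cut (slab (- b) b F) h x)"
    using insert.hyps by (auto simp: cut_def slab_def indicator_def fun_eq_iff)
  then show ?case using insert
    by (simp only:, intro commutes_add T r cut_rapid slab_measurable h commutes_slab_site[OF T r h B _ b]) auto
qed

text \<open>\<open>conv r h\<close> is formally the integral of the translates
  \<open>shift x r\<close> with weights \<open>h x\<close>, and \<open>T\<close> is moved inside it.
  Slabs over finitely many sites exhaust the cylinder: the integral converges by dominated
  convergence, and the functional because the weighted L1 norm of the remainder tends to 0 and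
  bounds the seminorms of its convolution.\<close>

theorem commutes_bounded:
  fixes h :: "'d::finite fn"
  assumes T: "tempered T" and r: "r \<in> schwartz \<delta>" and h: "rapid h" and B: "\<And>x. \<bar>h x\<bar> \<le> B"
  shows "T (conv r h) = (LINT x|\<mu>. T (shift x r) * h x)"
proof -
  let ?f = "\<lambda>x. T (shift x r)"
  define F where "F n = from_nat_into (lattice \<delta> :: (real^'d) set) ` {..<n}" for n
  define A where "A n = slab (- real n) (real n) (F n)" for n
  have ne: "lattice \<delta> \<noteq> ({} :: (real^'d) set)" using lattice_0 by blast
  have F: "finite (F n)" "F n \<subseteq> lattice \<delta>" for n
    using from_nat_into[OF ne] by (auto simp: F_def)
  have rap: "rapid (cut (A n) h)" for n
    unfolding A_def by (intro cut_rapid slab_measurable F h)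
  have in_A: "\<forall>\<^sub>F n in sequentially. x \<in> A n" if x: "x \<in> Gam \<delta>" for x
  proof -
    obtain j where j: "snd x = from_nat_into (lattice \<delta>) j"
      using from_nat_into_surj[OF countable_lattice, of "snd x"] x unfolding Gam_iff by metis
    obtain m :: nat where m: "\<bar>fst x\<bar> < real m" using reals_Archimedean2 by blast
    show ?thesis
    proof (rule eventually_sequentiallyI[of "max m (Suc j)"])
      fix n assume "max m (Suc j) \<le> n"
      then have "m \<le> n" "j < n" by auto
      then show "x \<in> A n" using m j unfolding A_def slab_def F_def by (cases x) auto
    qed
  qed
  have lim: "(\<lambda>n. cut (A n) h x) \<longlonglongrightarrow> h x" if "x \<in> Gam \<delta>" for x
    by (rule tendsto_eventually, rule eventually_mono[OF in_A[OF that]]) (simp add: cut_def)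
  have "(\<lambda>n. LINT x|\<mu>. ?f x * cut (A n) h x) \<longlonglongrightarrow> (LINT x|\<mu>. ?f x * h x)"
  proof (rule integral_dominated_convergence)
    show "integrable \<mu> (\<lambda>x. \<bar>?f x * h x\<bar>)" using integrable_shift_tempered[OF T r h] by simp
    show "AE x in \<mu>. (\<lambda>n. ?f x * cut (A n) h x) \<longlonglongrightarrow> ?f x * h x"
      using lim by (intro AE_I2 tendsto_mult_left) simp
    show "AE x in \<mu>. norm (?f x * cut (A n) h x) \<le> \<bar>?f x * h x\<bar>" for n
      by (intro AE_I2) (simp add: cut_def indicator_def abs_mult)
  qed (intro borel_measurable_times shift_tempered_measurable T r rapid_measurable h rap)+
  moreover have "(LINT x|\<mu>. ?f x * cut (A n) h x) = T (conv r (cut (A n) h))" for n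
    using commutes_slab[OF T r h B _ F, of "real n" n] unfolding commutes_def A_def by simp
  moreover have "(\<lambda>n. T (conv r (cut (A n) h))) \<longlonglongrightarrow> T (conv r h)"
  proof -
    obtain K C where C: "0 \<le> C" "\<And>g. g \<in> schwartz \<delta> \<Longrightarrow> \<bar>T g\<bar> \<le> C * psum K g"
      using T unfolding tempered_def by blast
    have rd: "rapid (\<lambda>x. cut (A n) h x - h x)" for n
      by (rule rapid_dominated[OF h, where C = 1], intro borel_measurable_diff rapid_measurable rap h)
        (simp add: cut_def indicator_def)
    have "(\<lambda>n. rapid_norm K (\<lambda>x. cut (A n) h x - h x)) \<longlonglongrightarrow> (LINT x|(\<mu> :: 'd point measure). (0::real))"
    proof (rule integral_dominated_convergence)
      show "integrable \<mu> (\<lambda>x. wt K x * \<bar>h x\<bar>)" by (rule rapid_integrable_abs[OF h])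
      have "(\<lambda>n. wt K x * \<bar>cut (A n) h x - h x\<bar>) \<longlonglongrightarrow> wt K x * \<bar>h x - h x\<bar>" if "x \<in> Gam \<delta>" for x
        by (intro tendsto_intros lim that)
      then show "AE x in \<mu>. (\<lambda>n. wt K x * \<bar>cut (A n) h x - h x\<bar>) \<longlonglongrightarrow> 0"
        by (intro AE_I2) simp
      show "AE x in \<mu>. norm (wt K x * \<bar>cut (A n) h x - h x\<bar>) \<le> wt K x * \<bar>h x\<bar>" for n
        by (intro AE_I2) (simp add: cut_def indicator_def abs_mult)
    qed (use rapid_measurable[OF rd] in measurable)
    then have "(\<lambda>n. C * (2 ^ K * rapid_norm K (\<lambda>x. cut (A n) h x - h x) * psum K r)) \<longlonglongrightarrow> C * (2 ^ K * 0 * psum K r)"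
      by (intro tendsto_intros) simp
    then have z: "(\<lambda>n. C * (2 ^ K * rapid_norm K (\<lambda>x. cut (A n) h x - h x) * psum K r)) \<longlonglongrightarrow> 0" by simp
    have "norm (T (conv r (cut (A n) h)) - T (conv r h)) \<le> C * (2 ^ K * rapid_norm K (\<lambda>x. cut (A n) h x - h x) * psum K r)" for n
    proof -
      have "T (conv r (cut (A n) h)) - T (conv r h) = T (\<lambda>x. conv r (cut (A n) h) x - conv r h x)"
        by (rule tempered_diff[OF T, symmetric]) (intro conv_schwartz r rap h)+
      also have "(\<lambda>x. conv r (cut (A n) h) x - conv r h x) = conv r (\<lambda>x. cut (A n) h x - h x)"
        using conv_lincomb_right[OF r rap h, of 1 n "-1"] by simp
      finally show ?thesis
        unfolding real_norm_def
        by (simp only: order_trans[OF C(2)[OF conv_schwartz[OF r rd]] mult_left_mono[OF psum_conv[OF r rd] C(1)]])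
    qed
    then have "(\<lambda>n. T (conv r (cut (A n) h)) - T (conv r h)) \<longlonglongrightarrow> 0"
      by (intro Lim_null_comparison[OF _ z]) simp
    then show ?thesis by (simp add: LIM_zero_iff)
  qed
  ultimately show ?thesis using LIMSEQ_unique by auto
qed

end

section \<open>Mollification\<close>

text \<open>Lets even powers, for which moment bounds are available, control all lower powers
  including the odd ones.\<close>

lemma abs_power_le:
  fixes u :: real
  assumes "k \<le> 2 * n"
  shows "\<bar>u\<bar> ^ k \<le> 1 + u ^ (2 * n)"
proof (cases "\<bar>u\<bar> \<le> 1")
  case True
  then have "\<bar>u\<bar> ^ k \<le> 1" by (intro power_le_one) auto
  moreover have "0 \<le> u ^ (2 * n)" by (simp only: power_mult zero_le_power zero_le_power2)
  ultimately show ?thesis by linarith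
next
  case False
  then have "\<bar>u\<bar> ^ k \<le> \<bar>u\<bar> ^ (2 * n)" using assms by (intro power_increasing) auto
  also have "\<dots> = u ^ (2 * n)" by (simp only: power_mult power2_abs)
  finally show ?thesis by simp
qed

lemma power_mult_gauss_bounded:
  fixes a s :: real
  assumes a: "0 < a"
  shows "\<bar>s\<bar> ^ i * exp (- a * s\<^sup>2) \<le> 1 + fact i / a ^ i"
proof -
  have "\<bar>s\<bar> ^ i \<le> 1 + (s\<^sup>2) ^ i"
    using abs_power_le[of i i s] by (simp add: power_mult)
  then have "\<bar>s\<bar> ^ i * exp (- a * s\<^sup>2) \<le> (1 + (s\<^sup>2) ^ i) * exp (- a * s\<^sup>2)"
    by (intro mult_right_mono) auto
  also have "\<dots> = exp (- a * s\<^sup>2) + (s\<^sup>2) ^ i * exp (- a * s\<^sup>2)" by (simp add: distrib_right)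
  also have "\<dots> \<le> 1 + fact i / a ^ i"
  proof -
    \<comment> \<open>Only the term of index \<open>i\<close> of the exponential series is
      kept.\<close>
    have "(a * s\<^sup>2) ^ i / fact i \<le> exp (a * s\<^sup>2)"
      using sums_le[OF _ sums_finite[of "{i}" "\<lambda>n. if n = i then (a * s\<^sup>2) ^ n /\<^sub>R fact n else 0"] exp_converges[of "a * s\<^sup>2"]] a
      by (auto simp: divide_inverse mult.commute)
    then have "(s\<^sup>2) ^ i \<le> fact i / a ^ i * exp (a * s\<^sup>2)"
      using a by (simp add: power_mult_distrib field_simps)
    then have "(s\<^sup>2) ^ i * exp (- a * s\<^sup>2) \<le> fact i / a ^ i * exp (a * s\<^sup>2) * exp (- a * s\<^sup>2)"
      by (intro mult_right_mono) auto
    also have "\<dots> = fact i / a ^ i" by (simp add: exp_minus)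
    finally show ?thesis using a by (intro add_mono) simp_all
  qed
  finally show ?thesis .
qed

lemma poly_mult_gauss_bounded:
  fixes a :: real
  assumes a: "0 < a"
  shows "\<exists>B. \<forall>s. \<bar>poly p s\<bar> * exp (- a * s\<^sup>2) \<le> B"
proof (intro exI allI)
  fix s
  have "\<bar>poly p s\<bar> * exp (- a * s\<^sup>2) \<le> (\<Sum>i\<le>degree p. \<bar>coeff p i\<bar> * \<bar>s\<bar> ^ i) * exp (- a * s\<^sup>2)"
    unfolding poly_altdef
    by (intro mult_right_mono order_trans[OF sum_abs]) (auto simp: abs_mult power_abs)
  also have "\<dots> = (\<Sum>i\<le>degree p. \<bar>coeff p i\<bar> * (\<bar>s\<bar> ^ i * exp (- a * s\<^sup>2)))"
    by (simp add: sum_distrib_right mult.assoc)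
  also have "\<dots> \<le> (\<Sum>i\<le>degree p. \<bar>coeff p i\<bar> * (1 + fact i / a ^ i))"
    by (intro sum_mono mult_left_mono power_mult_gauss_bounded a) auto
  finally show "\<bar>poly p s\<bar> * exp (- a * s\<^sup>2) \<le> (\<Sum>i\<le>degree p. \<bar>coeff p i\<bar> * (1 + fact i / a ^ i))" .
qed

text \<open>Hermite polynomials up to sign and scaling: the polynomial factor in the k-th derivative
  of \<open>exp (- a * s^2)\<close>.\<close>

primrec gauss_poly :: "real \<Rightarrow> nat \<Rightarrow> real poly" where
  "gauss_poly a 0 = 1"
| "gauss_poly a (Suc k) = pderiv (gauss_poly a k) - [:0, 2 * a:] * gauss_poly a k"

lemma gauss_poly_deriv:
  "((\<lambda>s. c * (poly (gauss_poly a k) s * exp (- a * s\<^sup>2))) has_real_derivative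
    c * (poly (gauss_poly a (Suc k)) s * exp (- a * s\<^sup>2))) (at s)"
  by (auto intro!: derivative_eq_intros simp: algebra_simps)

context spacing begin

text \<open>Smooths in time and is concentrated at the origin of the lattice, whose directions are
  discrete. Dividing by the mass \<open>\<delta> ^ CARD('d)\<close> of a site gives total mass
  one.\<close>

definition moll :: "nat \<Rightarrow> 'd::finite fn" where
  "moll n = (\<lambda>(s, y). if y = 0 then normal_density 0 (1 / Suc n) s / \<delta> ^ CARD('d) else 0)"

lemma moll_nonneg: "0 \<le> moll n x"
  using pos by (simp add: moll_def split: prod.split)

lemma moll_schwartz: "moll n \<in> schwartz \<delta>"
proof -
  define a :: real where "a = (real (Suc n))\<^sup>2 / 2"
  define c where "c = 1 / sqrt (2 * pi * (1 / Suc n)\<^sup>2) / \<delta> ^ CARD('a)"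
  have a: "0 < a" by (simp add: a_def)
  let ?F = "\<lambda>k (x :: 'a point). if snd x = 0 then c * (poly (gauss_poly a k) (fst x) * exp (- a * (fst x)\<^sup>2)) else 0"
  show ?thesis
  proof (rule schwartzI1[where F = ?F])
    show "?F 0 = moll n"
      by (auto simp: moll_def fun_eq_iff normal_density_def c_def a_def power_divide)
    show "?F k x = 0" if "x \<notin> Gam \<delta>" for k x
      using that by (auto simp: Gam_iff)
    show "((\<lambda>s. ?F k (s, y)) has_real_derivative ?F (Suc k) (t, y)) (at t)" for k y t
      using gauss_poly_deriv[of c a k t] by (cases "y = 0") simp_all
    fix N k
    \<comment> \<open>On the time axis through the origin the weight is itself a polynomial, the
      N-th power of \<open>[:1, 0, 1:]\<close>, and is absorbed into the Hermite factor.\<close>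
    obtain B where B: "\<And>s. \<bar>poly ([:1, 0, 1:] ^ N * gauss_poly a k) s\<bar> * exp (- a * s\<^sup>2) \<le> B"
      using poly_mult_gauss_bounded[OF a] by blast
    have B0: "0 \<le> B" using B[of 0] by (rule order_trans[rotated]) simp
    show "\<exists>B. \<forall>x\<in>Gam \<delta>. wt N x * \<bar>?F k x\<bar> \<le> B"
    proof (intro exI ballI)
      fix x :: "'a point"
      show "wt N x * \<bar>?F k x\<bar> \<le> \<bar>c\<bar> * B"
      proof (cases "snd x = 0")
        case True
        then have "x = (fst x, 0)" by (metis prod.collapse)
        then have "norm x = \<bar>fst x\<bar>" by (metis norm_Pair norm_zero power_zero_numeral add.right_neutral real_norm_def real_sqrt_abs power2_abs)
        then have "wt N x = (1 + (fst x)\<^sup>2) ^ N" by (simp add: wt_def)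
        moreover have "(1 + (fst x)\<^sup>2) ^ N = \<bar>poly ([:1, 0, 1:] ^ N) (fst x)\<bar>"
          by (simp add: power2_eq_square)
        moreover have "?F k x = c * (poly (gauss_poly a k) (fst x) * exp (- a * (fst x)\<^sup>2))"
          using True by simp
        ultimately have "wt N x * \<bar>?F k x\<bar> = \<bar>c\<bar> * (\<bar>poly ([:1, 0, 1:] ^ N * gauss_poly a k) (fst x)\<bar> * exp (- a * (fst x)\<^sup>2))"
          by (simp only: poly_mult abs_mult abs_exp_cancel mult_ac)
        also have "\<dots> \<le> \<bar>c\<bar> * B" by (intro mult_left_mono B) simp
        finally show ?thesis .
      qed (simp add: B0)
    qed
  qed
qed

lemmas moll_measurable = schwartz_measurable[OF moll_schwartz]

lemma moll_off: "snd x \<noteq> 0 \<Longrightarrow> moll n x = 0"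
  by (cases x) (simp add: moll_def)

lemma normal_density_scale:
  "normal_density 0 (1 / Suc n) (v / Suc n) = Suc n * normal_density 0 1 v"
proof -
  have "sqrt (2 * pi * (1 / real (Suc n))\<^sup>2) = sqrt (2 * pi) / Suc n"
    by (simp add: real_sqrt_mult real_sqrt_divide power_divide)
  then show ?thesis by (simp add: normal_density_def power_divide)
qed

text \<open>Rescaling time moves the dependence on \<open>n\<close> from the density into the
  argument of \<open>F\<close>, so limits can be taken against one fixed Gaussian.\<close>

lemma
  fixes F :: "'d::finite fn"
  assumes F: "F \<in> borel_measurable \<mu>"
  shows integral_moll: "(LINT x|\<mu>. F x * moll n x) = (LINT v|lborel. F (v / Suc n, 0) * normal_density 0 1 v)"
    and integrable_moll: "integrable \<mu> (\<lambda>x. F x * moll n x) \<longleftrightarrow> integrable lborel (\<lambda>v. F (v / Suc n, 0) * normal_density 0 1 v)"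
proof -
  have m: "(\<lambda>x. F x * moll n x) \<in> borel_measurable \<mu>"
    by (intro borel_measurable_times F moll_measurable)
  have z: "x \<in> Gam \<delta> \<Longrightarrow> snd x \<noteq> 0 \<Longrightarrow> F x * moll n x = 0" for x by (simp add: moll_off)
  have d: "\<delta> ^ CARD('d) \<noteq> 0" using pos by simp
  have e: "F (u, 0) * moll n (u, 0 :: real^'d) = F (u, 0) * normal_density 0 (1 / Suc n) u / \<delta> ^ CARD('d)" for u
    by (simp add: moll_def)
  have "(LINT x|\<mu>. F x * moll n x) = \<delta> ^ CARD('d) * (LINT u|lborel. F (u, 0) * moll n (u, 0 :: real^'d))"
    by (rule integral_site[OF m lattice_0 z])
  also have "\<dots> = (LINT u|lborel. F (u, 0) * normal_density 0 (1 / Suc n) u)"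
    using d unfolding e by simp
  also have "\<dots> = (1 / Suc n) *\<^sub>R (LINT v|lborel. F (v / Suc n, 0) * normal_density 0 (1 / Suc n) (v / Suc n))"
    by (subst lborel_integral_real_affine[where c = "1 / Suc n" and t = 0]) auto
  also have "\<dots> = (LINT v|lborel. F (v / Suc n, 0) * normal_density 0 1 v)"
    unfolding normal_density_scale by (simp add: mult.left_commute)
  finally show "(LINT x|\<mu>. F x * moll n x) = (LINT v|lborel. F (v / Suc n, 0) * normal_density 0 1 v)" .
  have "integrable \<mu> (\<lambda>x. F x * moll n x) \<longleftrightarrow> integrable lborel (\<lambda>u. F (u, 0) * moll n (u, 0 :: real^'d))"
    by (rule integrable_site[OF m lattice_0 z])
  also have "\<dots> \<longleftrightarrow> integrable lborel (\<lambda>u. F (u, 0) * normal_density 0 (1 / Suc n) u)"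
    using d unfolding e by (simp add: divide_inverse)
  also have "\<dots> \<longleftrightarrow> integrable lborel (\<lambda>v. F (v / Suc n, 0) * normal_density 0 (1 / Suc n) (v / Suc n))"
    using lborel_integrable_real_affine_iff[of "1 / Suc n" "\<lambda>u. F (u, 0) * normal_density 0 (1 / Suc n) u" 0] by simp
  also have "\<dots> \<longleftrightarrow> integrable lborel (\<lambda>v. F (v / Suc n, 0) * normal_density 0 1 v)"
    unfolding normal_density_scale by (simp add: mult.left_commute)
  finally show "integrable \<mu> (\<lambda>x. F x * moll n x) \<longleftrightarrow> integrable lborel (\<lambda>v. F (v / Suc n, 0) * normal_density 0 1 v)" .
qed

lemma integral_moll_1: "(LINT x|\<mu>. moll n x) = 1"
  using integral_moll[of "\<lambda>_. 1" n] by simp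

lemma integrable_moll_1: "integrable \<mu> (moll n)"
  by (rule rapid_integrable_0[OF schwartz_rapid[OF moll_schwartz]])

lemma conv_moll_eq:
  "H \<in> borel_measurable \<mu> \<Longrightarrow> z \<in> Gam \<delta> \<Longrightarrow> conv (moll n) H z = (LINT x|\<mu>. H (z - x) * moll n x)"
  by (subst conv_commute) (simp_all add: conv_def moll_measurable)

text \<open>Averaging with a probability density cannot raise the supremum. The sup norms of the
  mollified kernels thus stay bounded in \<open>n\<close>, although the seminorms of
  \<open>moll n\<close> do not.\<close>

lemma conv_moll_abs_le:
  fixes H :: "'d::finite fn"
  assumes H: "H \<in> borel_measurable \<mu>" and K: "\<And>x. \<bar>H x\<bar> \<le> K"
  shows "\<bar>conv (moll n) H z\<bar> \<le> K"
proof (cases "z \<in> Gam \<delta>")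
  case True
  have "\<bar>LINT x|\<mu>. H (z - x) * moll n x\<bar> \<le> (LINT x|(\<mu> :: 'd point measure). K * moll n x)"
  proof (rule integral_abs_bound_integral)
    show "integrable \<mu> (\<lambda>x. H (z - x) * moll n x)"
      by (rule conv_integrable[OF H K integrable_moll_1 True])
    show "integrable \<mu> (\<lambda>x :: 'd point. K * moll n x)" by (simp add: integrable_moll_1)
    show "\<bar>H (z - x) * moll n x\<bar> \<le> K * moll n x" for x
      using mult_right_mono[OF K moll_nonneg, of "z - x" n x] by (simp add: abs_mult moll_nonneg)
  qed
  then show ?thesis
    by (simp add: conv_moll_eq[OF H True] integral_moll_1)
next
  case False
  have "0 \<le> K" using K[of 0] by linarith
  with False show ?thesis by (simp add: conv_def)
qed

lemma conv_moll_tendsto_pointwise: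
  assumes H: "H \<in> borel_measurable \<mu>" and K: "\<And>x. \<bar>H x\<bar> \<le> K" and y: "y \<in> lattice \<delta>"
    and c: "isCont (\<lambda>t. H (t, y)) s"
  shows "(\<lambda>n. conv (moll n) H (s, y)) \<longlonglongrightarrow> H (s, y)"
proof -
  have z: "(s, y) \<in> Gam \<delta>" using y by (simp add: Gam_iff)
  have [measurable]: "(\<lambda>t. H (t, y)) \<in> borel_measurable borel" by (rule measurable_\<mu>_D[OF H y])
  have "(\<lambda>n. LINT v|lborel. H (s - v / Suc n, y) * normal_density 0 1 v) \<longlonglongrightarrow> (LINT v|lborel. H (s, y) * normal_density 0 1 v)"
  proof (rule integral_dominated_convergence)
    show "integrable lborel (\<lambda>v. K * normal_density 0 1 v)" by simp
    show "AE v in lborel. (\<lambda>n. H (s - v / Suc n, y) * normal_density 0 1 v) \<longlonglongrightarrow> H (s, y) * normal_density 0 1 v"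
    proof (intro AE_I2 tendsto_mult_right)
      fix v :: real
      have "(\<lambda>n. s - v / Suc n) \<longlonglongrightarrow> s" by real_asymp
      from isCont_tendsto_compose[OF c this] show "(\<lambda>n. H (s - v / Suc n, y)) \<longlonglongrightarrow> H (s, y)" .
    qed
    show "AE v in lborel. norm (H (s - v / Suc n, y) * normal_density 0 1 v) \<le> K * normal_density 0 1 v" for n
      using K by (intro AE_I2) (simp add: abs_mult mult_right_mono)
  qed measurable
  moreover have "conv (moll n) H (s, y) = (LINT v|lborel. H (s - v / Suc n, y) * normal_density 0 1 v)" for n
  proof -
    have "conv (moll n) H (s, y) = (LINT x|\<mu>. H ((s, y) - x) * moll n x)"
      by (simp add: conv_moll_eq[OF H z])
    also have "\<dots> = (LINT v|lborel. H ((s, y) - (v / Suc n, 0)) * normal_density 0 1 v)"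
      by (rule integral_moll[OF measurable_reflect[OF H z]])
    finally show ?thesis by simp
  qed
  ultimately show ?thesis by simp
qed

text \<open>The lattice coordinate is handled by freezing its two entries one after the other, each
  ranging over a countable set.\<close>

lemma diff_measurable:
  "(\<lambda>(z, x). z - x) \<in> (\<mu> \<Otimes>\<^sub>M \<mu> :: ('d::finite point \<times> 'd point) measure) \<rightarrow>\<^sub>M \<mu>"
proof -
  have s: "(\<lambda>p. snd (fst p) - snd (snd p)) \<in> (\<mu> \<Otimes>\<^sub>M \<mu> :: ('d::finite point \<times> 'd point) measure) \<rightarrow>\<^sub>M count_space (lattice \<delta>)"
  proof (rule measurable_compose_countable'[where I = "lattice \<delta>" and f = "\<lambda>a p. a - snd (snd p)" and g = "\<lambda>p. snd (fst p)"])
    fix a :: "real^'d" assume a: "a \<in> lattice \<delta>"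
    show "(\<lambda>p. a - snd (snd p)) \<in> (\<mu> \<Otimes>\<^sub>M \<mu> :: ('d::finite point \<times> 'd point) measure) \<rightarrow>\<^sub>M count_space (lattice \<delta>)"
      by (rule measurable_compose_countable'[where I = "lattice \<delta>" and f = "\<lambda>b p. a - b" and g = "\<lambda>p. snd (snd p)"])
        (use a in \<open>auto intro!: measurable_const measurable_compose[OF measurable_snd snd_measurable_count]\<close>)
  qed (auto intro!: measurable_compose[OF measurable_fst snd_measurable_count])
  have f: "(\<lambda>p. fst (fst p) - fst (snd p)) \<in> (\<mu> \<Otimes>\<^sub>M \<mu> :: ('d::finite point \<times> 'd point) measure) \<rightarrow>\<^sub>M lborel"
    using measurable_compose[OF measurable_fst fst_measurable] measurable_compose[OF measurable_snd fst_measurable]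
    by simp
  show ?thesis
    using measurable_Pair[OF f s] unfolding measurable_cong_sets[OF refl sets_\<mu>]
    by (simp add: minus_prod_def case_prod_beta)
qed

text \<open>Young's inequality in L1 for a mollifier of mass one: Tonelli's theorem and translation
  invariance of the measure.\<close>

lemma nn_integral_conv_moll_le:
  fixes H :: "'d::finite fn"
  assumes H: "H \<in> borel_measurable \<mu>" and K: "\<And>x. \<bar>H x\<bar> \<le> K"
  shows "(\<integral>\<^sup>+z. ennreal \<bar>conv (moll n) H z\<bar> \<partial>\<mu>) \<le> (\<integral>\<^sup>+z. ennreal \<bar>H z\<bar> \<partial>\<mu>)"
proof -
  interpret sigma_finite_measure "\<mu> :: 'd point measure" by (rule sigma_finite_\<mu>)
  interpret pair_sigma_finite "\<mu> :: 'd point measure" "\<mu> :: 'd point measure" ..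
  note [measurable] = H moll_measurable
  have [measurable]: "(\<lambda>(z, x). H (z - x)) \<in> borel_measurable (\<mu> \<Otimes>\<^sub>M \<mu>)"
    using measurable_compose[OF diff_measurable H] by (simp add: case_prod_beta)
  have "(\<integral>\<^sup>+z. ennreal \<bar>conv (moll n) H z\<bar> \<partial>\<mu>) \<le> (\<integral>\<^sup>+z. (\<integral>\<^sup>+x. ennreal (\<bar>H (z - x)\<bar> * moll n x) \<partial>\<mu>) \<partial>\<mu>)"
  proof (rule nn_integral_mono)
    fix z :: "'d point" assume "z \<in> space \<mu>"
    then have z: "z \<in> Gam \<delta>" by simp
    have i: "integrable \<mu> (\<lambda>x. H (z - x) * moll n x)"
      by (rule conv_integrable[OF H K integrable_moll_1 z])
    have "ennreal \<bar>conv (moll n) H z\<bar> = ennreal (norm (LINT x|\<mu>. H (z - x) * moll n x))"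
      by (simp add: conv_moll_eq[OF H z])
    also have "\<dots> \<le> (\<integral>\<^sup>+x. ennreal (norm (H (z - x) * moll n x)) \<partial>\<mu>)"
      by (rule integral_norm_bound_ennreal[OF i])
    finally show "ennreal \<bar>conv (moll n) H z\<bar> \<le> (\<integral>\<^sup>+x. ennreal (\<bar>H (z - x)\<bar> * moll n x) \<partial>\<mu>)"
      by (simp add: abs_mult moll_nonneg)
  qed
  also have "\<dots> = (\<integral>\<^sup>+x. (\<integral>\<^sup>+z. ennreal (\<bar>H (z - x)\<bar> * moll n x) \<partial>\<mu>) \<partial>\<mu>)"
    by (rule Fubini') measurable
  also have "\<dots> = (\<integral>\<^sup>+x. (\<integral>\<^sup>+z. ennreal \<bar>H z\<bar> \<partial>\<mu>) * ennreal (moll n x) \<partial>(\<mu> :: 'd point measure))"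
  proof (rule nn_integral_cong)
    fix x :: "'d point" assume "x \<in> space \<mu>"
    then have x: "- x \<in> Gam \<delta>" by auto
    have m: "(\<lambda>z. H (- x + z)) \<in> borel_measurable \<mu>" by (rule measurable_shift[OF H x])
    have "(\<integral>\<^sup>+z. ennreal (\<bar>H (z - x)\<bar> * moll n x) \<partial>\<mu>) = (\<integral>\<^sup>+z. ennreal \<bar>H (- x + z)\<bar> * ennreal (moll n x) \<partial>\<mu>)"
      by (intro nn_integral_cong) (simp add: ennreal_mult' moll_nonneg)
    also have "\<dots> = (\<integral>\<^sup>+z. ennreal \<bar>H (- x + z)\<bar> \<partial>\<mu>) * ennreal (moll n x)"
      by (rule nn_integral_multc) (use m in measurable)
    also have "(\<integral>\<^sup>+z. ennreal \<bar>H (- x + z)\<bar> \<partial>\<mu>) = (\<integral>\<^sup>+z. ennreal \<bar>H z\<bar> \<partial>\<mu>)"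
      by (rule nn_integral_shift[of "\<lambda>z. ennreal \<bar>H z\<bar>", OF _ x]) measurable
    finally show "(\<integral>\<^sup>+z. ennreal (\<bar>H (z - x)\<bar> * moll n x) \<partial>\<mu>) = (\<integral>\<^sup>+z. ennreal \<bar>H z\<bar> \<partial>\<mu>) * ennreal (moll n x)" .
  qed
  also have "\<dots> = (\<integral>\<^sup>+z. ennreal \<bar>H z\<bar> \<partial>\<mu>) * (\<integral>\<^sup>+x. ennreal (moll n x) \<partial>(\<mu> :: 'd point measure))"
    by (rule nn_integral_cmult) measurable
  also have "(\<integral>\<^sup>+x. ennreal (moll n x) \<partial>(\<mu> :: 'd point measure)) = 1"
    by (subst nn_integral_eq_integral[OF integrable_moll_1]) (simp_all add: moll_nonneg integral_moll_1)
  finally show ?thesis by simp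
qed

text \<open>Scheffe's lemma: pointwise convergence almost everywhere together with norms that do not
  exceed that of the limit. A jump at time 0 is harmless, since the time-zero slice of the cylinder
  is a null set.\<close>

lemma conv_moll_L1:
  fixes H :: "'d::finite fn"
  assumes H: "rapid H" and K: "\<And>x. \<bar>H x\<bar> \<le> K"
    and c: "\<And>s y. y \<in> lattice \<delta> \<Longrightarrow> s \<noteq> 0 \<Longrightarrow> isCont (\<lambda>t. H (t, y)) s"
  shows "(\<lambda>n. \<integral>\<^sup>+z. ennreal \<bar>conv (moll n) H z - H z\<bar> \<partial>\<mu>) \<longlonglongrightarrow> 0"
proof -
  have i: "integrable \<mu> (conv (moll n) H)" for n
    by (intro rapid_integrable_0 schwartz_rapid conv_schwartz moll_schwartz H)
  have "AE z in \<mu>. (\<lambda>n. conv (moll n) H z) \<longlonglongrightarrow> H z"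
  proof (rule AE_I)
    show "{z \<in> space \<mu>. \<not> (\<lambda>n. conv (moll n) H z) \<longlonglongrightarrow> H z} \<subseteq> {0} \<times> lattice \<delta>"
      using conv_moll_tendsto_pointwise[OF rapid_measurable[OF H] K _ c] by (auto simp: Gam_def)
    show s: "{0} \<times> lattice \<delta> \<in> sets (\<mu> :: 'd point measure)"
      unfolding sets_\<mu> by (intro pair_measureI) auto
    have "emeasure \<mu> ({0} \<times> lattice \<delta> :: 'd point set) = (\<integral>\<^sup>+z. indicator ({0} \<times> lattice \<delta> :: 'd point set) z \<partial>\<mu>)"
      using s by simp
    also have "\<dots> = ennreal (\<delta> ^ CARD('d)) * (\<integral>\<^sup>+y. (\<integral>\<^sup>+t. indicator ({0} \<times> lattice \<delta> :: 'd point set) (t, y) \<partial>lborel) \<partial>count_space (lattice \<delta> :: (real^'d) set))"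
      by (rule nn_integral_\<mu>) (use s in measurable)
    also have "(\<integral>\<^sup>+y. (\<integral>\<^sup>+t. indicator ({0} \<times> lattice \<delta> :: 'd point set) (t, y) \<partial>lborel) \<partial>count_space (lattice \<delta> :: (real^'d) set)) =
       (\<integral>\<^sup>+y. (\<integral>\<^sup>+t. indicator {0::real} t \<partial>lborel) \<partial>count_space (lattice \<delta> :: (real^'d) set))"
      by (intro nn_integral_cong) (auto simp: indicator_def)
    finally show "emeasure \<mu> ({0} \<times> lattice \<delta> :: 'd point set) = 0" by simp
  qed
  moreover have "limsup (\<lambda>n. \<integral>\<^sup>+z. ennreal (norm (conv (moll n) H z)) \<partial>\<mu>) \<le> (\<integral>\<^sup>+z. ennreal (norm (H z)) \<partial>\<mu>)"
    using nn_integral_conv_moll_le[OF rapid_measurable[OF H] K]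
    by (intro Limsup_bounded) simp_all
  ultimately have "(\<lambda>n. \<integral>\<^sup>+z. ennreal (norm (conv (moll n) H z - H z)) \<partial>\<mu>) \<longlonglongrightarrow> 0"
    by (intro Scheffe_lemma1 i rapid_integrable_0[OF H])
  then show ?thesis by simp
qed

text \<open>The error is of order 1/n: moving the argument of \<open>\<phi>\<close> by a time
  \<open>u\<close> costs one time derivative and a factor \<open>\<bar>u\<bar>\<close>, and the
  rescaled Gaussian has weighted first absolute moment at most \<open>m N / Suc n\<close>.\<close>

lemma tempered_conv_moll_tendsto:
  fixes \<phi> :: "'d::finite fn"
  assumes T: "tempered T" and \<phi>: "\<phi> \<in> schwartz \<delta>"
  shows "(\<lambda>n. T (conv (moll n) \<phi>)) \<longlonglongrightarrow> T \<phi>"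
proof -
  obtain K C where C: "0 \<le> C" "\<And>g. g \<in> schwartz \<delta> \<Longrightarrow> \<bar>T g\<bar> \<le> C * psum K g"
    using T unfolding tempered_def by blast
  define m where "m N = (LINT v|lborel. wt N v * \<bar>v\<bar> * normal_density 0 1 v)" for N
  define L where "L = (\<Sum>N\<le>K. \<Sum>k\<le>K. 2 ^ N * schwartz_seminorm \<delta> N (Suc k) \<phi> * m N)"
  let ?w = "\<lambda>N (x :: 'd point). wt N x * \<bar>fst x\<bar>"
  have wm: "?w N \<in> borel_measurable \<mu>" for N
    by (intro borel_measurable_times wt_measurable_\<mu> borel_measurable_abs fst_measurable)
  have wt0: "wt N (v, 0 :: real^'d) = wt N v" for N and v :: real by (simp add: wt_def norm_Pair)
  have wi: "integrable \<mu> (\<lambda>x. ?w N x * moll n x)" for N n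
  proof (rule Bochner_Integration.integrable_bound)
    show "integrable \<mu> (\<lambda>x. wt (N + 1) x * moll n x)"
      by (rule rapid_integrable[OF schwartz_rapid[OF moll_schwartz]])
    show "(\<lambda>x. ?w N x * moll n x) \<in> borel_measurable \<mu>" by (intro borel_measurable_times wm moll_measurable)
    have "\<bar>fst x\<bar> \<le> wt 1 x" for x :: "'d point"
      using norm_fst_le[of "fst x" "snd x"] norm_le_wt[of x] by simp
    then show "AE x in \<mu>. norm (?w N x * moll n x) \<le> norm (wt (N + 1) x * moll n x)"
      unfolding wt_add by (intro AE_I2) (simp add: abs_mult mult_left_mono mult_right_mono)
  qed
  have mi: "integrable lborel (\<lambda>v. wt N v * \<bar>v\<bar> * normal_density 0 1 v)" for N
    using wi[of N 0] unfolding integrable_moll[OF wm] by (simp add: wt0)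
  have wle: "(LINT x|\<mu>. ?w N x * moll n x) \<le> m N / Suc n" for N n
  proof -
    have i: "integrable lborel (\<lambda>v. ?w N (v / Suc n, 0 :: real^'d) * normal_density 0 1 v)"
      using wi[of N n] unfolding integrable_moll[OF wm] .
    have "(LINT x|\<mu>. ?w N x * moll n x) = (LINT v|lborel. ?w N (v / Suc n, 0 :: real^'d) * normal_density 0 1 v)"
      by (rule integral_moll[OF wm])
    also have "\<dots> \<le> (LINT v|lborel. (wt N v * \<bar>v\<bar> * normal_density 0 1 v) / Suc n)"
    proof (rule integral_mono[OF i])
      show "integrable lborel (\<lambda>v. (wt N v * \<bar>v\<bar> * normal_density 0 1 v) / Suc n)" using mi by simp
      fix v :: real
      have "\<bar>v\<bar> * 1 \<le> \<bar>v\<bar> * real (Suc n)" by (intro mult_left_mono) auto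
      then have "wt N (v / Suc n) \<le> wt N v" by (intro wt_mono_norm) (simp add: field_simps)
      then have "wt N (v / Suc n) * (\<bar>v\<bar> / Suc n) * normal_density 0 1 v \<le> wt N v * (\<bar>v\<bar> / Suc n) * normal_density 0 1 v"
        by (intro mult_right_mono) auto
      then show "?w N (v / Suc n, 0 :: real^'d) * normal_density 0 1 v \<le> (wt N v * \<bar>v\<bar> * normal_density 0 1 v) / Suc n"
        by (simp add: wt0 abs_divide)
    qed
    also have "\<dots> = m N / Suc n" by (simp add: m_def)
    finally show ?thesis .
  qed
  have bound: "\<bar>T (conv (moll n) \<phi>) - T \<phi>\<bar> \<le> C * (L / Suc n)" for n
  proof -
    note mr = schwartz_rapid[OF moll_schwartz, of n]
    \<comment> \<open>With the factors exchanged, the derivatives fall on the fixed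
      \<open>\<phi>\<close>; those of the mollifier would blow up with \<open>n\<close>.\<close>
    have cs: "conv (moll n) \<phi> = conv \<phi> (moll n)"
      by (rule conv_commute[OF schwartz_measurable[OF \<phi>] moll_measurable])
    let ?u = "\<lambda>x. conv \<phi> (moll n) x - \<phi> x"
    note us = diff_schwartz[OF conv_schwartz[OF \<phi> mr] \<phi>]
    have "psum K ?u \<le> L / Suc n"
      unfolding psum_def L_def sum_divide_distrib
    proof (intro sum_mono seminorm_le)
      fix N k and z :: "'d point" assume z: "z \<in> Gam \<delta>"
      let ?q = "schwartz_seminorm \<delta> N (Suc k) \<phi>"
      have i1: "integrable \<mu> (\<lambda>x. time_deriv k \<phi> (z - x) * moll n x)"
        by (rule conv_schwartz_integrable[OF time_deriv_schwartz[OF \<phi>] integrable_moll_1 z])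
      have i2: "integrable \<mu> (\<lambda>x :: 'd point. time_deriv k \<phi> z * moll n x)" by (simp add: integrable_moll_1)
      have "time_deriv k ?u z = (LINT x|\<mu>. time_deriv k \<phi> (z - x) * moll n x) - (LINT x|(\<mu> :: 'd point measure). time_deriv k \<phi> z * moll n x)"
        unfolding time_deriv_diff[OF conv_schwartz[OF \<phi> mr] \<phi>] time_deriv_conv[OF \<phi> mr]
        using z by (simp add: conv_def integral_moll_1)
      also have "\<dots> = (LINT x|\<mu>. (time_deriv k \<phi> (z - x) - time_deriv k \<phi> z) * moll n x)"
        using i1 i2 by (simp add: left_diff_distrib)
      finally have "wt N z * \<bar>time_deriv k ?u z\<bar> = \<bar>LINT x|\<mu>. wt N z * ((time_deriv k \<phi> (z - x) - time_deriv k \<phi> z) * moll n x)\<bar>"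
        by (simp add: abs_mult)
      also have "\<dots> \<le> (LINT x|\<mu>. 2 ^ N * ?q * (?w N x * moll n x))"
      proof (rule integral_abs_bound_integral)
        show "integrable \<mu> (\<lambda>x. wt N z * ((time_deriv k \<phi> (z - x) - time_deriv k \<phi> z) * moll n x))"
          using i1 i2 by (simp add: left_diff_distrib)
        show "integrable \<mu> (\<lambda>x. 2 ^ N * ?q * (?w N x * moll n x))" using wi by simp
        fix x :: "'d point"
        show "\<bar>wt N z * ((time_deriv k \<phi> (z - x) - time_deriv k \<phi> z) * moll n x)\<bar> \<le> 2 ^ N * ?q * (?w N x * moll n x)"
        proof (cases "snd x = 0")
          case True
          then obtain u where x: "x = (u, 0)" by (metis prod.collapse)
          have "wt N z * \<bar>time_deriv k \<phi> (z - (u, 0)) - time_deriv k \<phi> (z - (0, 0))\<bar> \<le> 2 ^ N * wt N (\<bar>u\<bar>, 0 :: real^'d) * ?q * \<bar>u - 0\<bar>"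
            by (rule shift_lipschitz[OF \<phi>]) auto
          also have "wt N (\<bar>u\<bar>, 0 :: real^'d) = wt N x" by (simp add: x wt_def norm_Pair)
          finally have "wt N z * \<bar>time_deriv k \<phi> (z - x) - time_deriv k \<phi> z\<bar> * moll n x \<le> 2 ^ N * wt N x * ?q * \<bar>u\<bar> * moll n x"
            by (intro mult_right_mono moll_nonneg) (simp add: x zero_prod_def[symmetric])
          then show ?thesis by (simp add: abs_mult moll_nonneg x mult_ac)
        qed (simp add: moll_off)
      qed
      also have "\<dots> \<le> 2 ^ N * ?q * (m N / Suc n)"
        unfolding integral_mult_right_zero
        by (intro mult_left_mono wle mult_nonneg_nonneg seminorm_nonneg \<phi>) simp
      finally show "wt N z * \<bar>time_deriv k ?u z\<bar> \<le> 2 ^ N * ?q * m N / Suc n" by simp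
    qed
    then have "C * psum K ?u \<le> C * (L / Suc n)" by (rule mult_left_mono[OF _ C(1)])
    with C(2)[OF us] have "\<bar>T ?u\<bar> \<le> C * (L / Suc n)" by linarith
    then show ?thesis unfolding cs tempered_diff[OF T conv_schwartz[OF \<phi> mr] \<phi>] .
  qed
  have z: "(\<lambda>n. C * (L / Suc n)) \<longlonglongrightarrow> 0" by real_asymp
  have "(\<lambda>n. T (conv (moll n) \<phi>) - T \<phi>) \<longlonglongrightarrow> 0"
    by (rule Lim_null_comparison[OF _ z]) (use bound in simp)
  then show ?thesis by (simp add: LIM_zero_iff)
qed

end

section \<open>The Green function\<close>

lemma one_plus_power_le_exp:
  assumes "0 < \<epsilon>"
  obtains A :: real where "0 \<le> A" "\<And>u. 0 \<le> u \<Longrightarrow> (1 + u\<^sup>2) ^ N \<le> A * exp (\<epsilon> * u)"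
proof -
  \<comment> \<open>Any \<open>a\<close> with \<open>2 * N * a\<close> at most
    \<open>\<epsilon>\<close> would do; the \<open>+ 1\<close> keeps the quotient meaningful for
    \<open>N = 0\<close>.\<close>
  define a where "a = \<epsilon> / (2 * real N + 1)"
  have a: "0 < a" "2 * real N * a \<le> \<epsilon>" using assms by (simp_all add: a_def field_simps)
  have "(1 + u\<^sup>2) ^ N \<le> (1 + 1 / a) ^ (2 * N) * exp (\<epsilon> * u)" if u: "0 \<le> u" for u
  proof -
    have "1 + u \<le> (1 + 1 / a) * exp (a * u)"
    proof -
      have "a * u \<le> exp (a * u)" using exp_ge_add_one_self[of "a * u"] by linarith
      then have "u \<le> 1 / a * exp (a * u)" using a by (simp add: field_simps)
      moreover have "1 \<le> exp (a * u)" using a u by simp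
      ultimately show ?thesis unfolding distrib_right by linarith
    qed
    then have "(1 + u) ^ (2 * N) \<le> ((1 + 1 / a) * exp (a * u)) ^ (2 * N)"
      using u by (intro power_mono) auto
    also have "\<dots> = (1 + 1 / a) ^ (2 * N) * exp (2 * real N * a * u)"
      by (simp add: power_mult_distrib exp_of_nat_mult[symmetric] mult_ac)
    also have "\<dots> \<le> (1 + 1 / a) ^ (2 * N) * exp (\<epsilon> * u)"
      using a u by (intro mult_left_mono) (auto intro!: mult_right_mono)
    finally have "(1 + u) ^ (2 * N) \<le> (1 + 1 / a) ^ (2 * N) * exp (\<epsilon> * u)" .
    moreover have "(1 + u\<^sup>2) ^ N \<le> ((1 + u)\<^sup>2) ^ N"
      using u by (intro power_mono) (simp_all add: power2_eq_square algebra_simps)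
    ultimately show ?thesis by (simp add: power_mult)
  qed
  then show ?thesis using a by (intro that[of "(1 + 1 / a) ^ (2 * N)"]) auto
qed

lemma nn_integral_exp_Ici:
  assumes "0 < a" shows "(\<integral>\<^sup>+t. ennreal (exp (- a * t)) * indicator {0<..} t \<partial>lborel) < \<infinity>"
proof -
  interpret prob_space "density lborel (exponential_density a)"
    by (rule prob_space_exponential_density[OF assms])
  have "(\<integral>\<^sup>+t. ennreal (exponential_density a t) \<partial>lborel) = 1"
    using emeasure_space_1 by (simp add: emeasure_density)
  moreover have "(\<integral>\<^sup>+t. ennreal (exp (- a * t)) * indicator {0<..} t \<partial>lborel) \<le>
    (\<integral>\<^sup>+t. ennreal (1 / a) * ennreal (exponential_density a t) \<partial>lborel)"
    using assms by (intro nn_integral_mono)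
      (auto simp: exponential_density_def indicator_def ennreal_mult'[symmetric] mult.commute)
  ultimately show ?thesis by (simp add: nn_integral_cmult le_less_trans[OF _ ennreal_less_top])
qed

lemma integral_cbox_prod:
  fixes f :: "real \<Rightarrow> 'n::finite \<Rightarrow> complex" and L :: real
  assumes f: "\<And>i. integrable lborel (\<lambda>u. indicator {0..L} u *\<^sub>R f u i)"
  shows "(CLINT p|lborel. indicator (cbox 0 (\<chi> i. L)) p *\<^sub>R (\<Prod>i\<in>UNIV. f (p $ i) i)) =
    (\<Prod>i\<in>UNIV. CLINT u|lborel. indicator {0..L} u *\<^sub>R f u i)"
proof -
  \<comment> \<open>Lebesgue measure on vectors is the image of a product indexed by basis vectors,
    whereas \<open>f\<close> is indexed by coordinates; \<open>?ix\<close> recovers the coordinate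
    from its basis vector.\<close>
  let ?ix = "\<lambda>b :: real^'n. THE i. b = axis i 1"
  have ix: "?ix (axis i 1) = i" for i by (rule the_equality) (auto simp: axis_eq_axis)
  have B: "(Basis :: (real^'n) set) = (\<lambda>i. axis i 1) ` UNIV" by (auto simp: Basis_vec_def)
  have inj: "inj (\<lambda>i. axis i (1::real) :: real^'n)" by (auto simp: inj_on_def axis_eq_axis)
  have reindex: "(\<Prod>b\<in>(Basis::(real^'n) set). g b) = (\<Prod>i\<in>UNIV. g (axis i 1))" for g :: "real^'n \<Rightarrow> complex"
    unfolding B by (rule prod.reindex[OF inj, unfolded o_def])
  interpret product_sigma_finite "\<lambda>_::real^'n. lborel :: real measure" ..
  have e: "indicator (cbox 0 (\<chi> i. L)) p *\<^sub>R (\<Prod>i\<in>UNIV. f (p $ i) i) =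
    (\<Prod>b\<in>Basis. indicator {0..L} (p \<bullet> b) *\<^sub>R f (p \<bullet> b) (?ix b))" for p :: "real^'n"
    unfolding reindex
    by (auto simp: ix inner_axis indicator_def mem_box_cart prod.neutral split: if_splits)
  have m: "(\<lambda>u. indicator {0..L} u *\<^sub>R f u i) \<in> borel_measurable borel" for i
    using borel_measurable_integrable[OF f[of i]] by simp
  have "(CLINT p|lborel. indicator (cbox 0 (\<chi> i. L)) p *\<^sub>R (\<Prod>i\<in>UNIV. f (p $ i) i)) =
    (CLINT p|lborel. (\<Prod>b\<in>Basis. indicator {0..L} (p \<bullet> b) *\<^sub>R f (p \<bullet> b) (?ix b)))"
    unfolding e ..
  also have "\<dots> = (CLINT g|(\<Pi>\<^sub>M b\<in>(Basis::(real^'n) set). lborel).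
     (\<Prod>b\<in>Basis. indicator {0..L} ((\<Sum>b\<in>Basis. g b *\<^sub>R b) \<bullet> b) *\<^sub>R f ((\<Sum>b\<in>Basis. g b *\<^sub>R b) \<bullet> b) (?ix b)))"
    unfolding lborel_eq[where 'a = "real^'n"]
    by (rule integral_distr) (auto intro!: borel_measurable_prod measurable_compose[OF _ m])
  also have "\<dots> = (CLINT g|(\<Pi>\<^sub>M b\<in>(Basis::(real^'n) set). lborel).
     (\<Prod>b\<in>Basis. indicator {0..L} (g b) *\<^sub>R f (g b) (?ix b)))"
    by (intro Bochner_Integration.integral_cong prod.cong refl) (simp add: inner_sum_left inner_Basis if_distrib sum.delta cong: if_cong)
  also have "\<dots> = (\<Prod>b\<in>(Basis::(real^'n) set). CLINT u|lborel. indicator {0..L} u *\<^sub>R f u (?ix b))"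
    by (rule product_integral_prod) (auto intro: f)
  finally show ?thesis unfolding reindex ix .
qed

locale green_fn = spacing +
  fixes m0 :: real
  assumes m0_pos: "0 < m0"
begin

section \<open>Lattice walks as Fourier integrals over the Brillouin zone\<close>

abbreviation bz :: "(real^'d::finite) set" where
  "bz \<equiv> cbox 0 (\<chi> i. 2 * pi / \<delta>)"

text \<open>The Fourier symbol of the operator that sums a function over the nearest neighbours of a
  site.\<close>

definition hop :: "real^'d::finite \<Rightarrow> real" where
  "hop p = (\<Sum>j\<in>UNIV. 2 * cos (\<delta> * p $ j))"

definition bzint :: "(real^'d::finite \<Rightarrow> real) \<Rightarrow> real" where
  "bzint f = (LINT p|lborel. indicator bz p * f p)"

text \<open>At a lattice point \<open>x\<close> this is the volume of \<open>bz\<close> times the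
  number of k-step nearest-neighbour walks from 0 to \<open>x\<close>. The recursion and the initial
  value that describe such counts are proved below.\<close>

definition walk :: "nat \<Rightarrow> real^'d::finite \<Rightarrow> real" where
  "walk k x = bzint (\<lambda>p. cos (p \<bullet> x) * hop p ^ k)"

abbreviation vol :: "'d::finite itself \<Rightarrow> real" where
  "vol _ \<equiv> measure lborel (bz :: (real^'d) set)"

lemma hop_measurable [measurable]: "hop \<in> borel_measurable borel"
  unfolding hop_def by (intro borel_measurable_continuous_onI continuous_intros)

lemma abs_hop_le: "\<bar>hop (p :: real^'d::finite)\<bar> \<le> 2 * real CARD('d)"
proof -
  have "\<bar>hop p\<bar> \<le> (\<Sum>j\<in>(UNIV::'d set). 2)"
    unfolding hop_def by (rule order_trans[OF sum_abs], intro sum_mono) (simp add: abs_mult abs_cos_le_one)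
  then show ?thesis by simp
qed

lemma bz_integrable: "integrable lborel (indicator (bz :: (real^'d::finite) set) :: _ \<Rightarrow> real)"
  by (intro integrable_real_indicator emeasure_bounded_finite bounded_cbox) simp

lemma
  fixes f :: "real^'d::finite \<Rightarrow> real"
  assumes f: "f \<in> borel_measurable borel" and B: "\<And>p. p \<in> bz \<Longrightarrow> \<bar>f p\<bar> \<le> B"
  shows integrable_bz: "integrable lborel (\<lambda>p. indicator bz p * f p)"
    and bzint_abs_le: "\<bar>bzint f\<bar> \<le> B * vol TYPE('d)"
proof -
  have b: "\<bar>indicator bz p * f p\<bar> \<le> B * indicator bz p" for p
    using B by (simp add: indicator_def)
  have i: "integrable lborel (\<lambda>p::real^'d. B * indicator bz p)" by (simp add: bz_integrable)
  show j: "integrable lborel (\<lambda>p. indicator bz p * f p)"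
  proof (rule Bochner_Integration.integrable_bound[OF i])
    show "(\<lambda>p. indicator bz p * f p) \<in> borel_measurable lborel" using f by simp
    show "AE p in lborel. norm (indicator bz p * f p) \<le> norm (B * indicator bz p :: real)"
      using b unfolding real_norm_def by (intro AE_I2 order_trans[OF _ abs_ge_self])
  qed
  have "\<bar>bzint f\<bar> \<le> (LINT p|lborel. B * indicator (bz :: (real^'d) set) p)"
    unfolding bzint_def by (rule integral_abs_bound_integral[OF j i b])
  then show "\<bar>bzint f\<bar> \<le> B * vol TYPE('d)" by simp
qed

lemma walk_bound: "\<bar>walk k (x :: real^'d::finite)\<bar> \<le> (2 * real CARD('d)) ^ k * vol TYPE('d)"
  unfolding walk_def
proof (rule bzint_abs_le)
  fix p :: "real^'d"
  have "\<bar>cos (p \<bullet> x)\<bar> * \<bar>hop p\<bar> ^ k \<le> 1 * (2 * real CARD('d)) ^ k"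
    by (intro mult_mono power_mono abs_hop_le) auto
  then show "\<bar>cos (p \<bullet> x) * hop p ^ k\<bar> \<le> (2 * real CARD('d)) ^ k" by (simp add: abs_mult power_abs)
qed measurable

lemma walk_integrable: "integrable lborel (\<lambda>p :: real^'d::finite. indicator bz p * (cos (p \<bullet> x) * hop p ^ k))"
proof (rule integrable_bz)
  fix p :: "real^'d"
  have "\<bar>cos (p \<bullet> x)\<bar> * \<bar>hop p\<bar> ^ k \<le> 1 * (2 * real CARD('d)) ^ k"
    by (intro mult_mono power_mono abs_hop_le) auto
  then show "\<bar>cos (p \<bullet> x) * hop p ^ k\<bar> \<le> (2 * real CARD('d)) ^ k" by (simp add: abs_mult power_abs)
qed measurable

text \<open>The product formula for cosines converts one factor of \<open>hop\<close> into a sum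
  over the neighbours of \<open>x\<close>, the possible positions one step earlier.\<close>

lemma walk_Suc:
  "walk (Suc k) (x :: real^'d::finite) = (\<Sum>j\<in>UNIV. walk k (x + axis j \<delta>) + walk k (x - axis j \<delta>))"
proof -
  have "cos (p \<bullet> x) * hop p ^ Suc k =
    (\<Sum>j\<in>UNIV. cos (p \<bullet> (x + axis j \<delta>)) * hop p ^ k + cos (p \<bullet> (x - axis j \<delta>)) * hop p ^ k)" for p :: "real^'d"
  proof -
    have "cos (p \<bullet> x) * (2 * cos (\<delta> * p $ j)) = cos (p \<bullet> (x + axis j \<delta>)) + cos (p \<bullet> (x - axis j \<delta>))" for j
      by (simp add: inner_add_right inner_diff_right inner_axis cos_add cos_diff mult.commute)
    then show ?thesis
      by (simp add: hop_def[of p] sum_distrib_left sum_distrib_right distrib_right[symmetric] mult.assoc[symmetric])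
  qed
  then have "walk (Suc k) x = (LINT p|lborel. (\<Sum>j\<in>UNIV.
     indicator bz p * (cos (p \<bullet> (x + axis j \<delta>)) * hop p ^ k) + indicator bz p * (cos (p \<bullet> (x - axis j \<delta>)) * hop p ^ k)))"
    unfolding walk_def bzint_def by (simp only: sum_distrib_left distrib_left)
  also have "\<dots> = (\<Sum>j\<in>UNIV. walk k (x + axis j \<delta>) + walk k (x - axis j \<delta>))"
    unfolding walk_def bzint_def by (subst Bochner_Integration.integral_sum) (simp_all add: walk_integrable)
  finally show ?thesis .
qed

lemma exp_integral_zero:
  fixes n :: int
  assumes n: "n \<noteq> 0"
  shows "(CLINT u|lborel. indicator {0..2 * pi / \<delta>} u *\<^sub>R exp (\<i> * of_real (u * (\<delta> * n)))) = 0"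
proof -
  let ?c = "\<i> * of_real (\<delta> * n)"
  have c: "?c \<noteq> 0" using n pos by simp
  let ?F = "\<lambda>u. exp (?c * of_real u) / ?c"
  have "(?F has_vector_derivative exp (\<i> * of_real (u * (\<delta> * n)))) (at u within {0..2 * pi / \<delta>})" for u
  proof -
    have "((\<lambda>z. exp (?c * z) / ?c) has_field_derivative exp (?c * of_real u)) (at (of_real u))"
      using c by (auto intro!: derivative_eq_intros)
    then have "(?F has_vector_derivative exp (?c * of_real u)) (at u within {0..2 * pi / \<delta>})"
      by (rule has_vector_derivative_real_field)
    moreover have "?c * of_real u = \<i> * of_real (u * (\<delta> * n))"
      by (simp only: of_real_mult mult_ac)
    ultimately show ?thesis by (simp only:)
  qed
  then have "(CLINT u|lborel. indicator {0..2 * pi / \<delta>} u *\<^sub>R exp (\<i> * of_real (u * (\<delta> * n)))) = ?F (2 * pi / \<delta>) - ?F 0"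
    using pos by (intro integral_FTC_atLeastAtMost continuous_intros) auto
  also have "exp (?c * of_real (2 * pi / \<delta>)) = exp (2 * of_int n * of_real pi * \<i>)"
    using pos by (intro arg_cong[of _ _ exp]) (simp add: mult_ac)
  also have "\<dots> = 1" using exp_integer_2pi[of "of_int n"] by simp
  finally show ?thesis by simp
qed

text \<open>Orthogonality of characters: the integral factors over the coordinates, and a nonzero
  coordinate of \<open>x\<close> contributes an integral over full periods.\<close>

lemma walk_0_eq_0:
  fixes x :: "real^'d::finite"
  assumes x: "x \<in> lattice \<delta>" "x \<noteq> 0"
  shows "walk 0 x = 0"
proof -
  obtain n where n: "\<And>i. x $ i = \<delta> * of_int (n i)"
    using x(1) unfolding lattice_def by auto metis
  obtain i where i: "n i \<noteq> 0" using x(2) n by (auto simp: vec_eq_iff)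
  let ?f = "\<lambda>u i. exp (\<i> * of_real (u * x $ i))"
  have int: "integrable lborel (\<lambda>u. indicator {0..2 * pi / \<delta>} u *\<^sub>R ?f u i)" for i
    by (rule borel_integrable_compact[OF compact_Icc]) (intro continuous_intros)
  have e: "exp (\<i> * of_real (p \<bullet> x)) = (\<Prod>i\<in>UNIV. ?f (p $ i) i)" for p
    by (simp add: inner_vec_def exp_sum[symmetric] sum_distrib_left)
  have "(CLINT p|lborel. indicator bz p *\<^sub>R exp (\<i> * of_real (p \<bullet> x))) =
    (\<Prod>i\<in>UNIV. CLINT u|lborel. indicator {0..2 * pi / \<delta>} u *\<^sub>R ?f u i)"
    unfolding e by (rule integral_cbox_prod[OF int])
  also have "\<dots> = 0"
    using exp_integral_zero[OF i] by (intro prod_zero) (auto intro!: bexI[of _ i] simp: n)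
  finally have z: "(CLINT p|lborel. indicator bz p *\<^sub>R exp (\<i> * of_real (p \<bullet> x))) = 0" .
  have ci: "complex_integrable lborel (\<lambda>p. indicator bz p *\<^sub>R exp (\<i> * of_real (p \<bullet> x)))"
    by (rule borel_integrable_compact[OF compact_cbox]) (intro continuous_intros)
  have "walk 0 x = (LINT p|lborel. Re (indicator bz p *\<^sub>R exp (\<i> * of_real (p \<bullet> x))))"
    unfolding walk_def bzint_def by (intro Bochner_Integration.integral_cong) (simp_all add: Re_exp)
  also have "\<dots> = Re (CLINT p|lborel. indicator bz p *\<^sub>R exp (\<i> * of_real (p \<bullet> x)))"
    using ci by (rule integral_Re)
  finally show ?thesis using z by simp
qed

lemma axis_lattice: "axis j \<delta> \<in> lattice \<delta>"
  unfolding lattice_def mem_Collect_eq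
proof
  fix i
  show "\<exists>n::int. axis j \<delta> $ i = \<delta> * of_int n"
    by (rule exI[of _ "if i = j then 1 else 0"]) (simp add: axis_def)
qed

lemma norm_axis_\<delta>: "norm (axis j \<delta> :: real^'d::finite) = \<delta>"
proof -
  have "axis j \<delta> = \<delta> *\<^sub>R (axis j 1 :: real^'d)" by (simp add: vec_eq_iff axis_def)
  then show ?thesis using pos by (simp only: norm_scaleR norm_axis_1 mult_1_right abs_of_pos)
qed

text \<open>A step changes the norm by at most \<open>\<delta>\<close>, so it multiplies the
  exponential weight by at most \<open>exp (\<eta> * \<delta>)\<close>, and there are twice
  \<open>CARD('d)\<close> directions to choose from. The induction starts at a function supported at
  the origin.\<close>

lemma walk_exp_sum:
  assumes \<eta>: "0 \<le> \<eta>"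
  shows "(\<integral>\<^sup>+x. ennreal (\<bar>walk k x\<bar> * exp (\<eta> * norm x)) \<partial>count_space (lattice \<delta> :: (real^'d::finite) set)) \<le>
    ennreal ((2 * real CARD('d) * exp (\<eta> * \<delta>)) ^ k * vol TYPE('d))"
proof (induction k)
  case 0
  have "(\<integral>\<^sup>+x. ennreal (\<bar>walk 0 x\<bar> * exp (\<eta> * norm x)) \<partial>count_space (lattice \<delta> :: (real^'d) set)) =
    (\<Sum>x\<in>{0}. ennreal (\<bar>walk 0 x\<bar> * exp (\<eta> * norm (x :: real^'d))))"
    by (rule nn_integral_count_space') (auto simp: walk_0_eq_0)
  also have "\<dots> \<le> ennreal (vol TYPE('d))"
    using walk_bound[of 0 "0::real^'d"] by (simp add: ennreal_leI)
  finally show ?case by simp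
next
  case (Suc k)
  let ?N = "count_space (lattice \<delta> :: (real^'d) set)"
  let ?g = "\<lambda>x :: real^'d. ennreal (\<bar>walk k x\<bar> * exp (\<eta> * norm x))"
  let ?W = "\<integral>\<^sup>+x. ?g x \<partial>?N"
  have "ennreal (\<bar>walk (Suc k) x\<bar> * exp (\<eta> * norm x)) \<le>
    (\<Sum>j\<in>UNIV. ennreal (exp (\<eta> * \<delta>)) * (?g (x + axis j \<delta>) + ?g (x - axis j \<delta>)))" for x :: "real^'d"
  proof -
    have e: "exp (\<eta> * norm x) \<le> exp (\<eta> * \<delta>) * exp (\<eta> * norm y)" if "norm x \<le> norm y + \<delta>" for y :: "real^'d"
      using mult_left_mono[OF that \<eta>] unfolding exp_add[symmetric] exp_le_cancel_iff distrib_left by linarith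
    have n: "exp (\<eta> * norm x) \<le> exp (\<eta> * \<delta>) * exp (\<eta> * norm (x + axis j \<delta>))"
      "exp (\<eta> * norm x) \<le> exp (\<eta> * \<delta>) * exp (\<eta> * norm (x - axis j \<delta>))" for j
      using norm_triangle_ineq4[of "x + axis j \<delta>" "axis j \<delta>"] norm_triangle_ineq[of "x - axis j \<delta>" "axis j \<delta>"]
      unfolding norm_axis_\<delta> by (auto intro!: e)
    have "\<bar>walk (Suc k) x\<bar> * exp (\<eta> * norm x) \<le>
      (\<Sum>j\<in>UNIV. \<bar>walk k (x + axis j \<delta>)\<bar> + \<bar>walk k (x - axis j \<delta>)\<bar>) * exp (\<eta> * norm x)"
      unfolding walk_Suc by (intro mult_right_mono order_trans[OF sum_abs] sum_mono) auto
    also have "\<dots> = (\<Sum>j\<in>UNIV. \<bar>walk k (x + axis j \<delta>)\<bar> * exp (\<eta> * norm x) + \<bar>walk k (x - axis j \<delta>)\<bar> * exp (\<eta> * norm x))"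
      by (simp only: sum_distrib_right distrib_right)
    also have "\<dots> \<le> (\<Sum>j\<in>UNIV. \<bar>walk k (x + axis j \<delta>)\<bar> * (exp (\<eta> * \<delta>) * exp (\<eta> * norm (x + axis j \<delta>))) +
      \<bar>walk k (x - axis j \<delta>)\<bar> * (exp (\<eta> * \<delta>) * exp (\<eta> * norm (x - axis j \<delta>))))"
      by (intro sum_mono add_mono mult_left_mono n) auto
    finally have "ennreal (\<bar>walk (Suc k) x\<bar> * exp (\<eta> * norm x)) \<le> ennreal (\<Sum>j\<in>UNIV. \<bar>walk k (x + axis j \<delta>)\<bar> * (exp (\<eta> * \<delta>) * exp (\<eta> * norm (x + axis j \<delta>))) +
      \<bar>walk k (x - axis j \<delta>)\<bar> * (exp (\<eta> * \<delta>) * exp (\<eta> * norm (x - axis j \<delta>))))"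
      by (rule ennreal_leI)
    also have "\<dots> = (\<Sum>j\<in>UNIV. ennreal (\<bar>walk k (x + axis j \<delta>)\<bar> * (exp (\<eta> * \<delta>) * exp (\<eta> * norm (x + axis j \<delta>))) +
      \<bar>walk k (x - axis j \<delta>)\<bar> * (exp (\<eta> * \<delta>) * exp (\<eta> * norm (x - axis j \<delta>)))))"
      by (rule sum_ennreal[symmetric]) simp
    also have "\<dots> = (\<Sum>j\<in>UNIV. ennreal (exp (\<eta> * \<delta>)) * (?g (x + axis j \<delta>) + ?g (x - axis j \<delta>)))"
      by (intro sum.cong refl) (simp add: ennreal_mult' distrib_left mult.left_commute)
    finally show ?thesis .
  qed
  then have "(\<integral>\<^sup>+x. ennreal (\<bar>walk (Suc k) x\<bar> * exp (\<eta> * norm x)) \<partial>?N) \<le>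
    (\<integral>\<^sup>+x. (\<Sum>j\<in>UNIV. ennreal (exp (\<eta> * \<delta>)) * (?g (x + axis j \<delta>) + ?g (x - axis j \<delta>))) \<partial>?N)"
    by (intro nn_integral_mono)
  also have "\<dots> = (\<Sum>j\<in>(UNIV::'d set). ennreal (exp (\<eta> * \<delta>)) * ((\<integral>\<^sup>+x. ?g (x + axis j \<delta>) \<partial>?N) + (\<integral>\<^sup>+x. ?g (x - axis j \<delta>) \<partial>?N)))"
    by (simp add: nn_integral_sum nn_integral_cmult nn_integral_add)
  also have "\<dots> = (\<Sum>j\<in>(UNIV::'d set). ennreal (exp (\<eta> * \<delta>)) * (?W + ?W))"
  proof -
    have "(\<integral>\<^sup>+x. ?g (x + axis j \<delta>) \<partial>?N) = ?W" for j :: 'd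
      by (rule nn_integral_bij_count_space, rule bij_betwI[where g = "\<lambda>x. x - axis j \<delta>"])
        (auto intro: axis_lattice lattice_add lattice_diff)
    moreover have "(\<integral>\<^sup>+x. ?g (x - axis j \<delta>) \<partial>?N) = ?W" for j :: 'd
      by (rule nn_integral_bij_count_space, rule bij_betwI[where g = "\<lambda>x. x + axis j \<delta>"])
        (auto intro: axis_lattice lattice_add lattice_diff)
    ultimately show ?thesis by simp
  qed
  also have "\<dots> = ennreal (2 * real CARD('d) * exp (\<eta> * \<delta>)) * ?W"
  proof -
    have "ennreal (2 * real CARD('d) * exp (\<eta> * \<delta>)) = of_nat CARD('d) * (2 * ennreal (exp (\<eta> * \<delta>)))"
      by (simp add: ennreal_mult' ennreal_of_nat_eq_real_of_nat mult.commute[of 2] mult.assoc)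
    then show ?thesis by (simp only: sum_constant mult_2[symmetric] mult.assoc mult.left_commute[of "ennreal (exp (\<eta> * \<delta>))" 2])
  qed
  also have "\<dots> \<le> ennreal (2 * real CARD('d) * exp (\<eta> * \<delta>)) * ennreal ((2 * real CARD('d) * exp (\<eta> * \<delta>)) ^ k * vol TYPE('d))"
    by (intro mult_left_mono Suc.IH) simp
  also have "\<dots> = ennreal ((2 * real CARD('d) * exp (\<eta> * \<delta>)) ^ Suc k * vol TYPE('d))"
    by (subst ennreal_mult'[symmetric]) (simp_all add: mult.assoc)
  finally show ?case .
qed


section \<open>The lattice heat kernel with mass term\<close>

definition hop_rate :: "'d::finite itself \<Rightarrow> real" where
  "hop_rate _ = 2 * real CARD('d) / \<delta>\<^sup>2"

lemma hop_rate_pos: "0 < hop_rate TYPE('d::finite)"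
  using pos by (simp add: hop_rate_def)

lemma mu_sq_eq: "mu_sq \<delta> m0 (p :: real^'d::finite) = hop_rate TYPE('d) + m0\<^sup>2 - hop p / \<delta>\<^sup>2"
  by (simp add: mu_sq_def hop_rate_def hop_def sum_distrib_left[symmetric] algebra_simps diff_divide_distrib)

lemma mu_sq_nonneg: "0 \<le> mu_sq \<delta> m0 (p :: real^'d::finite)"
  and mu_sq_le: "mu_sq \<delta> m0 (p :: real^'d::finite) \<le> 2 * hop_rate TYPE('d) + m0\<^sup>2"
proof -
  have "\<bar>hop p\<bar> / \<delta>\<^sup>2 \<le> hop_rate TYPE('d)"
    unfolding hop_rate_def using abs_hop_le[of p] by (intro divide_right_mono) auto
  then have "\<bar>hop p / \<delta>\<^sup>2\<bar> \<le> hop_rate TYPE('d)" by simp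
  then show "0 \<le> mu_sq \<delta> m0 p" "mu_sq \<delta> m0 p \<le> 2 * hop_rate TYPE('d) + m0\<^sup>2"
    unfolding mu_sq_eq using zero_le_power2[of m0] by linarith+
qed

lemma mu_sq_measurable [measurable]: "mu_sq \<delta> m0 \<in> borel_measurable borel"
  unfolding mu_sq_eq[abs_def] by measurable

text \<open>The Fourier integral of \<open>Green\<close> stripped of the step function and of the
  constant. It is continuous in \<open>t\<close> on the whole line, so the step function is the only
  source of the jump.\<close>

definition heat :: "real \<Rightarrow> real^'d::finite \<Rightarrow> real" where
  "heat t x = bzint (\<lambda>p. cos (p \<bullet> x) * exp (- t * mu_sq \<delta> m0 p))"

lemma Green_eq:
  "Green \<delta> m0 (t, x :: real^'d::finite) = (if 0 < t then heat t x / (2 * pi) ^ CARD('d) else 0)"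
proof -
  let ?f = "\<lambda>p. exp (- \<i> * of_real (p \<bullet> x)) * of_real (exp (- t * mu_sq \<delta> m0 p)) :: complex"
  have "continuous_on bz (\<lambda>p. mu_sq \<delta> m0 p)" unfolding mu_sq_def by (intro continuous_intros)
  then have "complex_integrable lborel (\<lambda>p. indicator bz p *\<^sub>R ?f p)"
    by (intro borel_integrable_compact compact_cbox continuous_intros)
  then have "Re (CLINT p:bz|lborel. ?f p) = (LINT p|lborel. Re (indicator bz p *\<^sub>R ?f p))"
    unfolding set_lebesgue_integral_def by (rule integral_Re[symmetric])
  also have "\<dots> = heat t x"
  proof -
    have "exp (- \<i> * of_real (p \<bullet> x)) = cis (- (p \<bullet> x))" for p by (simp add: cis_conv_exp)
    then show ?thesis unfolding heat_def bzint_def by (intro Bochner_Integration.integral_cong) simp_all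
  qed
  finally show ?thesis by (simp add: Green_def)
qed

lemma heat_bound: "0 \<le> t \<Longrightarrow> \<bar>heat t (x :: real^'d::finite)\<bar> \<le> vol TYPE('d)"
proof -
  assume t: "0 \<le> t"
  have "\<bar>cos (p \<bullet> x) * exp (- t * mu_sq \<delta> m0 p)\<bar> \<le> 1" for p
    using mult_mono[OF abs_cos_le_one[of "p \<bullet> x"], of "exp (- t * mu_sq \<delta> m0 p)" 1]
      mult_nonneg_nonneg[OF t mu_sq_nonneg[of p]] by (simp add: abs_mult)
  then show ?thesis
    unfolding heat_def using bzint_abs_le[of "\<lambda>p. cos (p \<bullet> x) * exp (- t * mu_sq \<delta> m0 p)" 1] by simp
qed

lemma heat_isCont: "isCont (\<lambda>t. heat t (x :: real^'d::finite)) t0"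
  unfolding continuous_at_sequentially
proof (intro allI impI)
  fix X assume X: "X \<longlonglongrightarrow> t0"
  let ?M = "2 * hop_rate TYPE('d) + m0\<^sup>2"
  obtain R where R: "\<And>n. \<bar>X n\<bar> \<le> R"
    using convergent_imp_Bseq[of X] X unfolding convergent_def Bseq_def real_norm_def by blast
  have "(\<lambda>n. LINT p|lborel. indicator bz p * (cos (p \<bullet> x) * exp (- X n * mu_sq \<delta> m0 p))) \<longlonglongrightarrow>
    (LINT p|lborel. indicator bz p * (cos (p \<bullet> x) * exp (- t0 * mu_sq \<delta> m0 p)))"
  proof (rule integral_dominated_convergence)
    show "integrable lborel (\<lambda>p::real^'d. indicator bz p * exp (R * ?M))"
      by (simp add: bz_integrable)
    show "AE p in lborel. (\<lambda>n. indicator bz p * (cos (p \<bullet> x) * exp (- X n * mu_sq \<delta> m0 p))) \<longlonglongrightarrow>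
      indicator bz p * (cos (p \<bullet> x) * exp (- t0 * mu_sq \<delta> m0 p))"
      by (intro AE_I2 tendsto_intros X)
    show "AE p in lborel. norm (indicator bz p * (cos (p \<bullet> x) * exp (- X n * mu_sq \<delta> m0 p))) \<le> indicator bz p * exp (R * ?M)" for n
    proof (rule AE_I2)
      fix p :: "real^'d"
      have "- X n * mu_sq \<delta> m0 p \<le> \<bar>X n\<bar> * mu_sq \<delta> m0 p"
        by (intro mult_right_mono mu_sq_nonneg) auto
      also have "\<dots> \<le> R * ?M"
        using R[of n] by (intro mult_mono mu_sq_le mu_sq_nonneg) auto
      finally have "\<bar>cos (p \<bullet> x)\<bar> * exp (- X n * mu_sq \<delta> m0 p) \<le> 1 * exp (R * ?M)"
        by (intro mult_mono) auto
      then show "norm (indicator bz p * (cos (p \<bullet> x) * exp (- X n * mu_sq \<delta> m0 p))) \<le> indicator bz p * exp (R * ?M)"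
        by (simp add: abs_mult indicator_def)
    qed
  qed measurable
  then show "((\<lambda>t. heat t x) \<circ> X) \<longlonglongrightarrow> heat t0 x"
    by (simp add: heat_def bzint_def o_def)
qed

text \<open>By \<open>mu_sq_eq\<close> the exponential splits into a factor free of \<open>p\<close>
  and \<open>exp (t * hop p / \<delta>^2)\<close>; expanding the latter exhibits the heat kernel as
  a Poisson mixture over the number of steps of the walk, with \<open>hop_rate\<close> as jump
  rate.\<close>

lemma heat_sums:
  fixes x :: "real^'d::finite"
  assumes t: "0 \<le> t"
  shows "(\<lambda>k. (t / \<delta>\<^sup>2) ^ k / fact k * walk k x) sums (exp ((hop_rate TYPE('d) + m0\<^sup>2) * t) * heat t x)"
proof -
  define s where "s = t / \<delta>\<^sup>2"
  have s: "0 \<le> s" using t by (simp add: s_def)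
  let ?f = "\<lambda>k p. indicator bz p * (cos (p \<bullet> x) * hop p ^ k) * (s ^ k / fact k)"
  have i: "integrable lborel (?f k)" for k by (intro integrable_mult_left walk_integrable)
  have e: "(\<lambda>k. ?f k p) sums (indicator bz p * cos (p \<bullet> x) * exp (s * hop p))" for p
  proof -
    have "(\<lambda>k. indicator bz p * cos (p \<bullet> x) * ((s * hop p) ^ k /\<^sub>R fact k)) sums (indicator bz p * cos (p \<bullet> x) * exp (s * hop p))"
      by (intro sums_mult exp_converges)
    then show ?thesis by (simp add: power_mult_distrib divide_inverse mult_ac)
  qed
  have b: "norm (?f k p) \<le> (2 * real CARD('d) * s) ^ k / fact k * indicator bz p" for k p
  proof -
    have "\<bar>cos (p \<bullet> x)\<bar> * \<bar>hop p\<bar> ^ k \<le> 1 * (2 * real CARD('d)) ^ k"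
      by (intro mult_mono power_mono abs_hop_le) auto
    then have "\<bar>cos (p \<bullet> x)\<bar> * \<bar>hop p\<bar> ^ k * (s ^ k / fact k) \<le> (2 * real CARD('d)) ^ k * (s ^ k / fact k)"
      using s by (intro mult_right_mono) auto
    then show ?thesis using s by (simp add: abs_mult power_abs indicator_def power_mult_distrib)
  qed
  have se: "summable (\<lambda>k. (2 * real CARD('d) * s) ^ k / fact k * c)" for c :: real
    using summable_exp[of "2 * real CARD('d) * s"] by (intro summable_mult2) (simp add: divide_inverse mult.commute)
  have sn: "summable (\<lambda>k. norm (?f k p))" for p
    by (rule summable_comparison_test'[OF se[of "indicator bz p"], of 0]) (use b in simp)
  have si: "summable (\<lambda>k. LINT p|lborel. norm (?f k p))"
  proof (rule summable_comparison_test'[OF se[of "vol TYPE('d)"], of 0])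
    fix k
    have "(LINT p|lborel. norm (?f k p)) \<le> (LINT p|lborel. (2 * real CARD('d) * s) ^ k / fact k * indicator (bz :: (real^'d) set) p)"
      by (intro integral_mono integrable_norm i b integrable_mult_right bz_integrable)
    then show "norm (LINT p|lborel. norm (?f k p)) \<le> (2 * real CARD('d) * s) ^ k / fact k * vol TYPE('d)"
      by (simp add: integral_nonneg_AE)
  qed
  have "(\<lambda>k. LINT p|lborel. ?f k p) sums (LINT p|lborel. (\<Sum>k. ?f k p))"
    using integral_suminf[OF i _ si] summable_integral[OF i _ si] sn by (auto simp: sums_iff)
  also have "(\<lambda>p. \<Sum>k. ?f k p) = (\<lambda>p. indicator bz p * cos (p \<bullet> x) * exp (s * hop p))"
    using e by (auto simp: sums_iff)
  also have "(LINT p|lborel. indicator bz p * cos (p \<bullet> x) * exp (s * hop p)) =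
    (LINT p|lborel. exp ((hop_rate TYPE('d) + m0\<^sup>2) * t) * (indicator bz p * (cos (p \<bullet> x) * exp (- t * mu_sq \<delta> m0 p))))"
  proof (intro Bochner_Integration.integral_cong refl)
    fix p :: "real^'d"
    have "s * hop p = (hop_rate TYPE('d) + m0\<^sup>2) * t + (- t * mu_sq \<delta> m0 p)"
      by (simp add: mu_sq_eq s_def algebra_simps)
    then have "exp (s * hop p) = exp ((hop_rate TYPE('d) + m0\<^sup>2) * t) * exp (- t * mu_sq \<delta> m0 p)"
      by (simp only: exp_add)
    then show "indicator bz p * cos (p \<bullet> x) * exp (s * hop p) =
      exp ((hop_rate TYPE('d) + m0\<^sup>2) * t) * (indicator bz p * (cos (p \<bullet> x) * exp (- t * mu_sq \<delta> m0 p)))"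
      by (simp only: mult_ac)
  qed
  also have "\<dots> = exp ((hop_rate TYPE('d) + m0\<^sup>2) * t) * heat t x"
    by (simp add: heat_def bzint_def)
  also have "(\<lambda>k. LINT p|lborel. ?f k p) = (\<lambda>k. s ^ k / fact k * walk k x)"
    by (simp only: walk_def bzint_def integral_mult_left_zero) (simp only: mult.commute)
  finally show ?thesis by (simp only: s_def)
qed

text \<open>Summing the walk bounds in the Poisson series raises the jump rate by the factor
  \<open>exp (\<eta> * \<delta>)\<close>. What remains is exponential decay in time as soon as
  \<open>\<eta>\<close> is small enough for \<open>m0^2\<close> to exceed the increase of the
  rate.\<close>

lemma heat_exp_sum:
  assumes t: "0 \<le> t" and \<eta>: "0 \<le> \<eta>"
  shows "(\<integral>\<^sup>+x. ennreal (\<bar>heat t x\<bar> * exp (\<eta> * norm x)) \<partial>count_space (lattice \<delta> :: (real^'d::finite) set)) \<le>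
    ennreal (vol TYPE('d) * exp (- (hop_rate TYPE('d) + m0\<^sup>2 - hop_rate TYPE('d) * exp (\<eta> * \<delta>)) * t))"
proof -
  let ?N = "count_space (lattice \<delta> :: (real^'d) set)"
  let ?\<kappa> = "hop_rate TYPE('d) + m0\<^sup>2"
  define a where "a k = (t / \<delta>\<^sup>2) ^ k / fact k" for k
  have a: "0 \<le> a k" for k using t by (simp add: a_def)
  have "ennreal (\<bar>heat t x\<bar> * exp (\<eta> * norm x)) \<le>
    ennreal (exp (- ?\<kappa> * t)) * (\<Sum>k. ennreal (a k) * ennreal (\<bar>walk k x\<bar> * exp (\<eta> * norm x)))" for x :: "real^'d"
  proof -
    have sw: "summable (\<lambda>k. a k * \<bar>walk k x\<bar>)"
    proof (rule summable_comparison_test'[of _ 0])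
      show "summable (\<lambda>k. (2 * real CARD('d) * (t / \<delta>\<^sup>2)) ^ k / fact k * vol TYPE('d))"
        using summable_exp[of "2 * real CARD('d) * (t / \<delta>\<^sup>2)"]
        by (intro summable_mult2) (simp add: divide_inverse mult.commute)
      show "norm (a k * \<bar>walk k x\<bar>) \<le> (2 * real CARD('d) * (t / \<delta>\<^sup>2)) ^ k / fact k * vol TYPE('d)" for k
      proof -
        have "norm (a k * \<bar>walk k x\<bar>) = a k * \<bar>walk k x\<bar>" using a by (simp add: abs_mult)
        also have "\<dots> \<le> a k * ((2 * real CARD('d)) ^ k * vol TYPE('d))" by (intro mult_left_mono walk_bound a)
        finally show ?thesis unfolding a_def power_mult_distrib by (simp add: mult_ac)
      qed
    qed
    have "\<bar>exp (?\<kappa> * t) * heat t x\<bar> \<le> (\<Sum>k. a k * \<bar>walk k x\<bar>)"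
      using summable_rabs[of "\<lambda>k. a k * walk k x"] sw heat_sums[OF t, of x] a
      by (simp add: sums_iff a_def[symmetric] abs_mult)
    then have "exp (- ?\<kappa> * t) * \<bar>exp (?\<kappa> * t) * heat t x\<bar> * exp (\<eta> * norm x) \<le>
      exp (- ?\<kappa> * t) * (\<Sum>k. a k * \<bar>walk k x\<bar>) * exp (\<eta> * norm x)"
      by (intro mult_right_mono mult_left_mono) auto
    moreover have "exp (- ?\<kappa> * t) * \<bar>exp (?\<kappa> * t) * heat t x\<bar> = \<bar>heat t x\<bar>"
    proof -
      have "- ?\<kappa> * t + ?\<kappa> * t = 0" by (simp add: algebra_simps)
      then show ?thesis by (simp only: abs_mult abs_exp_cancel mult.assoc[symmetric] exp_add[symmetric] exp_zero mult_1)
    qed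
    moreover have "exp (- ?\<kappa> * t) * (\<Sum>k. a k * \<bar>walk k x\<bar>) * exp (\<eta> * norm x) =
      exp (- ?\<kappa> * t) * (\<Sum>k. a k * (\<bar>walk k x\<bar> * exp (\<eta> * norm x)))"
      using sw by (simp add: suminf_mult2 mult.assoc)
    ultimately have "ennreal (\<bar>heat t x\<bar> * exp (\<eta> * norm x)) \<le>
      ennreal (exp (- ?\<kappa> * t) * (\<Sum>k. a k * (\<bar>walk k x\<bar> * exp (\<eta> * norm x))))"
      by (intro ennreal_leI) (simp only:)
    also have "\<dots> = ennreal (exp (- ?\<kappa> * t)) * ennreal (\<Sum>k. a k * (\<bar>walk k x\<bar> * exp (\<eta> * norm x)))"
      by (rule ennreal_mult') simp
    also have "ennreal (\<Sum>k. a k * (\<bar>walk k x\<bar> * exp (\<eta> * norm x))) = (\<Sum>k. ennreal (a k * (\<bar>walk k x\<bar> * exp (\<eta> * norm x))))"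
      using summable_mult2[OF sw, of "exp (\<eta> * norm x)"] a
      by (intro suminf_ennreal2[symmetric]) (simp_all add: mult.assoc)
    finally show ?thesis using a by (simp add: ennreal_mult')
  qed
  then have "(\<integral>\<^sup>+x. ennreal (\<bar>heat t x\<bar> * exp (\<eta> * norm x)) \<partial>?N) \<le>
    (\<integral>\<^sup>+x. ennreal (exp (- ?\<kappa> * t)) * (\<Sum>k. ennreal (a k) * ennreal (\<bar>walk k x\<bar> * exp (\<eta> * norm x))) \<partial>?N)"
    by (intro nn_integral_mono)
  also have "\<dots> = ennreal (exp (- ?\<kappa> * t)) * (\<Sum>k. ennreal (a k) * (\<integral>\<^sup>+x. ennreal (\<bar>walk k x\<bar> * exp (\<eta> * norm x)) \<partial>?N))"
    by (simp add: nn_integral_cmult nn_integral_suminf)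
  also have "\<dots> \<le> ennreal (exp (- ?\<kappa> * t)) * (\<Sum>k. ennreal (a k) * ennreal ((2 * real CARD('d) * exp (\<eta> * \<delta>)) ^ k * vol TYPE('d)))"
    by (intro mult_left_mono suminf_le walk_exp_sum \<eta>) auto
  also have "(\<Sum>k. ennreal (a k) * ennreal ((2 * real CARD('d) * exp (\<eta> * \<delta>)) ^ k * vol TYPE('d))) =
    ennreal (exp (hop_rate TYPE('d) * exp (\<eta> * \<delta>) * t) * vol TYPE('d))"
  proof -
    have "(\<lambda>k. (hop_rate TYPE('d) * exp (\<eta> * \<delta>) * t) ^ k /\<^sub>R fact k * vol TYPE('d)) sums
      (exp (hop_rate TYPE('d) * exp (\<eta> * \<delta>) * t) * vol TYPE('d))"
      by (intro sums_mult2 exp_converges)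
    moreover have "(hop_rate TYPE('d) * exp (\<eta> * \<delta>) * t) ^ k /\<^sub>R fact k * vol TYPE('d) =
      a k * ((2 * real CARD('d) * exp (\<eta> * \<delta>)) ^ k * vol TYPE('d))" for k
    proof -
      have "hop_rate TYPE('d) * exp (\<eta> * \<delta>) * t = (t / \<delta>\<^sup>2) * (2 * real CARD('d) * exp (\<eta> * \<delta>))"
        by (simp add: hop_rate_def)
      then show ?thesis by (simp only: a_def power_mult_distrib) (simp add: divide_inverse mult_ac)
    qed
    ultimately have "(\<lambda>k. a k * ((2 * real CARD('d) * exp (\<eta> * \<delta>)) ^ k * vol TYPE('d))) sums
      (exp (hop_rate TYPE('d) * exp (\<eta> * \<delta>) * t) * vol TYPE('d))" by (simp only:)
    then have "(\<Sum>k. ennreal (a k * ((2 * real CARD('d) * exp (\<eta> * \<delta>)) ^ k * vol TYPE('d)))) =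
      ennreal (exp (hop_rate TYPE('d) * exp (\<eta> * \<delta>) * t) * vol TYPE('d))"
      using a by (simp add: suminf_ennreal2 sums_iff)
    then show ?thesis using a by (simp add: ennreal_mult')
  qed
  also have "ennreal (exp (- ?\<kappa> * t)) * \<dots> = ennreal (exp (- ?\<kappa> * t) * (exp (hop_rate TYPE('d) * exp (\<eta> * \<delta>) * t) * vol TYPE('d)))"
    by (rule ennreal_mult'[symmetric]) simp
  also have "exp (- ?\<kappa> * t) * (exp (hop_rate TYPE('d) * exp (\<eta> * \<delta>) * t) * vol TYPE('d)) =
     vol TYPE('d) * exp (- (?\<kappa> - hop_rate TYPE('d) * exp (\<eta> * \<delta>)) * t)"
  proof -
    have "- (?\<kappa> - hop_rate TYPE('d) * exp (\<eta> * \<delta>)) * t = - ?\<kappa> * t + hop_rate TYPE('d) * exp (\<eta> * \<delta>) * t"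
      by (simp add: algebra_simps)
    then show ?thesis by (simp only: exp_add mult_ac)
  qed
  finally show ?thesis .
qed

section \<open>Regularity and rapid decrease of the Green function\<close>

lemma heat_measurable [measurable]: "(\<lambda>t. heat t (x :: real^'d::finite)) \<in> borel_measurable borel"
  by (intro borel_measurable_continuous_onI continuous_at_imp_continuous_on ballI heat_isCont)

lemma Green_measurable: "Green \<delta> m0 \<in> borel_measurable (\<mu> :: 'd::finite point measure)"
proof (rule measurable_\<mu>_I)
  fix x :: "real^'d"
  show "(\<lambda>t. Green \<delta> m0 (t, x)) \<in> borel_measurable borel"
    unfolding Green_eq by measurable
qed

lemma Green_bound: "\<bar>Green \<delta> m0 (z :: 'd::finite point)\<bar> \<le> vol TYPE('d) / (2 * pi) ^ CARD('d)"
  using heat_bound[of "fst z" "snd z"] by (cases z) (auto simp: Green_eq divide_right_mono)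

lemma Green_isCont: "t \<noteq> 0 \<Longrightarrow> isCont (\<lambda>t. Green \<delta> m0 (t, x :: real^'d::finite)) t"
proof -
  assume t: "t \<noteq> 0"
  show ?thesis
  proof (cases "0 < t")
    case True
    have "\<forall>\<^sub>F s in nhds t. Green \<delta> m0 (s, x) = heat s x / (2 * pi) ^ CARD('d)"
      using eventually_nhds_in_open[of "{0<..}" t] True by (auto elim!: eventually_mono simp: Green_eq)
    then show ?thesis
      by (subst isCont_cong) (auto intro!: continuous_intros heat_isCont)
  next
    case False
    then have "\<forall>\<^sub>F s in nhds t. Green \<delta> m0 (s, x) = 0"
      using eventually_nhds_in_open[of "{..<0}" t] t by (auto elim!: eventually_mono simp: Green_eq)
    then show ?thesis by (subst isCont_cong) auto
  qed
qed


lemma heat_measurable_pair: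
  "(\<lambda>x. heat (fst x) (snd x)) \<in> borel_measurable (lborel \<Otimes>\<^sub>M count_space (lattice \<delta> :: (real^'d::finite) set))"
proof -
  have "(\<lambda>x :: 'd point. heat (fst x) (snd x)) \<in> borel_measurable \<mu>"
  proof (rule measurable_\<mu>_I)
    fix y :: "real^'d"
    show "(\<lambda>t. heat (fst (t, y)) (snd (t, y))) \<in> borel_measurable borel"
      using heat_measurable[of y] unfolding fst_conv snd_conv .
  qed
  then show ?thesis using measurable_cong_sets[OF sets_\<mu> refl] by blast
qed

text \<open>The polynomial weight is dominated by an exponential in space times an exponential in
  time. The first is controlled by \<open>heat_exp_sum\<close>, the second by the decay in time that
  \<open>heat_exp_sum\<close> leaves. A positive mass is essential for both.\<close>

lemma Green_rapid: "rapid (Green \<delta> m0 :: 'd::finite fn)"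
  unfolding rapid_def
proof (intro conjI allI Green_measurable integrableI_bounded)
  note [measurable] = Green_measurable
  show "(\<lambda>x. wt N x * Green \<delta> m0 x) \<in> borel_measurable \<mu>" for N by measurable
  fix N
  \<comment> \<open>Chosen so that the spatial weight uses up exactly half of \<open>m0^2\<close>;
    decay in time at rate \<open>m0^2 / 2\<close> is left.\<close>
  define \<eta> where "\<eta> = ln (1 + m0\<^sup>2 / (2 * hop_rate TYPE('d))) / \<delta>"
  have m0: "0 < m0\<^sup>2" using m0_pos by simp
  have \<eta>: "0 < \<eta>" unfolding \<eta>_def using pos m0 hop_rate_pos[where 'd = 'd] by (auto intro!: divide_pos_pos ln_gt_zero)
  have "exp (\<eta> * \<delta>) = 1 + m0\<^sup>2 / (2 * hop_rate TYPE('d))"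
    using pos m0 hop_rate_pos[where 'd = 'd] by (simp add: \<eta>_def add_pos_pos)
  then have rate: "hop_rate TYPE('d) + m0\<^sup>2 - hop_rate TYPE('d) * exp (\<eta> * \<delta>) = m0\<^sup>2 / 2"
    using hop_rate_pos[where 'd = 'd] by (simp add: field_simps)
  obtain A where A: "0 \<le> A" "\<And>u. 0 \<le> u \<Longrightarrow> (1 + u\<^sup>2) ^ N \<le> A * exp (\<eta> * u)"
    using one_plus_power_le_exp[OF \<eta>] by blast
  \<comment> \<open>Half of the remaining rate pays for the polynomial weight in time, and the other
    half makes the time integral converge.\<close>
  have "0 < m0\<^sup>2 / 4" using m0 by simp
  then obtain A' where A': "0 \<le> A'" "\<And>u. 0 \<le> u \<Longrightarrow> (1 + u\<^sup>2) ^ N \<le> A' * exp (m0\<^sup>2 / 4 * u)"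
    using one_plus_power_le_exp by blast
  have w: "wt N (t, y) \<le> 2 ^ N * (A' * exp (m0\<^sup>2 / 4 * t)) * (A * exp (\<eta> * norm y))" if "0 \<le> t" for t and y :: "real^'d"
  proof -
    have "wt N ((t, 0) + (0, y)) \<le> 2 ^ N * wt N (t, 0 :: real^'d) * wt N (0 :: real, y)" by (rule wt_plus_le)
    also have "\<dots> = 2 ^ N * (1 + t\<^sup>2) ^ N * (1 + (norm y)\<^sup>2) ^ N" by (simp add: wt_def norm_Pair)
    also have "\<dots> \<le> 2 ^ N * (A' * exp (m0\<^sup>2 / 4 * t)) * (A * exp (\<eta> * norm y))"
      using A A' that by (intro mult_mono) auto
    finally show ?thesis by simp
  qed
  let ?c = "2 ^ N * A' * A / (2 * pi) ^ CARD('d)"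
  have c: "0 \<le> ?c" using A A' by simp
  have "(\<integral>\<^sup>+x. ennreal (norm (wt N x * Green \<delta> m0 x)) \<partial>(\<mu> :: 'd point measure)) =
    (\<integral>\<^sup>+x. ennreal (wt N x * \<bar>Green \<delta> m0 x\<bar>) \<partial>(\<mu> :: 'd point measure))"
    by (simp add: abs_mult)
  also have "\<dots> = ennreal (\<delta> ^ CARD('d)) * (\<integral>\<^sup>+y. (\<integral>\<^sup>+t. ennreal (wt N (t, y) * \<bar>Green \<delta> m0 (t, y)\<bar>) \<partial>lborel) \<partial>count_space (lattice \<delta> :: (real^'d) set))"
    by (rule nn_integral_\<mu>) measurable
  finally have total: "(\<integral>\<^sup>+x. ennreal (norm (wt N x * Green \<delta> m0 x)) \<partial>(\<mu> :: 'd point measure)) =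
    ennreal (\<delta> ^ CARD('d)) * (\<integral>\<^sup>+y. (\<integral>\<^sup>+t. ennreal (wt N (t, y) * \<bar>Green \<delta> m0 (t, y)\<bar>) \<partial>lborel) \<partial>count_space (lattice \<delta> :: (real^'d) set))" .
  have "(\<integral>\<^sup>+y. (\<integral>\<^sup>+t. ennreal (wt N (t, y) * \<bar>Green \<delta> m0 (t, y)\<bar>) \<partial>lborel) \<partial>count_space (lattice \<delta> :: (real^'d) set)) \<le>
    (\<integral>\<^sup>+y. (\<integral>\<^sup>+t. ennreal (?c * exp (m0\<^sup>2 / 4 * t)) * indicator {0<..} t * ennreal (\<bar>heat t y\<bar> * exp (\<eta> * norm y)) \<partial>lborel) \<partial>count_space (lattice \<delta> :: (real^'d) set))"
  proof (intro nn_integral_mono)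
    fix y :: "real^'d" and t :: real
    show "ennreal (wt N (t, y) * \<bar>Green \<delta> m0 (t, y)\<bar>) \<le> ennreal (?c * exp (m0\<^sup>2 / 4 * t)) * indicator {0<..} t * ennreal (\<bar>heat t y\<bar> * exp (\<eta> * norm y))"
    proof (cases "0 < t")
      case True
      have "wt N (t, y) * \<bar>Green \<delta> m0 (t, y)\<bar> = wt N (t, y) * (\<bar>heat t y\<bar> / (2 * pi) ^ CARD('d))"
        using True by (simp add: Green_eq)
      also have "\<dots> \<le> 2 ^ N * (A' * exp (m0\<^sup>2 / 4 * t)) * (A * exp (\<eta> * norm y)) * (\<bar>heat t y\<bar> / (2 * pi) ^ CARD('d))"
        using True by (intro mult_right_mono w) auto
      also have "\<dots> = ?c * exp (m0\<^sup>2 / 4 * t) * (\<bar>heat t y\<bar> * exp (\<eta> * norm y))" by simp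
      finally have "ennreal (wt N (t, y) * \<bar>Green \<delta> m0 (t, y)\<bar>) \<le> ennreal (?c * exp (m0\<^sup>2 / 4 * t) * (\<bar>heat t y\<bar> * exp (\<eta> * norm y)))"
        by (rule ennreal_leI)
      also have "\<dots> = ennreal (?c * exp (m0\<^sup>2 / 4 * t)) * ennreal (\<bar>heat t y\<bar> * exp (\<eta> * norm y))"
        using mult_nonneg_nonneg[OF c exp_ge_zero] by (rule ennreal_mult')
      finally show ?thesis using True by simp
    qed (simp add: Green_eq)
  qed
  \<comment> \<open>\<open>nn_integral_\<mu>\<close> integrates over time first, but the available
    estimate sums over the lattice at a fixed time, so the order is reversed.\<close>
  also have "\<dots> = (\<integral>\<^sup>+t. (\<integral>\<^sup>+y. ennreal (?c * exp (m0\<^sup>2 / 4 * t)) * indicator {0<..} t * ennreal (\<bar>heat t y\<bar> * exp (\<eta> * norm y)) \<partial>count_space (lattice \<delta> :: (real^'d) set)) \<partial>lborel)"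
  proof -
    note [measurable] = heat_measurable_pair
    have [measurable]: "(\<lambda>x. norm (snd x)) \<in> borel_measurable (lborel \<Otimes>\<^sub>M count_space (lattice \<delta> :: (real^'d) set))"
      by (rule measurable_compose[OF measurable_snd]) simp
    have m: "(\<lambda>x. ennreal (?c * exp (m0\<^sup>2 / 4 * fst x)) * indicator {0<..} (fst x) * ennreal (\<bar>heat (fst x) (snd x)\<bar> * exp (\<eta> * norm (snd x))))
      \<in> borel_measurable (lborel \<Otimes>\<^sub>M count_space (lattice \<delta> :: (real^'d) set))"
      by measurable
    have "pair_sigma_finite (lborel :: real measure) (count_space (lattice \<delta> :: (real^'d) set))"
      by (intro pair_sigma_finite.intro sigma_finite_lborel sigma_finite_measure_count_space_countable countable_lattice)
    from pair_sigma_finite.Fubini'[OF this, of "\<lambda>t y. ennreal (?c * exp (m0\<^sup>2 / 4 * t)) * indicator {0<..} t * ennreal (\<bar>heat t y\<bar> * exp (\<eta> * norm y))"] m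
    show ?thesis unfolding case_prod_beta by (simp only:)
  qed
  also have "\<dots> \<le> (\<integral>\<^sup>+t. ennreal (?c * vol TYPE('d)) * (ennreal (exp (- (m0\<^sup>2 / 4) * t)) * indicator {0<..} t) \<partial>lborel)"
  proof (rule nn_integral_mono)
    fix t :: real
    show "(\<integral>\<^sup>+y. ennreal (?c * exp (m0\<^sup>2 / 4 * t)) * indicator {0<..} t * ennreal (\<bar>heat t y\<bar> * exp (\<eta> * norm y)) \<partial>count_space (lattice \<delta> :: (real^'d) set))
      \<le> ennreal (?c * vol TYPE('d)) * (ennreal (exp (- (m0\<^sup>2 / 4) * t)) * indicator {0<..} t)"
    proof (cases "0 < t")
      case True
      have "(\<integral>\<^sup>+y. ennreal (\<bar>heat t y\<bar> * exp (\<eta> * norm y)) \<partial>count_space (lattice \<delta> :: (real^'d) set)) \<le> ennreal (vol TYPE('d) * exp (- (m0\<^sup>2 / 2) * t))"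
        using heat_exp_sum[of t \<eta>, where 'd = 'd] True \<eta> unfolding rate by simp
      then have "ennreal (?c * exp (m0\<^sup>2 / 4 * t)) * (\<integral>\<^sup>+y. ennreal (\<bar>heat t y\<bar> * exp (\<eta> * norm y)) \<partial>count_space (lattice \<delta> :: (real^'d) set))
        \<le> ennreal (?c * exp (m0\<^sup>2 / 4 * t)) * ennreal (vol TYPE('d) * exp (- (m0\<^sup>2 / 2) * t))"
        by (rule mult_left_mono) simp
      also have "\<dots> = ennreal (?c * exp (m0\<^sup>2 / 4 * t) * (vol TYPE('d) * exp (- (m0\<^sup>2 / 2) * t)))"
        using mult_nonneg_nonneg[OF c exp_ge_zero] by (rule ennreal_mult'[symmetric])
      also have "?c * exp (m0\<^sup>2 / 4 * t) * (vol TYPE('d) * exp (- (m0\<^sup>2 / 2) * t)) = ?c * vol TYPE('d) * exp (m0\<^sup>2 / 4 * t + - (m0\<^sup>2 / 2) * t)"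
        by (simp only: exp_add mult_ac)
      also have "m0\<^sup>2 / 4 * t + - (m0\<^sup>2 / 2) * t = - (m0\<^sup>2 / 4) * t" by (simp add: field_simps)
      also have "ennreal (?c * vol TYPE('d) * exp (- (m0\<^sup>2 / 4) * t)) = ennreal (?c * vol TYPE('d)) * ennreal (exp (- (m0\<^sup>2 / 4) * t))"
        using mult_nonneg_nonneg[OF c measure_nonneg] by (rule ennreal_mult')
      finally show ?thesis using True by (simp add: nn_integral_cmult)
    qed simp
  qed
  also have "\<dots> = ennreal (?c * vol TYPE('d)) * (\<integral>\<^sup>+t. ennreal (exp (- (m0\<^sup>2 / 4) * t)) * indicator {0<..} t \<partial>lborel)"
    by (rule nn_integral_cmult) measurable
  finally have "(\<integral>\<^sup>+x. ennreal (norm (wt N x * Green \<delta> m0 x)) \<partial>(\<mu> :: 'd point measure)) \<le>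
    ennreal (\<delta> ^ CARD('d)) * (ennreal (?c * vol TYPE('d)) * (\<integral>\<^sup>+t. ennreal (exp (- (m0\<^sup>2 / 4) * t)) * indicator {0<..} t \<partial>lborel))"
    unfolding total by (rule mult_left_mono) simp
  also have "\<dots> < \<infinity>"
    using nn_integral_exp_Ici[of "m0\<^sup>2 / 4"] m0 by (simp add: ennreal_mult_less_top)
  finally show "(\<integral>\<^sup>+x. ennreal (norm (wt N x * Green \<delta> m0 x)) \<partial>(\<mu> :: 'd point measure)) < \<infinity>" .
qed

text \<open>The adjoint of convolution with \<open>Green\<close> is convolution with its reflection,
  which brings \<open>Green_adjoint\<close> under the results on \<open>conv\<close>.\<close>

definition rGreen :: "'d::finite fn" where
  "rGreen z = Green \<delta> m0 (- z)"

lemma rGreen_measurable: "rGreen \<in> borel_measurable (\<mu> :: 'd::finite point measure)"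
  using measurable_reflect[OF Green_measurable, of 0] by (simp add: rGreen_def[abs_def])

lemma rGreen_rapid: "rapid (rGreen :: 'd::finite fn)"
  unfolding rapid_def
proof (intro conjI allI rGreen_measurable)
  fix N
  have "integrable \<mu> (\<lambda>z :: 'd point. (\<lambda>x. wt N x * Green \<delta> m0 x) (0 - z))"
    by (subst integrable_reflect)
      (intro borel_measurable_times wt_measurable_\<mu> Green_measurable Gam_0 rapid_integrable[OF Green_rapid])+
  then show "integrable \<mu> (\<lambda>x :: 'd point. wt N x * rGreen x)" by (simp add: rGreen_def)
qed

lemma rGreen_bound: "\<bar>rGreen (z :: 'd::finite point)\<bar> \<le> vol TYPE('d) / (2 * pi) ^ CARD('d)"
  unfolding rGreen_def by (rule Green_bound)

lemma rGreen_isCont: "t \<noteq> 0 \<Longrightarrow> isCont (\<lambda>t. rGreen (t, x :: real^'d::finite)) t"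
  using isCont_o2[where f = uminus and g = "\<lambda>t. Green \<delta> m0 (t, - x)" and a = t] Green_isCont[of "- t" "- x"]
  by (simp add: rGreen_def)

lemma Green_adjoint_eq:
  assumes "\<phi> \<in> schwartz \<delta>"
  shows "Green_adjoint \<delta> m0 \<phi> = conv \<phi> rGreen"
proof -
  have "conv \<phi> rGreen = conv rGreen \<phi>"
    by (rule conv_commute[OF rGreen_measurable schwartz_measurable[OF assms]])
  also have "\<dots> = Green_adjoint \<delta> m0 \<phi>"
    by (simp add: conv_def Green_adjoint_def rGreen_def fun_eq_iff)
  finally show ?thesis by simp
qed

end

section \<open>Moments from characteristic functions\<close>

text \<open>A symmetric difference quotient. It multiplies \<open>exp (i s x)\<close> by
  \<open>i sin (h x) / h\<close>, which is bounded for fixed \<open>h\<close>, so differences of a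
  characteristic function can be computed before any moment is known to exist.\<close>

definition cdiff :: "real \<Rightarrow> (real \<Rightarrow> complex) \<Rightarrow> real \<Rightarrow> complex" where
  "cdiff h f s = (f (s + h) - f (s - h)) /\<^sub>R (2 * h)"

lemma vector_derivative_bound:
  fixes f :: "real \<Rightarrow> complex"
  assumes der: "\<And>s. (f has_vector_derivative f' s) (at s)"
    and bnd: "\<And>s. u \<le> s \<Longrightarrow> s \<le> w \<Longrightarrow> norm (f' s) \<le> B" and uw: "u \<le> w"
  shows "norm (f w - f u) \<le> B * (w - u)"
proof -
  have "norm (f w - f u) \<le> B * norm (w - u)"
  proof (rule differentiable_bound[where S = "{u..w}" and f' = "\<lambda>s h. h *\<^sub>R f' s"])
    fix s assume s: "s \<in> {u..w}"
    show "(f has_derivative (\<lambda>h. h *\<^sub>R f' s)) (at s within {u..w})"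
      using der[of s] unfolding has_vector_derivative_def by (rule has_derivative_at_withinI)
    show "onorm (\<lambda>h. h *\<^sub>R f' s) \<le> B"
      by (rule onorm_le) (use bnd[of s] s in \<open>simp add: mult.commute[of B] mult_left_mono\<close>)
  qed (use uw in auto)
  then show ?thesis using uw by simp
qed

text \<open>A symmetric difference is bounded by the derivative over the window of radius
  \<open>h\<close>. The induction replaces the tower \<open>F\<close> by its differences, using up
  one derivative and shrinking the admissible range by \<open>h\<close> each time.\<close>

lemma cdiff_power_bound:
  fixes F :: "nat \<Rightarrow> real \<Rightarrow> complex"
  assumes h: "0 < h" and der: "\<And>j s. (F j has_vector_derivative F (Suc j) s) (at s)"
    and bnd: "\<And>s. \<bar>s\<bar> \<le> R \<Longrightarrow> norm (F n s) \<le> B" and s: "\<bar>s\<bar> + real n * h \<le> R"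
  shows "norm ((cdiff h ^^ n) (F 0) s) \<le> B"
  using der bnd s
proof (induction n arbitrary: F R s)
  case (Suc n)
  have "norm ((cdiff h ^^ n) (cdiff h (F 0)) s) \<le> B"
  proof (rule Suc.IH[where F = "\<lambda>j. cdiff h (F j)" and R = "R - h"])
    fix j u
    have "((\<lambda>s. F j (s + h)) has_vector_derivative F (Suc j) (u + h)) (at u)"
    proof -
      have "((\<lambda>s. s + h) has_vector_derivative 1) (at u)"
        unfolding has_real_derivative_iff_has_vector_derivative[symmetric] by (auto intro!: derivative_eq_intros)
      from vector_diff_chain_at[OF this Suc.prems(1)] show ?thesis by (simp add: o_def)
    qed
    moreover have "((\<lambda>s. F j (s - h)) has_vector_derivative F (Suc j) (u - h)) (at u)"
    proof -
      have "((\<lambda>s. s - h) has_vector_derivative 1) (at u)"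
        unfolding has_real_derivative_iff_has_vector_derivative[symmetric] by (auto intro!: derivative_eq_intros)
      from vector_diff_chain_at[OF this Suc.prems(1)] show ?thesis by (simp add: o_def)
    qed
    ultimately show "(cdiff h (F j) has_vector_derivative cdiff h (F (Suc j)) u) (at u)"
      unfolding cdiff_def[abs_def] divide_inverse
      by (intro bounded_linear.has_vector_derivative[OF bounded_linear_scaleR_right] has_vector_derivative_diff)
  next
    fix u assume u: "\<bar>u\<bar> \<le> R - h"
    have "norm (F n (u + h) - F n (u - h)) \<le> B * ((u + h) - (u - h))"
    proof (rule vector_derivative_bound[OF Suc.prems(1)])
      fix s assume "u - h \<le> s" "s \<le> u + h"
      then show "norm (F (Suc n) s) \<le> B" using u by (intro Suc.prems(2)) linarith
    qed (use h in simp)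
    moreover have "norm (cdiff h (F n) u) = norm (F n (u + h) - F n (u - h)) / (2 * h)"
    proof -
      have "\<bar>inverse (2 * h)\<bar> = inverse (2 * h)" using h by (intro abs_of_pos) simp
      then show ?thesis unfolding cdiff_def norm_scaleR by (simp only: divide_inverse mult.commute)
    qed
    ultimately show "norm (cdiff h (F n) u) \<le> B" using h by (simp add: pos_divide_le_eq)
  qed (use Suc.prems(3) in \<open>simp add: algebra_simps\<close>)
  then show ?case by (simp only: funpow_Suc_right o_apply)
qed simp

lemma (in prob_space) cdiff_power_char:
  assumes X: "random_variable borel X" and h: "0 < h"
  shows "(cdiff h ^^ n) (\<lambda>s. CLINT \<omega>|M. exp (\<i> * of_real (s * X \<omega>))) =
    (\<lambda>s. CLINT \<omega>|M. (\<i> * of_real (sin (h * X \<omega>) / h)) ^ n * exp (\<i> * of_real (s * X \<omega>)))"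
proof (induction n)
  case (Suc n)
  note [measurable] = X
  let ?Y = "\<lambda>\<omega>. (\<i> * of_real (sin (h * X \<omega>) / h)) ^ n"
  have int: "integrable M (\<lambda>\<omega>. ?Y \<omega> * exp (\<i> * of_real (s * X \<omega>)))" for s
  proof (rule integrable_const_bound[where B = "(1 / h) ^ n"])
    have "norm (?Y \<omega> * exp (\<i> * of_real (s * X \<omega>))) \<le> (1 / h) ^ n" for \<omega>
      using h by (simp add: norm_mult norm_power norm_divide del: power_divide power_one_over)
        (intro power_mono divide_right_mono, simp_all)
    then show "AE \<omega> in M. norm (?Y \<omega> * exp (\<i> * of_real (s * X \<omega>))) \<le> (1 / h) ^ n" by simp
  qed measurable
  have e: "?Y \<omega> * exp (\<i> * of_real ((s + h) * X \<omega>)) - ?Y \<omega> * exp (\<i> * of_real ((s - h) * X \<omega>)) =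
    of_real (2 * h) * ((\<i> * of_real (sin (h * X \<omega>) / h)) ^ Suc n * exp (\<i> * of_real (s * X \<omega>)))" for s \<omega>
  proof -
    have "exp (\<i> * of_real ((s + h) * X \<omega>)) = exp (\<i> * of_real (s * X \<omega>)) * cis (h * X \<omega>)"
      by (simp add: cis_conv_exp exp_add[symmetric] algebra_simps)
    moreover have "exp (\<i> * of_real ((s - h) * X \<omega>)) = exp (\<i> * of_real (s * X \<omega>)) * cis (- (h * X \<omega>))"
      by (simp add: cis_conv_exp exp_add[symmetric] algebra_simps)
    moreover have "cis (h * X \<omega>) - cis (- (h * X \<omega>)) = of_real (2 * h) * (\<i> * of_real (sin (h * X \<omega>) / h))"
      using h by (simp add: complex_eq_iff)
    ultimately have "exp (\<i> * of_real ((s + h) * X \<omega>)) - exp (\<i> * of_real ((s - h) * X \<omega>)) =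
      exp (\<i> * of_real (s * X \<omega>)) * (of_real (2 * h) * (\<i> * of_real (sin (h * X \<omega>) / h)))"
      by (simp only: right_diff_distrib[symmetric])
    then have "?Y \<omega> * (exp (\<i> * of_real ((s + h) * X \<omega>)) - exp (\<i> * of_real ((s - h) * X \<omega>))) =
      ?Y \<omega> * (exp (\<i> * of_real (s * X \<omega>)) * (of_real (2 * h) * (\<i> * of_real (sin (h * X \<omega>) / h))))"
      by (simp only:)
    then show ?thesis unfolding right_diff_distrib power_Suc by (simp only: mult_ac)
  qed
  show ?case
  proof
    fix s
    have "(cdiff h ^^ Suc n) (\<lambda>s. CLINT \<omega>|M. exp (\<i> * of_real (s * X \<omega>))) s =
      ((CLINT \<omega>|M. ?Y \<omega> * exp (\<i> * of_real ((s + h) * X \<omega>))) - (CLINT \<omega>|M. ?Y \<omega> * exp (\<i> * of_real ((s - h) * X \<omega>)))) /\<^sub>R (2 * h)"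
      by (simp only: funpow.simps o_apply Suc.IH cdiff_def)
    also have "\<dots> = (CLINT \<omega>|M. of_real (2 * h) * ((\<i> * of_real (sin (h * X \<omega>) / h)) ^ Suc n * exp (\<i> * of_real (s * X \<omega>)))) /\<^sub>R (2 * h)"
      by (simp only: Bochner_Integration.integral_diff[OF int int, symmetric] e)
    also have "\<dots> = (CLINT \<omega>|M. (\<i> * of_real (sin (h * X \<omega>) / h)) ^ Suc n * exp (\<i> * of_real (s * X \<omega>)))"
      unfolding integral_mult_right_zero using h by (simp only: scaleR_conv_of_real mult.assoc[symmetric] of_real_mult[symmetric]) simp
    finally show "(cdiff h ^^ Suc n) (\<lambda>s. CLINT \<omega>|M. exp (\<i> * of_real (s * X \<omega>))) s =
      (CLINT \<omega>|M. (\<i> * of_real (sin (h * X \<omega>) / h)) ^ Suc n * exp (\<i> * of_real (s * X \<omega>)))" .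
  qed
qed simp

text \<open>Fatou's lemma for the quotients \<open>(sin (h X) / h)\<^sup>2\<^sup>k\<close> as \<open>h \<rightarrow> 0\<close>.\<close>

lemma (in prob_space) even_moment_le:
  assumes X: "random_variable borel X" and h0: "0 < h0"
    and B: "\<And>h. 0 < h \<Longrightarrow> h \<le> h0 \<Longrightarrow> norm ((cdiff h ^^ (2 * k)) (\<lambda>s. CLINT \<omega>|M. exp (\<i> * of_real (s * X \<omega>))) 0) \<le> B"
  shows "(\<integral>\<^sup>+\<omega>. ennreal (X \<omega> ^ (2 * k)) \<partial>M) \<le> ennreal B"
proof -
  note [measurable] = X
  let ?Y = "\<lambda>h \<omega>. (sin (h * X \<omega>) / h) ^ (2 * k)"
  have le: "(\<integral>\<^sup>+\<omega>. ennreal (?Y h \<omega>) \<partial>M) \<le> ennreal B" if h: "0 < h" "h \<le> h0" for h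
  proof -
    have int: "integrable M (?Y h)"
    proof (rule integrable_const_bound[where B = "(1 / h) ^ (2 * k)"])
      have "\<bar>sin (h * X \<omega>) / h\<bar> ^ (2 * k) \<le> (1 / h) ^ (2 * k)" for \<omega>
        using h by (intro power_mono) (simp_all add: divide_right_mono)
      then show "AE \<omega> in M. norm (?Y h \<omega>) \<le> (1 / h) ^ (2 * k)" by (simp add: power_abs)
    qed measurable
    have "(cdiff h ^^ (2 * k)) (\<lambda>s. CLINT \<omega>|M. exp (\<i> * of_real (s * X \<omega>))) 0 =
      (CLINT \<omega>|M. (- 1) ^ k * of_real (?Y h \<omega>))"
      unfolding cdiff_power_char[OF X h(1)] power_mult_distrib power_mult[of \<i> 2 k] i_squared
      by (simp del: of_real_divide of_real_power add: of_real_power[symmetric])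
    also have "\<dots> = (- 1) ^ k * of_real (LINT \<omega>|M. ?Y h \<omega>)"
      by (simp only: integral_mult_right_zero integral_of_real[OF int])
    finally have "norm (of_real (LINT \<omega>|M. ?Y h \<omega>) :: complex) \<le> B"
      using B[OF h] by (simp add: norm_mult norm_power)
    then have "(LINT \<omega>|M. ?Y h \<omega>) \<le> B" by simp
    then show ?thesis
      by (subst nn_integral_eq_integral[OF int]) (auto simp: power_mult intro: ennreal_leI)
  qed
  let ?h = "\<lambda>n. h0 / real (Suc n)"
  have hn: "0 < ?h n" "?h n \<le> h0" for n using h0 by (simp_all add: field_simps)
  have lim: "(\<lambda>n. ?Y (?h n) \<omega>) \<longlonglongrightarrow> X \<omega> ^ (2 * k)" for \<omega>
  proof (intro tendsto_power)
    have "((\<lambda>h. sin (h * X \<omega>)) has_real_derivative X \<omega>) (at 0)"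
      by (auto intro!: derivative_eq_intros)
    from DERIV_D[OF this] have l: "((\<lambda>h. sin (h * X \<omega>) / h) \<longlongrightarrow> X \<omega>) (at 0)" by simp
    have "?h \<longlonglongrightarrow> 0" by real_asymp
    then have "filterlim ?h (at 0) sequentially"
      using hn by (auto simp: filterlim_at intro!: always_eventually)
    from filterlim_compose[OF l this] show "(\<lambda>n. sin (?h n * X \<omega>) / ?h n) \<longlonglongrightarrow> X \<omega>" .
  qed
  have "(\<integral>\<^sup>+\<omega>. ennreal (X \<omega> ^ (2 * k)) \<partial>M) = (\<integral>\<^sup>+\<omega>. liminf (\<lambda>n. ennreal (?Y (?h n) \<omega>)) \<partial>M)"
  proof (rule nn_integral_cong)
    fix \<omega>
    have "(\<lambda>n. ennreal (?Y (?h n) \<omega>)) \<longlonglongrightarrow> ennreal (X \<omega> ^ (2 * k))" using lim by (rule tendsto_ennrealI)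
    then show "ennreal (X \<omega> ^ (2 * k)) = liminf (\<lambda>n. ennreal (?Y (?h n) \<omega>))"
      by (intro lim_imp_Liminf[symmetric]) auto
  qed
  also have "\<dots> \<le> liminf (\<lambda>n. \<integral>\<^sup>+\<omega>. ennreal (?Y (?h n) \<omega>) \<partial>M)"
    by (rule nn_integral_liminf) measurable
  also have "\<dots> \<le> ennreal B"
    by (rule order_trans[OF Liminf_le_Limsup Limsup_bounded], simp, rule always_eventually, rule allI, rule le[OF hn])
  finally show ?thesis .
qed

text \<open>The derivatives of \<open>exp L\<close> are sums of products of \<open>exp L\<close> with derivatives of \<open>L\<close>; terms
  record the shape of such an expression, so that bounds depend on \<open>L\<close> only through bounds on
  its derivatives.\<close>

datatype exp_term = Exp_T | Mult_T nat exp_term | Add_T exp_term exp_term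

primrec term_val :: "(nat \<Rightarrow> real \<Rightarrow> complex) \<Rightarrow> exp_term \<Rightarrow> real \<Rightarrow> complex" where
  "term_val L Exp_T = (\<lambda>s. exp (L 0 s))"
| "term_val L (Mult_T j t) = (\<lambda>s. L (Suc j) s * term_val L t s)"
| "term_val L (Add_T t u) = (\<lambda>s. term_val L t s + term_val L u s)"

primrec term_deriv :: "exp_term \<Rightarrow> exp_term" where
  "term_deriv Exp_T = Mult_T 0 Exp_T"
| "term_deriv (Mult_T j t) = Add_T (Mult_T (Suc j) t) (Mult_T j (term_deriv t))"
| "term_deriv (Add_T t u) = Add_T (term_deriv t) (term_deriv u)"

primrec term_bound :: "(nat \<Rightarrow> real) \<Rightarrow> real \<Rightarrow> exp_term \<Rightarrow> real" where
  "term_bound c K Exp_T = 1"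
| "term_bound c K (Mult_T j t) = c j * K * term_bound c K t"
| "term_bound c K (Add_T t u) = term_bound c K t + term_bound c K u"

text \<open>The companion of \<open>term_bound\<close> that leaves one factor
  \<open>\<kappa>\<close> outside: one derivative of \<open>L\<close> is bounded by a multiple of
  \<open>\<kappa>\<close>, all others with \<open>\<kappa>\<close> replaced by \<open>K\<close>. It
  is the source of the linear dependence of the moments on the L1 norm.\<close>

primrec term_bound1 :: "(nat \<Rightarrow> real) \<Rightarrow> real \<Rightarrow> exp_term \<Rightarrow> real" where
  "term_bound1 c K Exp_T = 0"
| "term_bound1 c K (Mult_T j t) = c j * term_bound c K t"
| "term_bound1 c K (Add_T t u) = term_bound1 c K t + term_bound1 c K u"

primrec has_factor :: "exp_term \<Rightarrow> bool" where
  "has_factor Exp_T = False"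
| "has_factor (Mult_T j t) = True"
| "has_factor (Add_T t u) = (has_factor t \<and> has_factor u)"

lemma has_factor_term_deriv: "has_factor (term_deriv t)"
  by (induction t) auto

lemma term_val_deriv:
  assumes L: "\<And>j s. (L j has_vector_derivative L (Suc j) s) (at s)"
  shows "(term_val L t has_vector_derivative term_val L (term_deriv t) s) (at s)"
proof (induction t)
  case Exp_T
  have "((exp \<circ> L 0) has_vector_derivative (L (Suc 0) s * exp (L 0 s))) (at s)"
    by (rule field_vector_diff_chain_at[OF L DERIV_exp])
  then show ?case by (simp add: o_def)
next
  case (Mult_T j t)
  show ?case using has_vector_derivative_mult[OF L[of "Suc j" s] Mult_T] by (simp add: add.commute)
next
  case (Add_T t u)
  then show ?case by (simp add: has_vector_derivative_add)
qed

lemma term_val_bound: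
  assumes c: "\<And>j. 0 \<le> c j" and \<kappa>: "0 \<le> \<kappa>" "\<kappa> \<le> K"
    and L: "\<And>j. norm (L (Suc j) s) \<le> c j * \<kappa>" and E: "norm (exp (L 0 s)) \<le> 1"
  shows "norm (term_val L t s) \<le> term_bound c K t"
proof (induction t)
  case (Mult_T j t)
  have "norm (L (Suc j) s) \<le> c j * K"
    using L[of j] mult_left_mono[OF \<kappa>(2) c[of j]] by linarith
  then show ?case using Mult_T c \<kappa> by (simp add: norm_mult mult_mono)
next
  case (Add_T t u)
  then show ?case using norm_triangle_ineq[of "term_val L t s" "term_val L u s"] by simp
qed (use E in simp)

lemma term_val_bound1:
  assumes c: "\<And>j. 0 \<le> c j" and \<kappa>: "0 \<le> \<kappa>" "\<kappa> \<le> K"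
    and L: "\<And>j. norm (L (Suc j) s) \<le> c j * \<kappa>" and E: "norm (exp (L 0 s)) \<le> 1"
    and t: "has_factor t"
  shows "norm (term_val L t s) \<le> term_bound1 c K t * \<kappa>"
  using t
proof (induction t)
  case (Mult_T j t)
  have "norm (L (Suc j) s) * norm (term_val L t s) \<le> (c j * \<kappa>) * term_bound c K t"
    by (intro mult_mono L term_val_bound[where \<kappa> = \<kappa>] c \<kappa> E) (use c \<kappa> in auto)
  then show ?case by (simp add: norm_mult mult_ac)
next
  case (Add_T t u)
  then show ?case using norm_triangle_ineq[of "term_val L t s" "term_val L u s"] by (simp add: distrib_right)
qed simp

text \<open>A characteristic function has modulus at most one, so the factor
  \<open>exp (L 0 s)\<close> costs nothing, while every term of a derivative of positive order
  carries a derivative of \<open>L\<close> and hence a factor \<open>\<kappa>\<close>.\<close>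

lemma (in prob_space) even_moment_exp_char:
  assumes X: "random_variable borel X" and k: "0 < k"
    and char: "\<And>s. (CLINT \<omega>|M. exp (\<i> * of_real (s * X \<omega>))) = exp (L 0 s)"
    and L: "\<And>j s. (L j has_vector_derivative L (Suc j) s) (at s)"
    and c: "\<And>j. 0 \<le> c j" and \<kappa>: "0 \<le> \<kappa>" "\<kappa> \<le> K"
    and bnd: "\<And>j s. \<bar>s\<bar> \<le> 1 \<Longrightarrow> norm (L (Suc j) s) \<le> c j * \<kappa>"
  shows "(\<integral>\<^sup>+\<omega>. ennreal (X \<omega> ^ (2 * k)) \<partial>M) \<le> ennreal (term_bound1 c K ((term_deriv ^^ (2 * k)) Exp_T) * \<kappa>)"
proof (rule even_moment_le[OF X])
  note [measurable] = X
  \<comment> \<open>With steps of this size, \<open>2 * k\<close> symmetric differences about 0 stay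
    in the range where the bounds on \<open>L\<close> hold.\<close>
  show "0 < 1 / (2 * real k)" using k by simp
  fix h :: real assume h: "0 < h" "h \<le> 1 / (2 * real k)"
  have E: "norm (exp (L 0 s)) \<le> 1" for s
  proof -
    have "norm (CLINT \<omega>|M. exp (\<i> * of_real (s * X \<omega>))) \<le> (LINT \<omega>|M. norm (exp (\<i> * of_real (s * X \<omega>))))"
      by (rule integral_norm_bound)
    also have "\<dots> = 1" by (simp add: prob_space)
    finally show ?thesis unfolding char .
  qed
  let ?F = "\<lambda>n. term_val L ((term_deriv ^^ n) Exp_T)"
  have F0: "(\<lambda>s. CLINT \<omega>|M. exp (\<i> * of_real (s * X \<omega>))) = ?F 0"
    by (simp only: char funpow.simps id_apply term_val.simps)
  show "norm ((cdiff h ^^ (2 * k)) (\<lambda>s. CLINT \<omega>|M. exp (\<i> * of_real (s * X \<omega>))) 0) \<le>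
    term_bound1 c K ((term_deriv ^^ (2 * k)) Exp_T) * \<kappa>"
    unfolding F0
  proof (rule cdiff_power_bound[OF h(1), where R = 1])
    show "(?F j has_vector_derivative ?F (Suc j) s) (at s)" for j s
      using term_val_deriv[where L = L, OF L, of "(term_deriv ^^ j) Exp_T" s] by simp
    obtain m where m: "2 * k = Suc m" using k by (cases "2 * k") auto
    show "norm (?F (2 * k) s) \<le> term_bound1 c K ((term_deriv ^^ (2 * k)) Exp_T) * \<kappa>" if "\<bar>s\<bar> \<le> 1" for s
      by (rule term_val_bound1[where c = c and L = L, OF c \<kappa> bnd[OF that] E]) (simp add: m has_factor_term_deriv)
    show "\<bar>0\<bar> + real (2 * k) * h \<le> 1" using h k by (simp add: field_simps)
  qed
qed

section \<open>Derivatives and growth of the Levy characteristic\<close>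

locale levy_moments =
  fixes a v :: real and M :: "real measure"
  assumes v: "0 \<le> v" and levy: "levy_measure M"
    and moments: "\<And>n::nat. (\<integral>\<^sup>+ s. ennreal (s ^ (2 * n)) \<partial>M) < \<infinity>"
begin

lemma sets_M: "sets M = sets (restrict_space borel (UNIV - {0}))"
  using levy by (simp add: levy_measure_def)

lemma M_measurable: "f \<in> borel_measurable borel \<Longrightarrow> f \<in> borel_measurable M"
  by (subst measurable_cong_sets[OF sets_M refl]) (rule measurable_restrict_space1)

lemma integrable_power: "integrable M (\<lambda>s. \<bar>s\<bar> ^ j)"
proof (rule Bochner_Integration.integrable_bound)
  have i: "integrable M (\<lambda>s. s ^ (2 * n))" for n
    by (rule integrableI_bounded)
      (use moments[of n] in \<open>auto simp: power_mult intro!: M_measurable\<close>)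
  \<comment> \<open>The summand with exponent \<open>2 * 0\<close> is the constant one; its
    integrability is the moment of order zero, that is, finiteness of \<open>M\<close>.\<close>
  show "integrable M (\<lambda>s. s ^ (2 * 0) + s ^ (2 * j))" by (intro Bochner_Integration.integrable_add i)
  show "(\<lambda>s. \<bar>s\<bar> ^ j) \<in> borel_measurable M" by (rule M_measurable) measurable
  have "\<bar>s\<bar> ^ j \<le> 1 + s ^ (2 * j)" for s :: real
    by (rule abs_power_le) simp
  then show "AE s in M. norm (\<bar>s\<bar> ^ j) \<le> norm (s ^ (2 * 0) + s ^ (2 * j))"
    by (intro AE_I2) (simp add: power_mult)
qed

text \<open>The j-th derivative in \<open>t\<close> of the integrand of \<open>levy_char\<close>.
  The compensating term is affine in \<open>t\<close> and contributes only to orders 0 and 1;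
  \<open>drift\<close> treats the remaining terms in the same way, and \<open>psi j\<close> becomes
  the j-th derivative of the characteristic.\<close>

definition kern :: "nat \<Rightarrow> real \<Rightarrow> real \<Rightarrow> complex" where
  "kern j t s = (\<i> * of_real s) ^ j * exp (\<i> * of_real (s * t)) -
    (if j = 0 then 1 + \<i> * of_real (s * t / (1 + s\<^sup>2)) else if j = 1 then \<i> * of_real (s / (1 + s\<^sup>2)) else 0)"

definition drift :: "nat \<Rightarrow> real \<Rightarrow> complex" where
  "drift j t = (if j = 0 then \<i> * of_real (a * t) - of_real (v * t\<^sup>2 / 2)
     else if j = 1 then \<i> * of_real a - of_real (v * t) else if j = 2 then - of_real v else 0)"

definition psi :: "nat \<Rightarrow> real \<Rightarrow> complex" where
  "psi j t = drift j t + (CLINT s|M. kern j t s)"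

lemma psi_0: "psi 0 = levy_char a v M"
  by (simp add: psi_def drift_def kern_def levy_char_def fun_eq_iff diff_diff_add)

lemma kern_measurable: "kern j t \<in> borel_measurable M"
proof (rule M_measurable)
  show "kern j t \<in> borel_measurable borel" unfolding kern_def[abs_def] by measurable
qed

lemma abs_div_le: "\<bar>s / (1 + s\<^sup>2)\<bar> \<le> \<bar>s\<bar>" for s :: real
proof -
  have p: "0 < 1 + s\<^sup>2" by (simp add: add_pos_nonneg)
  then have "\<bar>s\<bar> / (1 + s\<^sup>2) \<le> \<bar>s\<bar> / 1" by (intro divide_left_mono) auto
  then show ?thesis using p by (simp add: abs_divide)
qed

lemma kern_bound: "norm (kern j t s) \<le> \<bar>s\<bar> ^ j + (1 + (1 + \<bar>t\<bar>) * \<bar>s\<bar>)"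
proof -
  let ?r = "if j = 0 then 1 + \<i> * of_real (s * t / (1 + s\<^sup>2)) else if j = 1 then \<i> * of_real (s / (1 + s\<^sup>2)) else 0"
  have "\<bar>s * t / (1 + s\<^sup>2)\<bar> \<le> \<bar>s\<bar> * \<bar>t\<bar>"
    using mult_right_mono[OF abs_div_le[of s], of "\<bar>t\<bar>"] by (simp add: abs_mult)
  then have "norm (1 + \<i> * of_real (s * t / (1 + s\<^sup>2)) :: complex) \<le> 1 + \<bar>s\<bar> * \<bar>t\<bar>"
    by (intro order_trans[OF norm_triangle_ineq]) (simp add: norm_mult del: of_real_divide of_real_mult of_real_add)
  moreover have "norm (\<i> * of_real (s / (1 + s\<^sup>2)) :: complex) \<le> \<bar>s\<bar>"
    using abs_div_le[of s] by (simp add: norm_mult del: of_real_divide of_real_add)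
  moreover have "0 \<le> \<bar>s\<bar> * \<bar>t\<bar>" by simp
  moreover have "1 + (1 + \<bar>t\<bar>) * \<bar>s\<bar> = 1 + \<bar>s\<bar> + \<bar>s\<bar> * \<bar>t\<bar>" by (simp add: algebra_simps)
  moreover have "norm (0 :: complex) \<le> \<bar>s\<bar>" by simp
  ultimately have r: "norm ?r \<le> 1 + (1 + \<bar>t\<bar>) * \<bar>s\<bar>"
    by (cases "j = 0"; cases "j = 1"; simp only: if_True if_False simp_thms one_neq_zero refl) linarith+
  have "norm ((\<i> * of_real s) ^ j * exp (\<i> * of_real (s * t)) :: complex) = \<bar>s\<bar> ^ j"
    by (simp add: norm_mult norm_power del: of_real_mult)
  with r show ?thesis unfolding kern_def
    by (intro order_trans[OF norm_triangle_ineq4]) simp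
qed

text \<open>In contrast to \<open>kern_bound\<close> this is uniform in \<open>t\<close>, as
  required of a dominating function for differentiation under the integral.\<close>

lemma kern_bound_Suc: "norm (kern (Suc j) t s) \<le> \<bar>s\<bar> ^ Suc j + \<bar>s\<bar>"
proof -
  have "norm ((\<i> * of_real s) ^ Suc j * exp (\<i> * of_real (s * t)) :: complex) = \<bar>s\<bar> ^ Suc j"
    by (simp add: norm_mult norm_power del: of_real_mult)
  moreover have "norm (if Suc j = 1 then \<i> * of_real (s / (1 + s\<^sup>2)) else 0 :: complex) \<le> \<bar>s\<bar>"
    using abs_div_le[of s] by (simp add: norm_mult del: of_real_divide of_real_add)
  ultimately show ?thesis unfolding kern_def
    by (intro order_trans[OF norm_triangle_ineq4]) simp
qed

lemma kern_integrable: "integrable M (kern j t)"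
proof (rule Bochner_Integration.integrable_bound[OF _ kern_measurable])
  show "integrable M (\<lambda>s. \<bar>s\<bar> ^ j + (\<bar>s\<bar> ^ 0 + (1 + \<bar>t\<bar>) * \<bar>s\<bar> ^ 1))"
    by (intro Bochner_Integration.integrable_add integrable_mult_right integrable_power)
  show "AE s in M. norm (kern j t s) \<le> norm (\<bar>s\<bar> ^ j + (\<bar>s\<bar> ^ 0 + (1 + \<bar>t\<bar>) * \<bar>s\<bar> ^ 1))"
    using kern_bound by (intro AE_I2) (simp add: order_trans[OF _ abs_ge_self])
qed

lemma kern_deriv: "((\<lambda>t. kern j t s) has_vector_derivative kern (Suc j) t s) (at t)"
proof -
  have 1: "((\<lambda>t. (\<i> * of_real s) ^ j * exp (\<i> * of_real s * of_real t)) has_vector_derivative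
    (\<i> * of_real s) ^ Suc j * exp (\<i> * of_real s * of_real t)) (at t)"
  proof (rule has_vector_derivative_real_field)
    show "((\<lambda>z. (\<i> * of_real s) ^ j * exp (\<i> * of_real s * z)) has_field_derivative
      (\<i> * of_real s) ^ Suc j * exp (\<i> * of_real s * of_real t)) (at (of_real t))"
      by (auto intro!: derivative_eq_intros)
  qed
  have 2: "((\<lambda>t. if j = 0 then 1 + \<i> * of_real (s / (1 + s\<^sup>2)) * of_real t else if j = 1 then \<i> * of_real (s / (1 + s\<^sup>2)) else 0)
     has_vector_derivative (if Suc j = 1 then \<i> * of_real (s / (1 + s\<^sup>2)) else 0)) (at t)"
  proof (cases "j = 0")
    case True
    have "((\<lambda>t. 1 + c * of_real t) has_vector_derivative c) (at t)" for c :: complex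
      by (rule has_vector_derivative_real_field) (auto intro!: derivative_eq_intros)
    with True show ?thesis by (simp only: if_True refl One_nat_def)
  qed simp
  have e: "\<i> * of_real (s * t) = \<i> * of_real s * of_real t"
    "\<i> * of_real (s * t / (1 + s\<^sup>2)) = \<i> * of_real (s / (1 + s\<^sup>2)) * of_real t" for t
  proof -
    have "s * t / (1 + s\<^sup>2) = s / (1 + s\<^sup>2) * t" by simp
    then show "\<i> * of_real (s * t / (1 + s\<^sup>2)) = \<i> * of_real (s / (1 + s\<^sup>2)) * of_real t"
      by (simp only: of_real_mult mult.assoc)
  qed simp
  show ?thesis
    unfolding kern_def e using has_vector_derivative_diff[OF 1 2] by simp
qed

lemma drift_deriv: "(drift j has_vector_derivative drift (Suc j) t) (at t)"
proof -
  consider "j = 0" | "j = 1" | "2 \<le> j" by linarith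
  then show ?thesis
  proof cases
    case 1
    have "((\<lambda>t. \<i> * of_real a * of_real t - of_real v * (of_real t)\<^sup>2 / 2) has_vector_derivative \<i> * of_real a - of_real v * of_real t) (at t)"
      by (rule has_vector_derivative_real_field) (auto intro!: derivative_eq_intros)
    then show ?thesis using 1 by (simp add: drift_def[abs_def] mult.assoc)
  next
    case 2
    have "((\<lambda>t. \<i> * of_real a - of_real v * of_real t) has_vector_derivative - of_real v) (at t)"
      by (rule has_vector_derivative_real_field) (auto intro!: derivative_eq_intros)
    then show ?thesis using 2 by (simp add: drift_def[abs_def] numeral_2_eq_2)
  next
    case 3
    then have "drift j = (\<lambda>_. if j = 2 then - of_real v else 0)" "drift (Suc j) t = 0"
      by (auto simp: drift_def fun_eq_iff)
    then show ?thesis by simp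
  qed
qed

lemma psi_deriv: "(psi j has_vector_derivative psi (Suc j) t) (at t)"
proof -
  have "((\<lambda>t. CLINT s|M. kern j t s) has_vector_derivative (CLINT s|M. kern (Suc j) t s)) (at t)"
  proof (rule has_vector_derivative_lebesgue_integral(1)[where e = 1 and B = "\<lambda>s. \<bar>s\<bar> ^ Suc j + \<bar>s\<bar>"])
    show "integrable M (\<lambda>s. \<bar>s\<bar> ^ Suc j + \<bar>s\<bar>)"
      using integrable_power[of "Suc j"] integrable_power[of 1] by simp
  qed (use kern_integrable kern_deriv kern_bound_Suc in auto)
  then show ?thesis unfolding psi_def[abs_def] by (intro has_vector_derivative_add drift_deriv)
qed

definition psi_const :: "nat \<Rightarrow> real" where
  "psi_const j = \<bar>a\<bar> + v + (LINT s|M. \<bar>s\<bar> ^ j + \<bar>s\<bar>)"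

lemma psi_const_nonneg: "0 \<le> psi_const j"
  unfolding psi_const_def using v by (intro add_nonneg_nonneg integral_nonneg_AE) auto

text \<open>The linear growth comes from the Gaussian part of the first derivative; all other
  contributions are bounded in \<open>t\<close>.\<close>

lemma psi_bound: "norm (psi (Suc j) t) \<le> psi_const (Suc j) * (1 + \<bar>t\<bar>)"
proof -
  have "norm (drift (Suc j) t) \<le> \<bar>a\<bar> + v * \<bar>t\<bar> + v"
  proof -
    have "norm (\<i> * of_real a - of_real (v * t) :: complex) \<le> \<bar>a\<bar> + v * \<bar>t\<bar>"
      using v by (intro order_trans[OF norm_triangle_ineq4]) (simp add: norm_mult)
    then show ?thesis using v by (auto simp: drift_def add_increasing)
  qed
  also have "\<dots> \<le> (\<bar>a\<bar> + v) * (1 + \<bar>t\<bar>)" by (simp add: algebra_simps)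
  finally have 1: "norm (drift (Suc j) t) \<le> (\<bar>a\<bar> + v) * (1 + \<bar>t\<bar>)" .
  have "norm (CLINT s|M. kern (Suc j) t s) \<le> (LINT s|M. \<bar>s\<bar> ^ Suc j + \<bar>s\<bar>)"
  proof (rule Bochner_Integration.integral_norm_bound_integral)
    show "integrable M (\<lambda>s. \<bar>s\<bar> ^ Suc j + \<bar>s\<bar>)"
      using integrable_power[of "Suc j"] integrable_power[of 1] by simp
  qed (rule kern_integrable kern_bound_Suc)+
  also have "\<dots> \<le> (LINT s|M. \<bar>s\<bar> ^ Suc j + \<bar>s\<bar>) * (1 + \<bar>t\<bar>)"
  proof -
    have "0 \<le> (LINT s|M. \<bar>s\<bar> ^ Suc j + \<bar>s\<bar>)" by (intro integral_nonneg_AE) auto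
    from mult_left_mono[OF _ this, of 1 "1 + \<bar>t\<bar>"] show ?thesis by simp
  qed
  finally have "norm (CLINT s|M. kern (Suc j) t s) \<le> (LINT s|M. \<bar>s\<bar> ^ Suc j + \<bar>s\<bar>) * (1 + \<bar>t\<bar>)" .
  with 1 have "norm (drift (Suc j) t) + norm (CLINT s|M. kern (Suc j) t s) \<le> psi_const (Suc j) * (1 + \<bar>t\<bar>)"
    unfolding psi_const_def by (simp add: distrib_right)
  then show ?thesis unfolding psi_def by (rule order_trans[OF norm_triangle_ineq])
qed

text \<open>The characteristic vanishes at 0, so the mean value inequality yields a factor
  \<open>\<bar>t\<bar>\<close>. It makes the characteristic of a bounded integrable function
  integrable.\<close>

lemma psi_0_bound: "norm (psi 0 t) \<le> psi_const 1 * (1 + \<bar>t\<bar>) * \<bar>t\<bar>"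
proof -
  have 0: "psi 0 0 = 0" by (simp add: psi_def drift_def kern_def)
  have b: "norm (psi (Suc 0) s) \<le> psi_const 1 * (1 + \<bar>t\<bar>)" if "\<bar>s\<bar> \<le> \<bar>t\<bar>" for s
    using psi_bound[of 0 s] mult_left_mono[OF _ psi_const_nonneg[of 1], of "1 + \<bar>s\<bar>" "1 + \<bar>t\<bar>"] that by simp
  show ?thesis
  proof (cases "0 \<le> t")
    case True
    have "norm (psi 0 t - psi 0 0) \<le> psi_const 1 * (1 + \<bar>t\<bar>) * (t - 0)"
      by (rule vector_derivative_bound[OF psi_deriv b]) (use True in auto)
    with 0 True show ?thesis by simp
  next
    case False
    have "norm (psi 0 0 - psi 0 t) \<le> psi_const 1 * (1 + \<bar>t\<bar>) * (0 - t)"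
      by (rule vector_derivative_bound[OF psi_deriv b]) (use False in auto)
    with 0 False show ?thesis by simp
  qed
qed

lemma psi_measurable [measurable]: "psi j \<in> borel_measurable borel"
  by (intro borel_measurable_continuous_onI continuous_at_imp_continuous_on ballI)
    (rule has_vector_derivative_continuous[OF psi_deriv])

end

section \<open>Moments of the noise\<close>

locale levy_noise = spacing + levy_moments +
  fixes P :: "('d::finite fn \<Rightarrow> real) measure"
  assumes noise: "levy_noise_law \<delta> (levy_char a v M) P"
begin

sublocale P: prob_space P
  using noise by (simp add: levy_noise_law_def)

lemma space_P: "space P = schwartz_dual \<delta>"
  using noise by (simp add: levy_noise_law_def)

lemma eval_measurable:
  assumes g: "g \<in> schwartz \<delta>"
  shows "(\<lambda>\<omega>. \<omega> g) \<in> borel_measurable P"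
proof (rule measurableI)
  fix B :: "real set" assume B: "B \<in> sets borel"
  have "{f \<in> space (Pi\<^sub>M {g} (\<lambda>_. borel)). f g \<in> B} \<in> sets (Pi\<^sub>M {g} (\<lambda>_. borel :: real measure))"
    using B by measurable
  then have "{\<omega> \<in> schwartz_dual \<delta>. restrict \<omega> {g} \<in> {f \<in> space (Pi\<^sub>M {g} (\<lambda>_. borel)). f g \<in> B}} \<in> cylinder_sets \<delta>"
    unfolding cylinder_sets_def using g by blast
  moreover have "{\<omega> \<in> schwartz_dual \<delta>. restrict \<omega> {g} \<in> {f \<in> space (Pi\<^sub>M {g} (\<lambda>_. borel)). f g \<in> B}} =
    (\<lambda>\<omega>. \<omega> g) -` B \<inter> space P"
    by (auto simp: space_P space_PiM)
  ultimately have "(\<lambda>\<omega>. \<omega> g) -` B \<inter> space P \<in> cylinder_sets \<delta>" by simp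
  moreover have "sets P = sigma_sets (schwartz_dual \<delta>) (cylinder_sets \<delta>)"
    using noise by (simp add: levy_noise_law_def)
  ultimately show "(\<lambda>\<omega>. \<omega> g) -` B \<inter> space P \<in> sets P" by auto
qed simp

text \<open>The j-th derivative in \<open>s\<close> of the exponent in the characteristic function
  of \<open>\<omega> g\<close>, obtained by differentiating under the integral.\<close>

definition log_char :: "'d fn \<Rightarrow> nat \<Rightarrow> real \<Rightarrow> complex" where
  "log_char g j s = (CLINT x|\<mu>. indicator (Gam_plus \<delta>) x *\<^sub>R (of_real (g x) ^ j * psi j (s * g x)))"

lemma log_char_0:
  assumes g: "g \<in> schwartz \<delta>"
  shows "(CLINT \<omega>|P. exp (\<i> * of_real (s * \<omega> g))) = exp (log_char g 0 s)"
proof -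
  have "(CLINT \<omega>|P. exp (\<i> * of_real (s * \<omega> g))) = (CLINT \<omega>|P. exp (\<i> * of_real (\<omega> (\<lambda>x. s * g x))))"
    using g by (intro Bochner_Integration.integral_cong) (auto simp: space_P schwartz_dual_def)
  also have "\<dots> = exp (CLINT x:Gam_plus \<delta>|\<mu>. levy_char a v M (s * g x))"
    using noise scale_schwartz[OF g, of s] unfolding levy_noise_law_def by blast
  finally show ?thesis by (simp add: log_char_def set_lebesgue_integral_def psi_0)
qed

lemma log_char_integrand_measurable:
  assumes "g \<in> schwartz \<delta>"
  shows "(\<lambda>x. indicator (Gam_plus \<delta>) x *\<^sub>R (of_real (g x) ^ j * psi j (s * g x))) \<in> borel_measurable \<mu>"
proof -
  note [measurable] = schwartz_measurable[OF assms]
  show ?thesis by measurable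
qed

text \<open>Of the \<open>Suc j\<close> factors \<open>g x\<close> one is kept and the others are
  bounded by \<open>K\<close>, so that integration leaves a multiple of the L1 norm of
  \<open>g\<close>.\<close>

lemma log_char_integrand_bound:
  assumes K: "\<bar>g x\<bar> \<le> K" and S: "\<bar>s\<bar> \<le> S"
  shows "norm (indicator (Gam_plus \<delta>) x *\<^sub>R (of_real (g x) ^ Suc j * psi (Suc j) (s * g x))) \<le>
    psi_const (Suc j) * (1 + S * K) * K ^ j * \<bar>g x\<bar>"
proof -
  have K0: "0 \<le> K" using K by linarith
  have "\<bar>s * g x\<bar> \<le> S * K" unfolding abs_mult using K S by (intro mult_mono) auto
  then have "psi_const (Suc j) * (1 + \<bar>s * g x\<bar>) \<le> psi_const (Suc j) * (1 + S * K)"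
    by (intro mult_left_mono psi_const_nonneg) simp
  with psi_bound[of j "s * g x"] have p: "norm (psi (Suc j) (s * g x)) \<le> psi_const (Suc j) * (1 + S * K)"
    by linarith
  have "norm (of_real (g x) ^ Suc j * psi (Suc j) (s * g x)) = \<bar>g x\<bar> * (\<bar>g x\<bar> ^ j * norm (psi (Suc j) (s * g x)))"
    by (simp add: norm_mult norm_power)
  also have "\<dots> \<le> \<bar>g x\<bar> * (K ^ j * (psi_const (Suc j) * (1 + S * K)))"
    using K K0 by (intro mult_left_mono mult_mono power_mono p) auto
  finally have f: "norm (of_real (g x) ^ Suc j * psi (Suc j) (s * g x)) \<le> psi_const (Suc j) * (1 + S * K) * K ^ j * \<bar>g x\<bar>"
    by (simp add: mult_ac)
  from f order_trans[OF norm_ge_zero f] show ?thesis by (simp add: indicator_def)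
qed

lemma log_char_integrable:
  assumes g: "g \<in> schwartz \<delta>"
  shows "integrable \<mu> (\<lambda>x. indicator (Gam_plus \<delta>) x *\<^sub>R (of_real (g x) ^ j * psi j (s * g x)))"
proof -
  define K where "K = schwartz_seminorm \<delta> 0 0 g"
  have K: "\<bar>g x\<bar> \<le> K" for x using schwartz_bounded[OF g, of 0 x] by (simp add: K_def)
  have K0: "0 \<le> K" using seminorm_nonneg[OF g] by (simp add: K_def)
  have gi: "integrable \<mu> (\<lambda>x. C * \<bar>g x\<bar>)" for C using rapid_integrable_0[OF schwartz_rapid[OF g]] by simp
  show ?thesis
  proof (cases j)
    case 0
    have f: "norm (psi 0 (s * g x)) \<le> psi_const 1 * (1 + \<bar>s\<bar> * K) * \<bar>s\<bar> * \<bar>g x\<bar>" for x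
    proof -
      have "\<bar>s * g x\<bar> \<le> \<bar>s\<bar> * K" unfolding abs_mult using K by (intro mult_left_mono) auto
      then have "psi_const 1 * (1 + \<bar>s * g x\<bar>) * \<bar>s * g x\<bar> \<le> psi_const 1 * (1 + \<bar>s\<bar> * K) * \<bar>s * g x\<bar>"
        by (intro mult_right_mono mult_left_mono psi_const_nonneg) auto
      with psi_0_bound[of "s * g x"] show ?thesis by (simp add: abs_mult mult.assoc)
    qed
    have b: "norm (indicator (Gam_plus \<delta>) x *\<^sub>R (of_real (g x) ^ j * psi j (s * g x))) \<le> psi_const 1 * (1 + \<bar>s\<bar> * K) * \<bar>s\<bar> * \<bar>g x\<bar>" for x
      using f[of x] order_trans[OF norm_ge_zero f[of x]] 0 by (simp add: indicator_def)
    show ?thesis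
      by (rule Bochner_Integration.integrable_bound[OF gi log_char_integrand_measurable[OF g]])
        (use b in \<open>auto intro!: AE_I2 order_trans[OF _ abs_ge_self]\<close>)
  next
    case (Suc i)
    show ?thesis unfolding Suc
      by (rule Bochner_Integration.integrable_bound[OF gi log_char_integrand_measurable[OF g]])
        (use log_char_integrand_bound[OF K order_refl] in \<open>auto intro!: AE_I2 order_trans[OF _ abs_ge_self]\<close>)
  qed
qed

lemma log_char_deriv:
  assumes g: "g \<in> schwartz \<delta>"
  shows "(log_char g j has_vector_derivative log_char g (Suc j) s) (at s)"
proof -
  define K where "K = schwartz_seminorm \<delta> 0 0 g"
  have K: "\<bar>g x\<bar> \<le> K" for x using schwartz_bounded[OF g, of 0 x] by (simp add: K_def)
  show ?thesis unfolding log_char_def[abs_def]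
  proof (rule has_vector_derivative_lebesgue_integral(1)[where e = 1 and
        B = "\<lambda>x. psi_const (Suc j) * (1 + (\<bar>s\<bar> + 1) * K) * K ^ j * \<bar>g x\<bar>"])
    show "integrable \<mu> (\<lambda>x. psi_const (Suc j) * (1 + (\<bar>s\<bar> + 1) * K) * K ^ j * \<bar>g x\<bar>)"
      using rapid_integrable_0[OF schwartz_rapid[OF g]] by simp
    fix u and x :: "'d point" assume u: "\<bar>u - s\<bar> < 1"
    show "norm (indicator (Gam_plus \<delta>) x *\<^sub>R (of_real (g x) ^ Suc j * psi (Suc j) (u * g x))) \<le>
      psi_const (Suc j) * (1 + (\<bar>s\<bar> + 1) * K) * K ^ j * \<bar>g x\<bar>"
      by (rule log_char_integrand_bound[OF K]) (use u in linarith)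
    have "((\<lambda>u. u * g x) has_vector_derivative g x) (at u)"
      unfolding has_real_derivative_iff_has_vector_derivative[symmetric] by (auto intro!: derivative_eq_intros)
    from vector_diff_chain_at[OF this psi_deriv[of j]]
    have "((\<lambda>u. psi j (u * g x)) has_vector_derivative of_real (g x) * psi (Suc j) (u * g x)) (at u)"
      by (simp add: o_def scaleR_conv_of_real)
    from has_vector_derivative_mult_right[OF this, of "of_real (g x) ^ j"]
    have "((\<lambda>u. of_real (g x) ^ j * psi j (u * g x)) has_vector_derivative of_real (g x) ^ Suc j * psi (Suc j) (u * g x)) (at u)"
      by (simp add: mult_ac)
    then show "((\<lambda>u. indicator (Gam_plus \<delta>) x *\<^sub>R (of_real (g x) ^ j * psi j (u * g x))) has_vector_derivative
      indicator (Gam_plus \<delta>) x *\<^sub>R (of_real (g x) ^ Suc j * psi (Suc j) (u * g x))) (at u)"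
      by (rule bounded_linear.has_vector_derivative[OF bounded_linear_scaleR_right])
  qed (use log_char_integrable[OF g] in auto)
qed

lemma log_char_bound:
  assumes g: "g \<in> schwartz \<delta>" and K: "\<And>x. \<bar>g x\<bar> \<le> K" and s: "\<bar>s\<bar> \<le> 1"
  shows "norm (log_char g (Suc j) s) \<le> psi_const (Suc j) * (1 + 1 * K) * K ^ j * (LINT x|\<mu>. \<bar>g x\<bar>)"
proof -
  have "norm (log_char g (Suc j) s) \<le> (LINT x|\<mu>. psi_const (Suc j) * (1 + 1 * K) * K ^ j * \<bar>g x\<bar>)"
    unfolding log_char_def
  proof (rule Bochner_Integration.integral_norm_bound_integral[OF log_char_integrable[OF g]])
    show "integrable \<mu> (\<lambda>x. psi_const (Suc j) * (1 + 1 * K) * K ^ j * \<bar>g x\<bar>)"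
      using rapid_integrable_0[OF schwartz_rapid[OF g]] by simp
  qed (rule log_char_integrand_bound[OF K s])
  then show ?thesis by simp
qed

text \<open>The general moment bound with the L1 norm of \<open>g\<close> as
  \<open>\<kappa>\<close>. The same \<open>K\<close> bounds the sup norm and the L1 norm, and the
  resulting constant depends on \<open>g\<close> through \<open>K\<close> alone.\<close>

theorem noise_moment_bound:
  assumes k: "0 < k"
  shows "\<exists>C\<ge>0. \<forall>g\<in>schwartz \<delta>. (\<forall>x. \<bar>g x\<bar> \<le> K) \<longrightarrow> (LINT x|\<mu>. \<bar>g x\<bar>) \<le> K \<longrightarrow>
    (\<integral>\<^sup>+\<omega>. ennreal (\<omega> g ^ (2 * k)) \<partial>P) \<le> ennreal (C * (LINT x|\<mu>. \<bar>g x\<bar>))"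
proof (cases "0 \<le> K")
  case True
  define c where "c j = psi_const (Suc j) * (1 + 1 * K) * K ^ j" for j
  have c: "0 \<le> c j" for j unfolding c_def using True psi_const_nonneg[of "Suc j"] by simp
  let ?C = "term_bound1 c K ((term_deriv ^^ (2 * k)) Exp_T)"
  \<comment> \<open>The sign of \<open>?C\<close> is not tracked, hence the truncation at 0.\<close>
  show ?thesis
  proof (intro exI[of _ "max 0 ?C"] conjI ballI impI)
    fix g :: "'d fn" assume g: "g \<in> schwartz \<delta>" and K: "\<forall>x. \<bar>g x\<bar> \<le> K" and L1: "(LINT x|\<mu>. \<bar>g x\<bar>) \<le> K"
    have n: "0 \<le> (LINT x|\<mu>. \<bar>g x\<bar>)" by simp
    have "(\<integral>\<^sup>+\<omega>. ennreal (\<omega> g ^ (2 * k)) \<partial>P) \<le> ennreal (?C * (LINT x|\<mu>. \<bar>g x\<bar>))"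
      by (rule P.even_moment_exp_char[OF eval_measurable[OF g] k log_char_0[OF g] log_char_deriv[OF g] c n L1])
        (unfold c_def, rule log_char_bound[OF g], use K in auto)
    also have "\<dots> \<le> ennreal (max 0 ?C * (LINT x|\<mu>. \<bar>g x\<bar>))"
      using n by (intro ennreal_leI mult_right_mono) auto
    finally show "(\<integral>\<^sup>+\<omega>. ennreal (\<omega> g ^ (2 * k)) \<partial>P) \<le> ennreal (max 0 ?C * (LINT x|\<mu>. \<bar>g x\<bar>))" .
  qed simp
next
  case False
  then show ?thesis by (intro exI[of _ 0]) (auto dest: order_trans[OF abs_ge_zero])
qed

end

section \<open>The random field\<close>

context spacing begin

lemma conv_shift:
  assumes "x \<in> Gam \<delta>"
  shows "conv (shift x r) H = shift x (conv r H)"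
proof
  fix z
  have e: "z - u - x = z - x - u" for u by simp
  show "conv (shift x r) H z = shift x (conv r H) z"
    using Gam_diff_iff[OF assms, of z] by (simp add: conv_def shift_def e)
qed

lemma integral_abs_shift:
  assumes "g \<in> borel_measurable \<mu>" "x \<in> Gam \<delta>"
  shows "(LINT z|\<mu>. \<bar>shift x g z\<bar>) = (LINT z|\<mu>. \<bar>g z\<bar>)"
  using integral_shift[of "\<lambda>z. \<bar>g z\<bar>" "- x"] assms by (auto simp: shift_def)

text \<open>In the time variable \<open>x \<mapsto> T (shift x r)\<close> is continuous, hence a limit of functions
  that are constant on the intervals \<open>[i/n, (i+1)/n)\<close>.\<close>

lemma shift_eval_measurable:
  fixes Q :: "'e measure" and r :: "'d::finite fn"
  assumes T: "\<And>\<omega>. \<omega> \<in> space Q \<Longrightarrow> tempered (T \<omega>)" and r: "r \<in> schwartz \<delta>"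
    and m: "\<And>x. x \<in> Gam \<delta> \<Longrightarrow> (\<lambda>\<omega>. T \<omega> (shift x r)) \<in> borel_measurable Q"
  shows "(\<lambda>p. T (fst p) (shift (snd p) r)) \<in> borel_measurable (Q \<Otimes>\<^sub>M \<mu>)"
proof -
  let ?t = "\<lambda>n t. of_int \<lfloor>real (Suc n) * t\<rfloor> / real (Suc n)"
  let ?f = "\<lambda>n p. T (fst p) (shift (?t n (fst (snd p)), snd (snd p)) r)"
  have sn: "(\<lambda>p. snd (snd p)) \<in> Q \<Otimes>\<^sub>M \<mu> \<rightarrow>\<^sub>M count_space (lattice \<delta> :: (real^'d) set)"
    by (rule measurable_compose[OF measurable_snd snd_measurable_count])
  have fs: "(\<lambda>p. \<lfloor>real (Suc n) * fst (snd p)\<rfloor>) \<in> Q \<Otimes>\<^sub>M (\<mu> :: 'd point measure) \<rightarrow>\<^sub>M count_space UNIV" for n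
    using measurable_compose[OF measurable_snd[of Q "\<mu> :: 'd point measure"] fst_measurable] by measurable
  have "?f n \<in> borel_measurable (Q \<Otimes>\<^sub>M \<mu>)" for n
  proof (rule measurable_compose_countable'[where I = "lattice \<delta>" and g = "\<lambda>p :: 'e \<times> 'd point. snd (snd p)"
        and f = "\<lambda>y (p :: 'e \<times> 'd point). T (fst p) (shift (?t n (fst (snd p)), y) r)", OF _ sn countable_lattice])
    fix y :: "real^'d" assume y: "y \<in> lattice \<delta>"
    have m': "(\<lambda>p. T (fst p) (shift (of_int i / real (Suc n), y) r)) \<in> borel_measurable (Q \<Otimes>\<^sub>M (\<mu> :: 'd point measure))" for i :: int
    proof -
      have "(of_int i / real (Suc n), y) \<in> Gam \<delta>" using y by (simp add: Gam_iff)
      from measurable_compose[OF measurable_fst m[OF this]] show ?thesis .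
    qed
    from measurable_compose_countable[where f = "\<lambda>(i :: int) (p :: 'e \<times> 'd point). T (fst p) (shift (of_int i / real (Suc n), y) r)", OF m' fs[of n]]
    show "(\<lambda>p. T (fst p) (shift (?t n (fst (snd p)), y) r)) \<in> borel_measurable (Q \<Otimes>\<^sub>M (\<mu> :: 'd point measure))" .
  qed
  moreover have "(\<lambda>n. ?f n p) \<longlonglongrightarrow> T (fst p) (shift (snd p) r)" if p: "p \<in> space (Q \<Otimes>\<^sub>M (\<mu> :: 'd point measure))" for p
  proof -
    obtain \<omega> t y where p': "p = (\<omega>, t, y)" by (metis prod.exhaust)
    have \<omega>: "\<omega> \<in> space Q" and y: "y \<in> lattice \<delta>" using p by (auto simp: p' space_pair_measure Gam_iff)
    have "(\<lambda>n. ?t n t) \<longlonglongrightarrow> t"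
    proof (rule real_tendsto_sandwich[of "\<lambda>n. t - 1 / real (Suc n)" _ _ "\<lambda>_. t"])
      have "t - 1 / real (Suc n) \<le> ?t n t" for n
      proof -
        have "t - 1 / real (Suc n) = (real (Suc n) * t - 1) / real (Suc n)"
          by (simp add: diff_divide_distrib del: of_nat_Suc)
        also have "\<dots> \<le> ?t n t" by (rule divide_right_mono) linarith+
        finally show ?thesis .
      qed
      moreover have "?t n t \<le> t" for n
      proof -
        have "?t n t \<le> (real (Suc n) * t) / real (Suc n)" by (rule divide_right_mono) linarith+
        also have "\<dots> = t" by (simp del: of_nat_Suc)
        finally show ?thesis .
      qed
      ultimately show "\<forall>\<^sub>F n in sequentially. t - 1 / real (Suc n) \<le> ?t n t" "\<forall>\<^sub>F n in sequentially. ?t n t \<le> t"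
        by (simp_all only: eventually_True)
      show "(\<lambda>n. t - 1 / real (Suc n)) \<longlonglongrightarrow> t" by real_asymp
    qed simp
    from isCont_tendsto_compose[OF shift_tempered_continuous[OF T[OF \<omega>] r y] this]
    show ?thesis by (simp add: p')
  qed
  ultimately show ?thesis by (rule borel_measurable_LIMSEQ_metric)
qed

end

text \<open>A linear substitute for the Cauchy-Schwarz inequality: with \<open>c\<close> of the size
  of an L2 norm, integration bounds the first absolute moment by a multiple of that norm.\<close>

lemma abs_le_add_square_div: "0 < c \<Longrightarrow> \<bar>u\<bar> \<le> c + u\<^sup>2 / c" for u c :: real
proof -
  assume c: "0 < c"
  show ?thesis
  proof (cases "\<bar>u\<bar> \<le> c")
    case True
    then show ?thesis using c by (simp add: add_increasing2)
  next
    case False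
    then have "c * \<bar>u\<bar> \<le> \<bar>u\<bar> * \<bar>u\<bar>" by (intro mult_right_mono) auto
    then have "\<bar>u\<bar> \<le> u\<^sup>2 / c" using c by (simp add: pos_le_divide_eq power2_eq_square mult.commute)
    then show ?thesis using c by linarith
  qed
qed

section \<open>The mollified field, its kernels and its moments\<close>

locale noise_field = green_fn \<delta> m0 + levy_noise \<delta> a v M P
  for \<delta> m0 a v :: real and M :: "real measure" and P :: "('d::finite fn \<Rightarrow> real) measure"
begin

text \<open>The random distribution \<open>G * \<eta>\<close> in a form to which
  \<open>tempered_conv\<close> applies; on Schwartz functions it is
  \<open>conv_noise\<close>.\<close>

definition field :: "('d fn \<Rightarrow> real) \<Rightarrow> 'd fn \<Rightarrow> real" where
  "field \<omega> \<phi> = \<omega> (conv \<phi> rGreen)"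

definition field_approx :: "nat \<Rightarrow> ('d fn \<Rightarrow> real) \<Rightarrow> 'd fn" where
  "field_approx n \<omega> x = field \<omega> (shift x (moll n))"

text \<open>A smooth replacement of the reflected Green function, and therefore a legitimate
  argument of the noise. Its translate by \<open>x\<close> is the kernel of
  \<open>field_approx n\<close> at \<open>x\<close>.\<close>

definition kernel :: "nat \<Rightarrow> 'd fn" where
  "kernel n = conv (moll n) rGreen"

definition kernel_err :: "nat \<Rightarrow> real" where
  "kernel_err n = (LINT z|\<mu>. \<bar>kernel n z - rGreen z\<bar>)"

lemma field_tempered: "\<omega> \<in> space P \<Longrightarrow> tempered (field \<omega>)"
  unfolding field_def by (intro tempered_conv dual_tempered rGreen_rapid) (simp add: space_P)

lemma kernel_schwartz: "kernel n \<in> schwartz \<delta>"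
  unfolding kernel_def by (intro conv_schwartz moll_schwartz rGreen_rapid)

lemma field_approx_eq: "x \<in> Gam \<delta> \<Longrightarrow> field_approx n \<omega> x = \<omega> (shift x (kernel n))"
  by (simp add: field_approx_def field_def kernel_def conv_shift)

lemma field_approx_measurable: "(\<lambda>p. field_approx n (fst p) (snd p)) \<in> borel_measurable (P \<Otimes>\<^sub>M \<mu>)"
  unfolding field_approx_def
proof (rule shift_eval_measurable[OF field_tempered moll_schwartz])
  fix x :: "'d point" assume x: "x \<in> Gam \<delta>"
  have "conv (shift x (moll n)) rGreen \<in> schwartz \<delta>"
    by (intro conv_schwartz shift_schwartz moll_schwartz rGreen_rapid x)
  then show "(\<lambda>\<omega>. field \<omega> (shift x (moll n))) \<in> borel_measurable P"
    unfolding field_def by (rule eval_measurable)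
qed

lemma field_approx_measurable_at:
  assumes "x \<in> Gam \<delta>"
  shows "(\<lambda>\<omega>. field_approx n \<omega> x) \<in> borel_measurable P"
  using measurable_Pair1[of "\<lambda>p. field_approx n (fst p) (snd p)" P \<mu> borel x] field_approx_measurable assms by simp

lemma kernel_err_tendsto: "kernel_err \<longlonglongrightarrow> 0"
proof -
  have i: "integrable \<mu> (\<lambda>z. \<bar>kernel n z - rGreen z\<bar>)" for n
    by (intro integrable_abs Bochner_Integration.integrable_diff rapid_integrable_0 schwartz_rapid kernel_schwartz rGreen_rapid)
  have "(\<lambda>n. \<integral>\<^sup>+z. ennreal \<bar>kernel n z - rGreen z\<bar> \<partial>\<mu>) \<longlonglongrightarrow> 0"
    unfolding kernel_def by (rule conv_moll_L1[OF rGreen_rapid rGreen_bound rGreen_isCont])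
  moreover have "(\<integral>\<^sup>+z. ennreal \<bar>kernel n z - rGreen z\<bar> \<partial>\<mu>) = ennreal (kernel_err n)" for n
    unfolding kernel_err_def by (rule nn_integral_eq_integral[OF i]) simp
  ultimately have "(\<lambda>n. ennreal (kernel_err n)) \<longlonglongrightarrow> ennreal 0" by simp
  then show ?thesis by (rule tendsto_ennrealD) (auto simp: kernel_err_def)
qed

definition green_sup :: real where
  "green_sup = vol TYPE('d) / (2 * pi) ^ CARD('d)"

lemma kernel_bound: "\<bar>kernel n z\<bar> \<le> green_sup"
  unfolding kernel_def green_sup_def by (rule conv_moll_abs_le[OF rGreen_measurable rGreen_bound])

definition green_L1 :: real where
  "green_L1 = (LINT z|\<mu>. \<bar>(rGreen :: 'd fn) z\<bar>)"

lemma kernel_L1: "(LINT z|\<mu>. \<bar>kernel n z\<bar>) \<le> green_L1"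
proof -
  have "ennreal (LINT z|\<mu>. \<bar>kernel n z\<bar>) = (\<integral>\<^sup>+z. ennreal \<bar>kernel n z\<bar> \<partial>\<mu>)"
    by (intro nn_integral_eq_integral[symmetric] integrable_abs rapid_integrable_0 schwartz_rapid kernel_schwartz) simp
  also have "\<dots> \<le> (\<integral>\<^sup>+z. ennreal \<bar>(rGreen :: 'd fn) z\<bar> \<partial>\<mu>)"
    unfolding kernel_def by (rule nn_integral_conv_moll_le[OF rGreen_measurable rGreen_bound])
  also have "\<dots> = ennreal green_L1" unfolding green_L1_def
    by (intro nn_integral_eq_integral integrable_abs rapid_integrable_0 rGreen_rapid) simp
  finally show ?thesis by (subst (asm) ennreal_le_iff) (simp_all add: green_L1_def)
qed

lemma kernel_diff_L1: "(LINT z|\<mu>. \<bar>kernel m z - kernel n z\<bar>) \<le> kernel_err m + kernel_err n"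
proof -
  note i = rapid_integrable_0[OF schwartz_rapid[OF kernel_schwartz]] rapid_integrable_0[OF rGreen_rapid]
  have "(LINT z|\<mu>. \<bar>kernel m z - kernel n z\<bar>) \<le> (LINT z|\<mu>. \<bar>kernel m z - rGreen z\<bar> + \<bar>kernel n z - rGreen z\<bar>)"
    by (intro integral_mono Bochner_Integration.integrable_add integrable_abs Bochner_Integration.integrable_diff i) linarith
  also have "\<dots> = kernel_err m + kernel_err n"
    unfolding kernel_err_def
    by (intro Bochner_Integration.integral_add integrable_abs Bochner_Integration.integrable_diff i)
  finally show ?thesis .
qed

text \<open>Translation changes neither the sup norm nor the L1 norm of a kernel, and both are
  bounded in \<open>n\<close>; so the constant of \<open>noise_moment_bound\<close> serves all
  points and all \<open>n\<close>.\<close>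

lemma approx_moment_bound:
  assumes k: "0 < k"
  shows "\<exists>B\<ge>0. \<forall>n. \<forall>x\<in>Gam \<delta>. (\<integral>\<^sup>+\<omega>. ennreal (field_approx n \<omega> x ^ (2 * k)) \<partial>P) \<le> ennreal B"
proof -
  define K where "K = max green_sup green_L1"
  obtain C where C: "0 \<le> C" "\<And>g. g \<in> schwartz \<delta> \<Longrightarrow> (\<forall>x. \<bar>g x\<bar> \<le> K) \<Longrightarrow> (LINT x|\<mu>. \<bar>g x\<bar>) \<le> K \<Longrightarrow>
    (\<integral>\<^sup>+\<omega>. ennreal (\<omega> g ^ (2 * k)) \<partial>P) \<le> ennreal (C * (LINT x|\<mu>. \<bar>g x\<bar>))"
    using noise_moment_bound[OF k, of K] by blast
  have K0: "0 \<le> K" using order_trans[OF abs_ge_zero kernel_bound[of 0 0]] by (simp add: K_def le_max_iff_disj)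
  have "(\<integral>\<^sup>+\<omega>. ennreal (field_approx n \<omega> x ^ (2 * k)) \<partial>P) \<le> ennreal (C * K)" if x: "x \<in> Gam \<delta>" for n x
  proof -
    have L: "(LINT z|\<mu>. \<bar>shift x (kernel n) z\<bar>) \<le> K"
      unfolding integral_abs_shift[OF schwartz_measurable[OF kernel_schwartz] x] using kernel_L1[of n] by (simp add: K_def)
    have "(\<integral>\<^sup>+\<omega>. ennreal (\<omega> (shift x (kernel n)) ^ (2 * k)) \<partial>P) \<le> ennreal (C * (LINT z|\<mu>. \<bar>shift x (kernel n) z\<bar>))"
      by (rule C(2)[OF shift_schwartz[OF kernel_schwartz x] _ L]) (auto simp: shift_def K_def intro: order_trans[OF kernel_bound])
    also have "\<dots> \<le> ennreal (C * K)" by (intro ennreal_leI mult_left_mono L C)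
    finally show ?thesis by (simp add: field_approx_eq[OF x])
  qed
  then show ?thesis using C(1) K0 by (intro exI[of _ "C * K"]) auto
qed

text \<open>Here linearity in the L1 norm pays off: L1 convergence of the kernels becomes mean
  square convergence of the fields, uniformly in the point.\<close>

lemma approx_diff_bound:
  "\<exists>C\<ge>0. \<forall>m n. \<forall>x\<in>Gam \<delta>. (\<integral>\<^sup>+\<omega>. ennreal ((field_approx m \<omega> x - field_approx n \<omega> x)\<^sup>2) \<partial>P) \<le>
    ennreal (C * (kernel_err m + kernel_err n))"
proof -
  define K where "K = max (2 * green_sup) (2 * green_L1)"
  obtain C where C: "0 \<le> C" "\<And>g. g \<in> schwartz \<delta> \<Longrightarrow> (\<forall>x. \<bar>g x\<bar> \<le> K) \<Longrightarrow> (LINT x|\<mu>. \<bar>g x\<bar>) \<le> K \<Longrightarrow>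
    (\<integral>\<^sup>+\<omega>. ennreal (\<omega> g ^ (2 * 1)) \<partial>P) \<le> ennreal (C * (LINT x|\<mu>. \<bar>g x\<bar>))"
    using noise_moment_bound[of 1 K] by auto
  have "(\<integral>\<^sup>+\<omega>. ennreal ((field_approx m \<omega> x - field_approx n \<omega> x)\<^sup>2) \<partial>P) \<le> ennreal (C * (kernel_err m + kernel_err n))"
    if x: "x \<in> Gam \<delta>" for m n x
  proof -
    let ?g = "\<lambda>z. kernel m z - kernel n z"
    note gs = diff_schwartz[OF kernel_schwartz kernel_schwartz]
    have eq: "field_approx m \<omega> x - field_approx n \<omega> x = \<omega> (shift x ?g)" if "\<omega> \<in> space P" for \<omega>
    proof -
      have "tempered \<omega>" using that by (intro dual_tempered) (simp add: space_P)
      from tempered_diff[OF this shift_schwartz[OF kernel_schwartz x] shift_schwartz[OF kernel_schwartz x], of m n]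
      show ?thesis by (simp add: field_approx_eq[OF x] shift_def)
    qed
    have L: "(LINT z|\<mu>. \<bar>shift x ?g z\<bar>) = (LINT z|\<mu>. \<bar>?g z\<bar>)"
      by (rule integral_abs_shift[OF schwartz_measurable[OF gs] x])
    have "(LINT z|\<mu>. \<bar>?g z\<bar>) \<le> (LINT z|\<mu>. \<bar>kernel m z\<bar> + \<bar>kernel n z\<bar>)"
      by (intro integral_mono Bochner_Integration.integrable_add integrable_abs rapid_integrable_0 schwartz_rapid gs kernel_schwartz) linarith
    also have "\<dots> = (LINT z|\<mu>. \<bar>kernel m z\<bar>) + (LINT z|\<mu>. \<bar>kernel n z\<bar>)"
      by (intro Bochner_Integration.integral_add integrable_abs rapid_integrable_0 schwartz_rapid kernel_schwartz)
    finally have L2: "(LINT z|\<mu>. \<bar>?g z\<bar>) \<le> K"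
      using kernel_L1[of m] kernel_L1[of n] by (simp add: K_def)
    have gK: "\<bar>shift x ?g z\<bar> \<le> K" for z
      using kernel_bound[of m "z - x"] kernel_bound[of n "z - x"] unfolding K_def shift_def by linarith
    have "(\<integral>\<^sup>+\<omega>. ennreal ((field_approx m \<omega> x - field_approx n \<omega> x)\<^sup>2) \<partial>P) = (\<integral>\<^sup>+\<omega>. ennreal (\<omega> (shift x ?g) ^ (2 * 1)) \<partial>P)"
      by (rule nn_integral_cong) (simp add: eq)
    also have "\<dots> \<le> ennreal (C * (LINT z|\<mu>. \<bar>shift x ?g z\<bar>))"
      by (rule C(2)[OF shift_schwartz[OF gs x]]) (use gK L2 in \<open>auto simp: L\<close>)
    also have "\<dots> \<le> ennreal (C * (kernel_err m + kernel_err n))"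
      unfolding L by (intro ennreal_leI mult_left_mono kernel_diff_L1 C)
    finally show ?thesis .
  qed
  then show ?thesis using C(1) by blast
qed

section \<open>Summable increments and the limiting version\<close>

abbreviation wgt :: "'d point \<Rightarrow> real" where
  "wgt x \<equiv> 1 / wt (CARD('d) + 1) x"

lemma wgt_nonneg: "0 \<le> wgt x"
  by simp

lemma wgt_measurable [measurable]: "wgt \<in> borel_measurable \<mu>"
  by measurable

lemma nn_integral_wgt: "(\<integral>\<^sup>+x. ennreal (wgt x) \<partial>\<mu>) < \<infinity>"
  using integrable_inverse_wt[where 'd = 'd] by (simp add: integrable_iff_bounded)

text \<open>Tonelli's theorem on the product of \<open>P\<close> and the cylinder: expectations
  bounded uniformly in the point, integrated against a finite weight, give a finite expectation of
  the weighted integral.\<close>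

lemma AE_weighted_integral_finite:
  fixes F :: "('d fn \<Rightarrow> real) \<Rightarrow> 'd point \<Rightarrow> ennreal"
  assumes F: "(\<lambda>p. F (fst p) (snd p)) \<in> borel_measurable (P \<Otimes>\<^sub>M \<mu>)"
    and B: "\<And>x. x \<in> Gam \<delta> \<Longrightarrow> (\<integral>\<^sup>+\<omega>. F \<omega> x \<partial>P) \<le> B" and fin: "B < \<infinity>"
  shows "AE \<omega> in P. (\<integral>\<^sup>+x. F \<omega> x * ennreal (wgt x) \<partial>\<mu>) < \<infinity>"
proof -
  interpret mu: sigma_finite_measure "\<mu> :: 'd point measure" by (rule sigma_finite_\<mu>)
  interpret pair_sigma_finite P "\<mu> :: 'd point measure" ..
  have m: "(\<lambda>p. F (fst p) (snd p) * ennreal (wgt (snd p))) \<in> borel_measurable (P \<Otimes>\<^sub>M \<mu>)"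
    by (intro borel_measurable_times_ennreal F measurable_compose[OF measurable_snd]) measurable
  then have m': "(\<lambda>(\<omega>, x). F \<omega> x * ennreal (wgt x)) \<in> borel_measurable (P \<Otimes>\<^sub>M \<mu>)"
    by (simp add: case_prod_beta)
  have F1: "(\<lambda>\<omega>. F \<omega> x) \<in> borel_measurable P" if "x \<in> Gam \<delta>" for x
    using measurable_Pair1[of "\<lambda>p. F (fst p) (snd p)" P \<mu> borel x] F that by simp
  have "(\<integral>\<^sup>+\<omega>. (\<integral>\<^sup>+x. F \<omega> x * ennreal (wgt x) \<partial>\<mu>) \<partial>P) = (\<integral>\<^sup>+x. (\<integral>\<^sup>+\<omega>. F \<omega> x * ennreal (wgt x) \<partial>P) \<partial>\<mu>)"
    by (rule Fubini'[OF m', symmetric])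
  also have "\<dots> \<le> (\<integral>\<^sup>+x. B * ennreal (wgt x) \<partial>\<mu>)"
  proof (rule nn_integral_mono)
    fix x :: "'d point" assume "x \<in> space \<mu>"
    then have x: "x \<in> Gam \<delta>" by simp
    have "(\<integral>\<^sup>+\<omega>. F \<omega> x * ennreal (wgt x) \<partial>P) = (\<integral>\<^sup>+\<omega>. F \<omega> x \<partial>P) * ennreal (wgt x)"
      by (rule nn_integral_multc[OF F1[OF x]])
    also have "\<dots> \<le> B * ennreal (wgt x)" by (intro mult_right_mono B x) simp
    finally show "(\<integral>\<^sup>+\<omega>. F \<omega> x * ennreal (wgt x) \<partial>P) \<le> B * ennreal (wgt x)" .
  qed
  also have "\<dots> = B * (\<integral>\<^sup>+x. ennreal (wgt x) \<partial>\<mu>)"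
    by (rule nn_integral_cmult) measurable
  also have "\<dots> < \<infinity>" using fin nn_integral_wgt by (simp add: ennreal_mult_less_top)
  finally have "(\<integral>\<^sup>+\<omega>. (\<integral>\<^sup>+x. F \<omega> x * ennreal (wgt x) \<partial>\<mu>) \<partial>P) \<noteq> \<infinity>" by simp
  moreover have "(\<lambda>\<omega>. \<integral>\<^sup>+x. F \<omega> x * ennreal (wgt x) \<partial>\<mu>) \<in> borel_measurable P"
    by (rule mu.borel_measurable_nn_integral[OF m'])
  ultimately have "AE \<omega> in P. (\<integral>\<^sup>+x. F \<omega> x * ennreal (wgt x) \<partial>\<mu>) \<noteq> \<infinity>"
    by (intro nn_integral_noteq_infinite)
  then show ?thesis by eventually_elim (simp add: less_top)
qed

text \<open>Mean square increments of order \<open>(1/4)^j\<close> give first moments of order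
  \<open>(1/2)^j\<close>, which are summable. The condition \<open>j \<le> n\<close> makes the
  indices tend to infinity.\<close>

definition subseq :: "nat \<Rightarrow> nat" where
  "subseq j = (SOME n. j \<le> n \<and> kernel_err n \<le> (1 / 4) ^ j)"

lemma subseq: "j \<le> subseq j" "kernel_err (subseq j) \<le> (1 / 4) ^ j"
proof -
  have "\<forall>\<^sub>F n in sequentially. kernel_err n < (1 / 4) ^ j"
    using kernel_err_tendsto by (rule order_tendstoD) simp
  then obtain N where "\<And>n. N \<le> n \<Longrightarrow> kernel_err n < (1 / 4) ^ j"
    unfolding eventually_sequentially by blast
  then have "j \<le> max j N \<and> kernel_err (max j N) \<le> (1 / 4) ^ j" by (simp add: less_imp_le)
  then have "j \<le> subseq j \<and> kernel_err (subseq j) \<le> (1 / 4) ^ j"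
    unfolding subseq_def by (rule someI)
  then show "j \<le> subseq j" "kernel_err (subseq j) \<le> (1 / 4) ^ j" by auto
qed

abbreviation approx :: "nat \<Rightarrow> ('d fn \<Rightarrow> real) \<Rightarrow> 'd fn" where
  "approx j \<equiv> field_approx (subseq j)"

text \<open>Plays two roles: where it is finite the approximations converge, and there it dominates
  all of them at once. It does not involve a test function, so neither does the exceptional null
  set.\<close>

definition majorant :: "('d fn \<Rightarrow> real) \<Rightarrow> 'd point \<Rightarrow> ennreal" where
  "majorant \<omega> x = ennreal \<bar>approx 0 \<omega> x\<bar> + (\<Sum>j. ennreal \<bar>approx (Suc j) \<omega> x - approx j \<omega> x\<bar>)"

text \<open>The default 0 is taken on a measurable set that depends on the pair of
  \<open>\<omega>\<close> and \<open>x\<close> jointly, which keeps the whole function jointly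
  measurable.\<close>

definition version :: "('d fn \<Rightarrow> real) \<Rightarrow> 'd fn" where
  "version \<omega> x = (if majorant \<omega> x < \<infinity> then lim (\<lambda>j. approx j \<omega> x) else 0)"

lemma majorant_measurable: "(\<lambda>p. majorant (fst p) (snd p)) \<in> borel_measurable (P \<Otimes>\<^sub>M \<mu>)"
proof -
  note [measurable] = field_approx_measurable
  show ?thesis unfolding majorant_def by measurable
qed

lemma version_measurable: "(\<lambda>p. version (fst p) (snd p)) \<in> borel_measurable (P \<Otimes>\<^sub>M \<mu>)"
proof -
  note [measurable] = majorant_measurable borel_measurable_lim_metric[OF field_approx_measurable]
  show ?thesis unfolding version_def by measurable
qed

lemma
  assumes "majorant \<omega> x < \<infinity>"
  shows approx_le_majorant: "\<bar>approx j \<omega> x\<bar> \<le> enn2real (majorant \<omega> x)"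
    and approx_tendsto_version: "(\<lambda>j. approx j \<omega> x) \<longlonglongrightarrow> version \<omega> x"
proof -
  let ?D = "\<lambda>j. approx (Suc j) \<omega> x - approx j \<omega> x"
  have fin: "(\<Sum>j. ennreal \<bar>?D j\<bar>) < \<infinity>" using assms by (simp add: majorant_def)
  then have s: "summable (\<lambda>j. \<bar>?D j\<bar>)" by (intro summable_suminf_not_top) auto
  have tele: "approx j \<omega> x = approx 0 \<omega> x + (\<Sum>i<j. ?D i)" for j
    by (induction j) auto
  have maj: "majorant \<omega> x = ennreal (\<bar>approx 0 \<omega> x\<bar> + (\<Sum>j. \<bar>?D j\<bar>))"
    unfolding majorant_def using s by (simp add: suminf_ennreal2 suminf_nonneg)
  have "\<bar>approx j \<omega> x\<bar> \<le> \<bar>approx 0 \<omega> x\<bar> + (\<Sum>i<j. \<bar>?D i\<bar>)"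
    unfolding tele[of j] by (rule order_trans[OF abs_triangle_ineq add_left_mono[OF sum_abs]])
  also have "\<dots> \<le> \<bar>approx 0 \<omega> x\<bar> + (\<Sum>j. \<bar>?D j\<bar>)"
    by (intro add_left_mono sum_le_suminf s) auto
  also have "\<dots> = enn2real (majorant \<omega> x)"
    unfolding maj using suminf_nonneg[OF s] by (intro enn2real_ennreal[symmetric]) simp
  finally show "\<bar>approx j \<omega> x\<bar> \<le> enn2real (majorant \<omega> x)" .
  have "(\<lambda>j. approx 0 \<omega> x + (\<Sum>i<j. ?D i)) \<longlonglongrightarrow> approx 0 \<omega> x + suminf ?D"
    by (rule tendsto_add[OF tendsto_const summable_LIMSEQ[OF summable_rabs_cancel[OF s]]])
  then have "(\<lambda>j. approx j \<omega> x) \<longlonglongrightarrow> approx 0 \<omega> x + suminf ?D"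
    unfolding tele[symmetric] .
  then show "(\<lambda>j. approx j \<omega> x) \<longlonglongrightarrow> version \<omega> x"
    using assms by (simp add: version_def limI)
qed

lemma majorant_moment: "\<exists>B<\<infinity>. \<forall>x\<in>Gam \<delta>. (\<integral>\<^sup>+\<omega>. majorant \<omega> x \<partial>P) \<le> B"
proof -
  obtain B where B: "0 \<le> B" "\<And>n x. x \<in> Gam \<delta> \<Longrightarrow> (\<integral>\<^sup>+\<omega>. ennreal (field_approx n \<omega> x ^ (2 * 1)) \<partial>P) \<le> ennreal B"
    using approx_moment_bound[of 1] by auto
  obtain C where C: "0 \<le> C" "\<And>m n x. x \<in> Gam \<delta> \<Longrightarrow>
    (\<integral>\<^sup>+\<omega>. ennreal ((field_approx m \<omega> x - field_approx n \<omega> x)\<^sup>2) \<partial>P) \<le> ennreal (C * (kernel_err m + kernel_err n))"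
    using approx_diff_bound by blast
  \<comment> \<open>The parameter \<open>c\<close> is left free, to be adapted to the size of the
    second moment of each increment.\<close>
  have abs_le: "(\<integral>\<^sup>+\<omega>. ennreal \<bar>f \<omega>\<bar> \<partial>P) \<le> ennreal (c + b / c)"
    if [measurable]: "f \<in> borel_measurable P" and c: "0 < c" and b: "0 \<le> b"
      and fb: "(\<integral>\<^sup>+\<omega>. ennreal ((f \<omega>)\<^sup>2) \<partial>P) \<le> ennreal b" for f b c
  proof -
    have "(\<integral>\<^sup>+\<omega>. ennreal \<bar>f \<omega>\<bar> \<partial>P) \<le> (\<integral>\<^sup>+\<omega>. ennreal c + ennreal (1 / c) * ennreal ((f \<omega>)\<^sup>2) \<partial>P)"
    proof (rule nn_integral_mono)
      fix \<omega>
      have "ennreal \<bar>f \<omega>\<bar> \<le> ennreal (c + 1 / c * (f \<omega>)\<^sup>2)"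
        using abs_le_add_square_div[OF c, of "f \<omega>"] by (intro ennreal_leI) simp
      also have "\<dots> = ennreal c + ennreal (1 / c) * ennreal ((f \<omega>)\<^sup>2)"
        using c by (simp add: ennreal_plus ennreal_mult'[symmetric])
      finally show "ennreal \<bar>f \<omega>\<bar> \<le> ennreal c + ennreal (1 / c) * ennreal ((f \<omega>)\<^sup>2)" .
    qed
    also have "\<dots> = ennreal c + ennreal (1 / c) * (\<integral>\<^sup>+\<omega>. ennreal ((f \<omega>)\<^sup>2) \<partial>P)"
      by (simp add: nn_integral_add nn_integral_cmult P.emeasure_space_1)
    also have "\<dots> \<le> ennreal c + ennreal (1 / c) * ennreal b"
      by (intro add_left_mono mult_left_mono fb) simp
    also have "\<dots> = ennreal (c + b / c)"
      using b c by (simp add: ennreal_plus ennreal_mult'[symmetric])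
    finally show ?thesis .
  qed
  have "(\<integral>\<^sup>+\<omega>. majorant \<omega> x \<partial>P) \<le> ennreal (1 + B / 1) + ennreal ((1 + 2 * C) * 2)" if x: "x \<in> Gam \<delta>" for x
  proof -
    note [measurable] = field_approx_measurable_at[OF x]
    have 0: "(\<integral>\<^sup>+\<omega>. ennreal \<bar>approx 0 \<omega> x\<bar> \<partial>P) \<le> ennreal (1 + B / 1)"
      by (rule abs_le) (use B x in auto)
    have D: "(\<integral>\<^sup>+\<omega>. ennreal \<bar>approx (Suc j) \<omega> x - approx j \<omega> x\<bar> \<partial>P) \<le> ennreal ((1 + 2 * C) * (1 / 2) ^ j)" for j
    proof -
      have "kernel_err (subseq (Suc j)) + kernel_err (subseq j) \<le> (1 / 4) ^ Suc j + (1 / 4) ^ j"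
        by (intro add_mono subseq)
      also have "\<dots> \<le> 2 * (1 / 4 :: real) ^ j" by simp
      finally have "C * (kernel_err (subseq (Suc j)) + kernel_err (subseq j)) \<le> C * (2 * (1 / 4) ^ j)"
        by (rule mult_left_mono[OF _ C(1)])
      then have "(\<integral>\<^sup>+\<omega>. ennreal ((approx (Suc j) \<omega> x - approx j \<omega> x)\<^sup>2) \<partial>P) \<le> ennreal (C * (2 * (1 / 4) ^ j))"
        using C(2)[OF x, of "subseq (Suc j)" "subseq j"] by (meson ennreal_leI order_trans)
      \<comment> \<open>With \<open>c = (1/2)^j\<close> and a second moment of order
        \<open>(1/4)^j\<close>, both \<open>c\<close> and \<open>b / c\<close> are of order
        \<open>(1/2)^j\<close>.\<close>
      then have "(\<integral>\<^sup>+\<omega>. ennreal \<bar>approx (Suc j) \<omega> x - approx j \<omega> x\<bar> \<partial>P) \<le> ennreal ((1 / 2) ^ j + C * (2 * (1 / 4) ^ j) / (1 / 2) ^ j)"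
        using C(1) by (intro abs_le) auto
      also have "(1 / 2) ^ j + C * (2 * (1 / 4) ^ j) / (1 / 2) ^ j = (1 + 2 * C) * (1 / 2) ^ j"
      proof -
        have "(1 / 4 :: real) ^ j = (1 / 2) ^ j * (1 / 2) ^ j" by (simp add: power_mult_distrib[symmetric])
        then show ?thesis by (simp add: distrib_right)
      qed
      finally show ?thesis .
    qed
    have "(\<integral>\<^sup>+\<omega>. majorant \<omega> x \<partial>P) = (\<integral>\<^sup>+\<omega>. ennreal \<bar>approx 0 \<omega> x\<bar> \<partial>P) + (\<Sum>j. \<integral>\<^sup>+\<omega>. ennreal \<bar>approx (Suc j) \<omega> x - approx j \<omega> x\<bar> \<partial>P)"
      unfolding majorant_def by (simp add: nn_integral_add nn_integral_suminf)
    also have "\<dots> \<le> ennreal (1 + B / 1) + (\<Sum>j. ennreal ((1 + 2 * C) * (1 / 2) ^ j))"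
      by (intro add_mono 0 suminf_le D) auto
    also have "(\<Sum>j. ennreal ((1 + 2 * C) * (1 / 2) ^ j)) = ennreal ((1 + 2 * C) * 2)"
    proof -
      have "(\<lambda>j. (1 + 2 * C) * (1 / 2 :: real) ^ j) sums ((1 + 2 * C) * (1 / (1 - 1 / 2)))"
        by (intro sums_mult geometric_sums) simp
      then show ?thesis using C(1) by (simp add: suminf_ennreal2 sums_iff)
    qed
    finally show ?thesis .
  qed
  then show ?thesis by (intro exI[of _ "ennreal (1 + B / 1) + ennreal ((1 + 2 * C) * 2)"]) auto
qed

text \<open>Fatou's lemma along the subsequence. Where the default value applies, the integrand is 0
  because the exponent is positive.\<close>

lemma version_moment:
  assumes k: "0 < k"
  shows "\<exists>B<\<infinity>. \<forall>x\<in>Gam \<delta>. (\<integral>\<^sup>+\<omega>. ennreal (version \<omega> x ^ (2 * k)) \<partial>P) \<le> B"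
proof -
  obtain B where B: "0 \<le> B" "\<And>n x. x \<in> Gam \<delta> \<Longrightarrow> (\<integral>\<^sup>+\<omega>. ennreal (field_approx n \<omega> x ^ (2 * k)) \<partial>P) \<le> ennreal B"
    using approx_moment_bound[OF k] by blast
  have "(\<integral>\<^sup>+\<omega>. ennreal (version \<omega> x ^ (2 * k)) \<partial>P) \<le> ennreal B" if x: "x \<in> Gam \<delta>" for x
  proof -
    note [measurable] = field_approx_measurable_at[OF x]
    have "(\<integral>\<^sup>+\<omega>. ennreal (version \<omega> x ^ (2 * k)) \<partial>P) \<le> (\<integral>\<^sup>+\<omega>. liminf (\<lambda>j. ennreal (approx j \<omega> x ^ (2 * k))) \<partial>P)"
    proof (rule nn_integral_mono)
      fix \<omega>
      show "ennreal (version \<omega> x ^ (2 * k)) \<le> liminf (\<lambda>j. ennreal (approx j \<omega> x ^ (2 * k)))"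
      proof (cases "majorant \<omega> x < \<infinity>")
        case True
        have "(\<lambda>j. ennreal (approx j \<omega> x ^ (2 * k))) \<longlonglongrightarrow> ennreal (version \<omega> x ^ (2 * k))"
          by (intro tendsto_ennrealI tendsto_power approx_tendsto_version True)
        then have "liminf (\<lambda>j. ennreal (approx j \<omega> x ^ (2 * k))) = ennreal (version \<omega> x ^ (2 * k))"
          by (intro lim_imp_Liminf) auto
        then show ?thesis by simp
      next
        case False
        moreover have "(0 :: real) ^ (2 * k) = 0" using k by simp
        ultimately show ?thesis by (simp only: version_def if_False ennreal_0 zero_le)
      qed
    qed
    also have "\<dots> \<le> liminf (\<lambda>j. \<integral>\<^sup>+\<omega>. ennreal (approx j \<omega> x ^ (2 * k)) \<partial>P)"
      by (rule nn_integral_liminf) measurable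
    also have "\<dots> \<le> ennreal B"
      by (rule order_trans[OF Liminf_le_Limsup Limsup_bounded], simp, rule always_eventually, rule allI, rule B(2)[OF x])
    finally show ?thesis .
  qed
  then show ?thesis by (intro exI[of _ "ennreal B"]) auto
qed

text \<open>The even moment of order \<open>2 * Suc k\<close> controls the k-th power, also for
  \<open>k = 0\<close>, and countably many \<open>k\<close> leave a single null set. The moments are
  bounded uniformly in the point, so the weight exponent \<open>CARD('d) + 1\<close> serves for
  every \<open>k\<close>.\<close>

lemma version_in_M_b: "AE \<omega> in P. version \<omega> \<in> M_b \<delta>"
proof -
  have "AE \<omega> in P. (\<integral>\<^sup>+x. ennreal (version \<omega> x ^ (2 * Suc k)) * ennreal (wgt x) \<partial>\<mu>) < \<infinity>" for k
  proof -
    obtain B where B: "B < \<infinity>" "\<And>x. x \<in> Gam \<delta> \<Longrightarrow> (\<integral>\<^sup>+\<omega>. ennreal (version \<omega> x ^ (2 * Suc k)) \<partial>P) \<le> B"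
      using version_moment[of "Suc k"] by auto
    show ?thesis
    proof (rule AE_weighted_integral_finite[OF _ B(2) B(1)])
      note [measurable] = version_measurable
      show "(\<lambda>p. ennreal (version (fst p) (snd p) ^ (2 * Suc k))) \<in> borel_measurable (P \<Otimes>\<^sub>M \<mu>)" by measurable
    qed
  qed
  then have "AE \<omega> in P. \<forall>k. (\<integral>\<^sup>+x. ennreal (version \<omega> x ^ (2 * Suc k)) * ennreal (wgt x) \<partial>\<mu>) < \<infinity>"
    unfolding AE_all_countable by (rule allI)
  with AE_space show ?thesis
  proof eventually_elim
    case (elim \<omega>)
    have m[measurable]: "version \<omega> \<in> borel_measurable \<mu>"
      using measurable_Pair2[of "\<lambda>p. version (fst p) (snd p)" P \<mu> borel \<omega>] version_measurable elim(1) by simp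
    have "(\<integral>\<^sup>+x. ennreal (\<bar>version \<omega> x\<bar> ^ k / (1 + (norm x)\<^sup>2) ^ (CARD('d) + 1)) \<partial>\<mu>) < \<infinity>" for k
    proof -
      have "(\<integral>\<^sup>+x. ennreal (\<bar>version \<omega> x\<bar> ^ k / (1 + (norm x)\<^sup>2) ^ (CARD('d) + 1)) \<partial>\<mu>) \<le>
        (\<integral>\<^sup>+x. ennreal (wgt x) + ennreal (version \<omega> x ^ (2 * Suc k)) * ennreal (wgt x) \<partial>\<mu>)"
      proof (rule nn_integral_mono)
        fix x
        let ?u = "version \<omega> x"
        have "\<bar>?u\<bar> ^ k \<le> 1 + ?u ^ (2 * Suc k)"
          by (rule abs_power_le) simp
        then have "\<bar>?u\<bar> ^ k * wgt x \<le> (1 + ?u ^ (2 * Suc k)) * wgt x"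
          by (rule mult_right_mono) simp
        then have "ennreal (\<bar>?u\<bar> ^ k * wgt x) \<le> ennreal ((1 + ?u ^ (2 * Suc k)) * wgt x)"
          by (rule ennreal_leI)
        also have "\<dots> = ennreal (wgt x + ?u ^ (2 * Suc k) * wgt x)" by (simp only: distrib_right mult_1)
        also have "\<dots> = ennreal (wgt x) + ennreal (?u ^ (2 * Suc k) * wgt x)"
          by (rule ennreal_plus[OF wgt_nonneg]) (intro mult_nonneg_nonneg wgt_nonneg, simp only: power_mult zero_le_power zero_le_power2)
        also have "ennreal (?u ^ (2 * Suc k) * wgt x) = ennreal (?u ^ (2 * Suc k)) * ennreal (wgt x)"
          by (rule ennreal_mult') (simp only: power_mult zero_le_power zero_le_power2)
        finally show "ennreal (\<bar>?u\<bar> ^ k / (1 + (norm x)\<^sup>2) ^ (CARD('d) + 1)) \<le> ennreal (wgt x) + ennreal (?u ^ (2 * Suc k)) * ennreal (wgt x)"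
          by (simp only: wt_def times_divide_eq_right mult_1_right)
      qed
      also have "\<dots> = (\<integral>\<^sup>+x. ennreal (wgt x) \<partial>\<mu>) + (\<integral>\<^sup>+x. ennreal (version \<omega> x ^ (2 * Suc k)) * ennreal (wgt x) \<partial>\<mu>)"
        by (rule nn_integral_add) measurable
      also have "\<dots> < \<infinity>" using nn_integral_wgt elim(2) by simp
      finally show ?thesis .
    qed
    then show ?case using m unfolding M_b_def by blast
  qed
qed

text \<open>A statement about one \<open>\<omega>\<close> and all \<open>\<phi>\<close>: a Schwartz
  function is at most a multiple of \<open>wgt\<close>, so the weighted majorant dominates for every
  \<open>\<phi>\<close>. The integrals of the approximations are \<open>field\<close> at the
  mollified \<open>\<phi>\<close>, and these converge by continuity of the functional.\<close>

lemma version_represents: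
  assumes \<omega>: "\<omega> \<in> space P" and fin: "(\<integral>\<^sup>+x. majorant \<omega> x * ennreal (wgt x) \<partial>\<mu>) < \<infinity>" and \<phi>: "\<phi> \<in> schwartz \<delta>"
  shows "integrable \<mu> (\<lambda>x. version \<omega> x * \<phi> x)"
    and "conv_noise \<delta> m0 \<phi> \<omega> = (LINT x|\<mu>. version \<omega> x * \<phi> x)"
proof -
  note [measurable] = schwartz_measurable[OF \<phi>]
  have am [measurable]: "approx j \<omega> \<in> borel_measurable \<mu>" for j
    using measurable_Pair2[of "\<lambda>p. approx j (fst p) (snd p)" P \<mu> borel \<omega>] field_approx_measurable \<omega> by simp
  have vm [measurable]: "version \<omega> \<in> borel_measurable \<mu>"
    using measurable_Pair2[of "\<lambda>p. version (fst p) (snd p)" P \<mu> borel \<omega>] version_measurable \<omega> by simp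
  have mm [measurable]: "majorant \<omega> \<in> borel_measurable \<mu>"
    using measurable_Pair2[of "\<lambda>p. majorant (fst p) (snd p)" P \<mu> borel \<omega>] majorant_measurable \<omega> by simp
  let ?q = "schwartz_seminorm \<delta> (CARD('d) + 1) 0 \<phi>"
  let ?B = "\<lambda>x. ?q * (enn2real (majorant \<omega> x) * wgt x)"
  have \<phi>b: "\<bar>\<phi> x\<bar> \<le> ?q * wgt x" for x
    using time_deriv_bound[OF \<phi>, of 0 x "CARD('d) + 1"] by simp
  have AEf: "AE x in \<mu>. majorant \<omega> x < \<infinity>"
  proof -
    have "AE x in \<mu>. majorant \<omega> x * ennreal (wgt x) \<noteq> \<infinity>"
      using fin by (intro nn_integral_noteq_infinite) auto
    then show ?thesis
    proof eventually_elim
      case (elim x)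
      have "0 < wgt x" using wt_pos[of "CARD('d) + 1" x] by simp
      then have "ennreal (wgt x) \<noteq> 0" by simp
      with elim show ?case by (auto simp: ennreal_mult_eq_top_iff less_top)
    qed
  qed
  have Bi: "integrable \<mu> ?B"
  proof (intro integrable_mult_right integrableI_bounded)
    show "(\<lambda>x. enn2real (majorant \<omega> x) * wgt x) \<in> borel_measurable \<mu>" by measurable
    have "(\<integral>\<^sup>+x. ennreal (norm (enn2real (majorant \<omega> x) * wgt x)) \<partial>\<mu>) \<le> (\<integral>\<^sup>+x. majorant \<omega> x * ennreal (wgt x) \<partial>\<mu>)"
    proof (rule nn_integral_mono)
      fix x
      have "norm (enn2real (majorant \<omega> x) * wgt x) = enn2real (majorant \<omega> x) * wgt x"
        unfolding real_norm_def by (intro abs_of_nonneg mult_nonneg_nonneg wgt_nonneg enn2real_nonneg)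
      then have "ennreal (norm (enn2real (majorant \<omega> x) * wgt x)) = ennreal (enn2real (majorant \<omega> x)) * ennreal (wgt x)"
        by (simp only: ennreal_mult'[OF enn2real_nonneg])
      \<comment> \<open>Only an inequality, since \<open>enn2real\<close> sends infinity to
        0.\<close>
      also have "\<dots> \<le> majorant \<omega> x * ennreal (wgt x)"
        by (rule mult_right_mono) (simp_all add: ennreal_enn2real_if)
      finally show "ennreal (norm (enn2real (majorant \<omega> x) * wgt x)) \<le> majorant \<omega> x * ennreal (wgt x)" .
    qed
    with fin show "(\<integral>\<^sup>+x. ennreal (norm (enn2real (majorant \<omega> x) * wgt x)) \<partial>\<mu>) < \<infinity>" by (rule le_less_trans[rotated])
  qed
  have m1: "(\<lambda>x. version \<omega> x * \<phi> x) \<in> borel_measurable \<mu>" and m2: "\<And>j. (\<lambda>x. approx j \<omega> x * \<phi> x) \<in> borel_measurable \<mu>"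
    by measurable
  have lim: "AE x in \<mu>. (\<lambda>j. approx j \<omega> x * \<phi> x) \<longlonglongrightarrow> version \<omega> x * \<phi> x"
    using AEf by eventually_elim (intro tendsto_mult_right approx_tendsto_version)
  have dom: "AE x in \<mu>. norm (approx j \<omega> x * \<phi> x) \<le> ?B x" for j
    using AEf
  proof eventually_elim
    case (elim x)
    have "\<bar>approx j \<omega> x\<bar> * \<bar>\<phi> x\<bar> \<le> enn2real (majorant \<omega> x) * (?q * wgt x)"
      by (intro mult_mono approx_le_majorant elim \<phi>b) auto
    then show ?case by (simp add: abs_mult mult_ac)
  qed
  show "integrable \<mu> (\<lambda>x. version \<omega> x * \<phi> x)"
    by (rule integrable_dominated_convergence[OF m1 m2 Bi lim dom])
  have "(\<lambda>j. LINT x|\<mu>. approx j \<omega> x * \<phi> x) \<longlonglongrightarrow> (LINT x|\<mu>. version \<omega> x * \<phi> x)"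
    by (rule integral_dominated_convergence[OF m1 m2 Bi lim dom])
  moreover have "(LINT x|\<mu>. approx j \<omega> x * \<phi> x) = field \<omega> (conv (moll (subseq j)) \<phi>)" for j
    unfolding field_approx_def
    by (rule commutes_bounded[OF field_tempered[OF \<omega>] moll_schwartz schwartz_rapid[OF \<phi>], symmetric])
      (use schwartz_bounded[OF \<phi>, of 0] in simp)
  moreover have "(\<lambda>j. field \<omega> (conv (moll (subseq j)) \<phi>)) \<longlonglongrightarrow> field \<omega> \<phi>"
  proof (rule filterlim_compose[OF tempered_conv_moll_tendsto[OF field_tempered[OF \<omega>] \<phi>]])
    show "filterlim subseq sequentially sequentially"
      using subseq(1) by (intro filterlim_at_top_mono[OF filterlim_ident]) auto
  qed
  ultimately have "field \<omega> \<phi> = (LINT x|\<mu>. version \<omega> x * \<phi> x)"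
    using LIMSEQ_unique by auto
  then show "conv_noise \<delta> m0 \<phi> \<omega> = (LINT x|\<mu>. version \<omega> x * \<phi> x)"
    by (simp add: conv_noise_def field_def Green_adjoint_eq[OF \<phi>])
qed

lemma version_of_noise: "version_of_conv_noise \<delta> m0 P version"
  unfolding version_of_conv_noise_def
proof
  show "(\<lambda>(\<omega>, x). version \<omega> x) \<in> borel_measurable (P \<Otimes>\<^sub>M Gam_measure \<delta>)"
    using version_measurable by (simp add: case_prod_beta)
  obtain B where B: "B < \<infinity>" "\<And>x. x \<in> Gam \<delta> \<Longrightarrow> (\<integral>\<^sup>+\<omega>. majorant \<omega> x \<partial>P) \<le> B"
    using majorant_moment by blast
  have "AE \<omega> in P. (\<integral>\<^sup>+x. majorant \<omega> x * ennreal (wgt x) \<partial>\<mu>) < \<infinity>"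
    by (rule AE_weighted_integral_finite[OF majorant_measurable B(2) B(1)])
  with AE_space show "AE \<omega> in P. \<forall>\<phi>\<in>schwartz \<delta>. integrable \<mu> (\<lambda>x. version \<omega> x * \<phi> x) \<and>
    conv_noise \<delta> m0 \<phi> \<omega> = (LINT x|\<mu>. version \<omega> x * \<phi> x)"
    by eventually_elim (use version_represents in blast)
qed

end

theorem proposition5p3:
  fixes \<delta> m0 a v :: real
    and M :: "real measure"
    and P :: "('d::finite fn \<Rightarrow> real) measure"
  assumes "\<delta> > 0" and "m0 > 0"
    and "v \<ge> 0" and "levy_measure M"
    and "\<And>n::nat. (\<integral>\<^sup>+ s. ennreal (s ^ (2 * n)) \<partial>M) < \<infinity>"
    and "levy_noise_law \<delta> (levy_char a v M) P"
  shows "\<exists>X. version_of_conv_noise \<delta> m0 P X \<and> (AE \<omega> in P. X \<omega> \<in> M_b \<delta>)"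
proof -
  interpret noise_field \<delta> m0 a v M P
    by unfold_locales (use assms in auto)
  show ?thesis using version_of_noise version_in_M_b by blast
qed

end
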